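(* Fix $p\in(0,1/2]$ and $\varepsilon>0$ with $(1+\varepsilon)p<1$. For integers $n,d\ge2$ let $G$ be the spherical random geometric graph on $n$ vertices with edge probability $p$ in dimension $d$, and let $|E(G)|$ be its number of edges. Then there exist constants $c,C>0$ (depending on $p$ and $\varepsilon$ but not on $n,d$) such that for all $n,d\ge 2$, $$\exp\left(-c\min(n^2,n\sqrt d)\right)\le\mathbb P\left(|E(G)|\ge(1+\varepsilon)\binom n2p\right)\le\exp\left(-C\min(n^2,n\sqrt d)\right).$$
   Context: Spherical random geometric graph: let $X_1,\dots,X_n$ be i.i.d. uniform on the unit sphere $\mathbb S^{d-1}\subset\mathbb R^d$ and let $t_p=t_{p,d}$ be such that $\mathbb P(\langle X_1,X_2\rangle\ge t_p)=p$. The graph has vertex set $\{1,\dots,n\}$, with an (undirected) edge between $i\ne j$ iff $\langle X_i,X_j\rangle\ge t_p$. *)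

theory Defs
  imports "HOL-Probability.Probability"
begin

text \<open>
  Vectors of $R^d$ are the elements of the carrier of the product space
  \<^term>\<open>Pi\<^sub>M {..<d} (\<lambda>_. borel)\<close>, that is, functions on \<^term>\<open>{..<d}\<close> extended by
  \<^term>\<open>undefined\<close>, so that the dimension is an ordinary natural number over which
  one can quantify.
\<close>

definition sphere_inner :: "nat \<Rightarrow> (nat \<Rightarrow> real) \<Rightarrow> (nat \<Rightarrow> real) \<Rightarrow> real" where
  "sphere_inner d x y = (\<Sum>k<d. x k * y k)"

definition euclidean_ball :: "nat \<Rightarrow> (nat \<Rightarrow> real) set" where
  "euclidean_ball d = {x \<in> space (Pi\<^sub>M {..<d} (\<lambda>_. lborel)). L2_set x {..<d} \<le> 1}"

definition euclidean_sphere :: "nat \<Rightarrow> (nat \<Rightarrow> real) set" where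
  "euclidean_sphere d = {x \<in> space (Pi\<^sub>M {..<d} (\<lambda>_. borel)). L2_set x {..<d} = 1}"

text \<open>
  The uniform distribution on the unit sphere is the normalised surface measure, obtained
  as usual by polar coordinates: the measure of a Borel set $A$ of unit vectors is the
  proportion of the unit ball occupied by the cone of all $r x$ with $x$ in $A$ and
  $r$ in $(0,1]$. Equivalently, it is the law of the direction of a uniform point of the ball.
  The origin, sent to itself by the division, is a null set for \<^prop>\<open>d \<ge> 1\<close>.
\<close>

definition uniform_sphere :: "nat \<Rightarrow> (nat \<Rightarrow> real) measure" where
  "uniform_sphere d =
     distr (uniform_measure (Pi\<^sub>M {..<d} (\<lambda>_. lborel)) (euclidean_ball d))
       (Pi\<^sub>M {..<d} (\<lambda>_. borel)) (\<lambda>x. \<lambda>k\<in>{..<d}. x k / L2_set x {..<d})"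

text \<open>
  The joint law of $n$ independent uniform points of the sphere; \<^term>\<open>X i\<close> is the $i$-th point.
\<close>

definition sphere_points :: "nat \<Rightarrow> nat \<Rightarrow> (nat \<Rightarrow> nat \<Rightarrow> real) measure" where
  "sphere_points n d = Pi\<^sub>M {1..n} (\<lambda>_. uniform_sphere d)"

definition is_threshold :: "real \<Rightarrow> nat \<Rightarrow> real \<Rightarrow> bool" where
  "is_threshold p d t \<longleftrightarrow>
     measure (sphere_points 2 d)
       {X \<in> space (sphere_points 2 d). sphere_inner d (X 1) (X 2) \<ge> t} = p"

definition rgg_edges :: "nat \<Rightarrow> nat \<Rightarrow> real \<Rightarrow> (nat \<Rightarrow> nat \<Rightarrow> real) \<Rightarrow> nat set set" where
  "rgg_edges n d t X =
     {{i, j} | i j. i \<in> {1..n} \<and> j \<in> {1..n} \<and> i \<noteq> j \<and> sphere_inner d (X i) (X j) \<ge> t}"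

lemma sets_uniform_sphere [measurable_cong]:
  "sets (uniform_sphere d) = sets (Pi\<^sub>M {..<d} (\<lambda>_. borel))"
  by (simp add: uniform_sphere_def)

lemma measurable_L2_set [measurable]:
  "(\<lambda>x. L2_set x {..<d}) \<in> borel_measurable (Pi\<^sub>M {..<d} (\<lambda>_. lborel :: real measure))"
  "(\<lambda>x. L2_set x {..<d}) \<in> borel_measurable (Pi\<^sub>M {..<d} (\<lambda>_. borel :: real measure))"
  unfolding L2_set_def by measurable

lemma measurable_normalise:
  "(\<lambda>x. \<lambda>k\<in>{..<d}. x k / L2_set x {..<d})
     \<in> Pi\<^sub>M {..<d} (\<lambda>_. lborel :: real measure) \<rightarrow>\<^sub>M Pi\<^sub>M {..<d} (\<lambda>_. borel)"
  by measurable

lemma emeasure_euclidean_ball: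
  "emeasure (Pi\<^sub>M {..<d} (\<lambda>_. lborel)) (euclidean_ball d) = ennreal (unit_ball_vol (real d))"
proof -
  have "euclidean_ball d = {f. sqrt (\<Sum>i\<in>{..<d}. (f i)\<^sup>2) \<le> 1} \<inter> space (Pi\<^sub>M {..<d} (\<lambda>_. lborel))"
    by (auto simp: euclidean_ball_def L2_set_def)
  then show ?thesis
    using emeasure_cball_aux[of "{..<d}" 1] by simp
qed

lemma prob_space_uniform_sphere: "prob_space (uniform_sphere d)"
proof -
  have "prob_space (uniform_measure (Pi\<^sub>M {..<d} (\<lambda>_. lborel)) (euclidean_ball d))"
    using unit_ball_vol_pos[of "real d"]
    by (intro prob_space_uniform_measure) (simp_all add: emeasure_euclidean_ball del: unit_ball_vol_pos)
  then show ?thesis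
    unfolding uniform_sphere_def
    by (rule prob_space.prob_space_distr) (simp add: measurable_normalise)
qed

lemma prob_space_sphere_points: "prob_space (sphere_points n d)"
  unfolding sphere_points_def by (rule prob_space_PiM) (rule prob_space_uniform_sphere)

lemma AE_uniform_sphere:
  assumes "d \<ge> 1"
  shows "AE x in uniform_sphere d. x \<in> euclidean_sphere d"
proof -
  let ?L = "Pi\<^sub>M {..<d} (\<lambda>_. lborel :: real measure)"
  interpret product_sigma_finite "\<lambda>_::nat. lborel :: real measure" ..
  have eq: "{x \<in> space ?L. L2_set x {..<d} = 0} = (\<Pi>\<^sub>E k\<in>{..<d}. {0})"
    by (auto simp: space_PiM L2_set_eq_0_iff PiE_iff extensional_def fun_eq_iff)
  have "emeasure ?L (\<Pi>\<^sub>E k\<in>{..<d}. {0}) = (\<Prod>k<d. emeasure lborel {0::real})"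
    by (rule emeasure_PiM) auto
  also have "\<dots> = 0" using assms by auto
  finally have null: "emeasure ?L {x \<in> space ?L. L2_set x {..<d} = 0} = 0"
    unfolding eq .
  have "{x \<in> space ?L. L2_set x {..<d} = 0} \<in> sets ?L"
    by measurable
  with null have "AE x in ?L. L2_set x {..<d} \<noteq> 0"
    by (intro AE_I[OF _ null]) auto
  moreover have "euclidean_ball d \<in> sets ?L"
    unfolding euclidean_ball_def by measurable
  ultimately have AE: "AE x in uniform_measure ?L (euclidean_ball d). L2_set x {..<d} \<noteq> 0"
    by (intro AE_uniform_measureI) auto
  have unit: "L2_set (\<lambda>k\<in>{..<d}. x k / L2_set x {..<d}) {..<d} = 1"
    if "L2_set x {..<d} \<noteq> 0" for x :: "nat \<Rightarrow> real"
  proof -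
    have "L2_set (\<lambda>k\<in>{..<d}. x k / L2_set x {..<d}) {..<d}
        = L2_set (\<lambda>k. inverse (L2_set x {..<d}) * x k) {..<d}"
      by (intro L2_set_cong) (auto simp: field_simps)
    also have "\<dots> = inverse (L2_set x {..<d}) * L2_set x {..<d}"
      by (rule L2_set_right_distrib[symmetric]) simp
    finally show ?thesis using that by simp
  qed
  have meas: "{x \<in> space (Pi\<^sub>M {..<d} (\<lambda>_. borel)). x \<in> euclidean_sphere d}
      \<in> sets (Pi\<^sub>M {..<d} (\<lambda>_. borel :: real measure))"
    unfolding euclidean_sphere_def by measurable
  show ?thesis
    unfolding uniform_sphere_def
    apply (subst AE_distr_iff)
      apply (simp add: measurable_normalise)
     apply (rule meas)
    using AE by eventually_elim (auto simp: euclidean_sphere_def unit space_PiM)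
qed

end

theory Submission
  imports Defs "HOL-Real_Asymp.Real_Asymp"
begin

text \<open>
  A uniform point of the sphere is the direction of a standard Gaussian vector. By rotation
  invariance, the Gram matrix of \<open>n \<le> d\<close> independent Gaussian vectors has the law of the Gram
  matrix of a triangular array: vector \<open>j\<close> keeps its first \<open>j - 1\<close> coordinates, followed by the
  norm of the remaining ones. If \<open>d\<close> is at least a large multiple of \<open>n\<^sup>2\<close>, the graph is then
  close to the one that joins \<open>i < j\<close> when coordinate \<open>i - 1\<close> of vector \<open>j\<close> exceeds
  \<open>t * sqrt d\<close>, an Erdos-Renyi graph: this gives the upper bound \<open>exp (- C * n\<^sup>2)\<close> by a
  Chernoff bound, and the lower bound by making all these coordinates large.

  For smaller \<open>d\<close>, Hoeffding's averaging over partitions of the vertices into \<open>n / m\<close> blocks of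
  size \<open>m\<close> of order \<open>sqrt d\<close> gives the upper bound \<open>exp (- C * m\<^sup>2 * (n / m))\<close>. Conversely, if the
  first coordinates of all Gaussian vectors are of order \<open>d\<close> to the power \<open>1 / 4\<close>, which costs
  \<open>exp (- c * sqrt d)\<close> per vertex, then all inner products are shifted by a large multiple of
  \<open>sqrt d\<close>, and all but a small proportion of the pairs are edges.
\<close>

section \<open>Invariance of Lebesgue measure under reflections\<close>

text \<open>The requirement that d be at least a multiple of n^2 reflects the size of the error
  probabilities: a norm deviates by a constant proportion with probability of order exp (- c d), and
  this must not exceed exp (- C n^2). At this precision the inner sums of the triangular array are
  not bounded one by one; their sum of squares is, at the price of giving away a small proportion of
  pairs.

  Apart from single pairs, where the edge probability is exactly p, the threshold enters through
  three consequences of its definition: |t| sqrt d is bounded for large d; the standard Gaussian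
  tail from slightly below t sqrt d is at most p + \<zeta>; and t stays below a constant s < 1 for
  all d \<ge> 2. The last one serves bounded dimensions, where the lower bound comes from crowding
  all points into a cap. In the upper bound, bounded n or d are treated with blocks of two vertices.

  Decoupling asks for an exponential moment of the block density, so the dense tail bound is
  converted into one. For the planted first coordinates, conditioning is replaced by integrals
  against the indicator of the planted event, where second moments and Markov's inequality
  suffice.\<close>

abbreviation leb :: "nat \<Rightarrow> (nat \<Rightarrow> real) measure" where
  "leb d \<equiv> Pi\<^sub>M {..<d} (\<lambda>_. lborel)"

interpretation leb: product_sigma_finite "\<lambda>_::nat. lborel :: real measure" ..

lemma sigma_finite_leb: "sigma_finite_measure (leb d)"
  by (intro leb.sigma_finite) simp

lemma pair_sigma_finite_leb: "pair_sigma_finite (leb d) (leb d)"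
  by (simp add: pair_sigma_finite_def sigma_finite_leb)

text \<open>Used at two levels: for translations, coordinate by coordinate, and for a reflection
  that acts on some vectors of a sample and leaves the others alone.\<close>

lemma (in product_sigma_finite) distr_PiM_components:
  assumes "finite I" and f[measurable]: "\<And>i. i \<in> I \<Longrightarrow> f i \<in> M i \<rightarrow>\<^sub>M M i"
    and eq: "\<And>i. i \<in> I \<Longrightarrow> distr (M i) (M i) (f i) = M i"
  shows "distr (Pi\<^sub>M I M) (Pi\<^sub>M I M) (\<lambda>x. \<lambda>i\<in>I. f i (x i)) = Pi\<^sub>M I M"
proof (rule PiM_eqI)
  fix A assume A: "\<And>i. i \<in> I \<Longrightarrow> A i \<in> sets (M i)"
  have meas: "(\<lambda>x. \<lambda>i\<in>I. f i (x i)) \<in> Pi\<^sub>M I M \<rightarrow>\<^sub>M Pi\<^sub>M I M"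
    by measurable
  have "(\<lambda>x. \<lambda>i\<in>I. f i (x i)) -` Pi\<^sub>E I A \<inter> space (Pi\<^sub>M I M) = Pi\<^sub>E I (\<lambda>i. f i -` A i \<inter> space (M i))"
    by (auto simp: space_PiM PiE_iff)
  then have "emeasure (distr (Pi\<^sub>M I M) (Pi\<^sub>M I M) (\<lambda>x. \<lambda>i\<in>I. f i (x i))) (Pi\<^sub>E I A)
      = emeasure (Pi\<^sub>M I M) (Pi\<^sub>E I (\<lambda>i. f i -` A i \<inter> space (M i)))"
    using A \<open>finite I\<close> by (subst emeasure_distr[OF meas]) (auto intro!: sets_PiM_I_finite)
  also have "\<dots> = (\<Prod>i\<in>I. emeasure (M i) (f i -` A i \<inter> space (M i)))"
    using A \<open>finite I\<close> by (intro emeasure_PiM) (auto intro!: measurable_sets)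
  also have "\<dots> = (\<Prod>i\<in>I. emeasure (M i) (A i))"
    using A eq by (intro prod.cong refl) (metis emeasure_distr f)
  finally show "emeasure (distr (Pi\<^sub>M I M) (Pi\<^sub>M I M) (\<lambda>x. \<lambda>i\<in>I. f i (x i))) (Pi\<^sub>E I A)
      = (\<Prod>i\<in>I. emeasure (M i) (A i))" .
qed (use \<open>finite I\<close> in auto)

section \<open>Translations and dilations of Lebesgue measure\<close>

lemma distr_leb_translate:
  "distr (leb d) (leb d) (\<lambda>x. \<lambda>k\<in>{..<d}. x k + a k) = leb d"
proof (rule leb.distr_PiM_components)
  fix k
  have "distr lborel lborel (\<lambda>z. z + a k) = distr lborel borel ((+) (a k))"
    by (intro distr_cong) (auto simp: add.commute)
  then show "distr lborel lborel (\<lambda>z. z + a k) = lborel"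
    by (simp add: lborel_distr_plus)
qed auto

lemma nn_integral_leb_translate:
  assumes [measurable]: "f \<in> borel_measurable (leb d)"
  shows "(\<integral>\<^sup>+x. f (\<lambda>k\<in>{..<d}. x k + a k) \<partial>leb d) = (\<integral>\<^sup>+x. f x \<partial>leb d)"
proof -
  have "(\<integral>\<^sup>+x. f x \<partial>leb d) = (\<integral>\<^sup>+x. f x \<partial>distr (leb d) (leb d) (\<lambda>x. \<lambda>k\<in>{..<d}. x k + a k))"
    by (simp add: distr_leb_translate)
  also have "\<dots> = (\<integral>\<^sup>+x. f (\<lambda>k\<in>{..<d}. x k + a k) \<partial>leb d)"
    by (subst nn_integral_distr) auto
  finally show ?thesis ..
qed

text \<open>On boxes the claim splits into \<open>d\<close> one-dimensional affine substitutions,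
  each contributing one Jacobian factor \<open>r\<close>.\<close>

lemma nn_integral_leb_scale:
  assumes [measurable]: "f \<in> borel_measurable (leb d)" and "r > 0"
  shows "(\<integral>\<^sup>+x. f x \<partial>leb d) = ennreal (r ^ d) * (\<integral>\<^sup>+x. f (\<lambda>k\<in>{..<d}. r * x k) \<partial>leb d)"
proof -
  let ?T = "\<lambda>x. \<lambda>k\<in>{..<d}. r * x k"
  have meas: "?T \<in> leb d \<rightarrow>\<^sub>M leb d"
    by measurable
  have "density (distr (leb d) (leb d) ?T) (\<lambda>_. ennreal (r ^ d)) = leb d"
  proof (rule leb.PiM_eqI)
    fix A :: "nat \<Rightarrow> real set" assume A: "\<And>i. i \<in> {..<d} \<Longrightarrow> A i \<in> sets lborel"
    have "?T -` Pi\<^sub>E {..<d} A \<inter> space (leb d) = Pi\<^sub>E {..<d} (\<lambda>k. (\<lambda>z. r * z) -` A k)"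
      by (auto simp: space_PiM PiE_iff extensional_def)
    then have "emeasure (density (distr (leb d) (leb d) ?T) (\<lambda>_. ennreal (r ^ d))) (Pi\<^sub>E {..<d} A)
        = ennreal (r ^ d) * emeasure (leb d) (Pi\<^sub>E {..<d} (\<lambda>k. (\<lambda>z. r * z) -` A k))"
      using A sets_PiM_I_finite[of "{..<d}" A "\<lambda>_. lborel"]
      by (simp add: emeasure_density_const emeasure_distr[OF meas])
    also have "emeasure (leb d) (Pi\<^sub>E {..<d} (\<lambda>k. (\<lambda>z. r * z) -` A k))
        = (\<Prod>k<d. emeasure lborel ((\<lambda>z. r * z) -` A k))"
      using A by (intro leb.emeasure_PiM) (auto intro!: measurable_sets_borel[of _ borel])
    also have "ennreal (r ^ d) * \<dots> = (\<Prod>k<d. ennreal r * emeasure lborel ((\<lambda>z. r * z) -` A k))"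
      using \<open>r > 0\<close> by (simp add: prod.distrib ennreal_power)
    also have "\<dots> = (\<Prod>k<d. emeasure lborel (A k))"
    proof (rule prod.cong)
      fix k assume "k \<in> {..<d}"
      then have [measurable]: "A k \<in> sets borel" using A by auto
      have "emeasure lborel (A k)
          = emeasure (density (distr lborel borel (\<lambda>x. 0 + r * x)) (\<lambda>_. ennreal \<bar>r\<bar>)) (A k)"
        using lborel_real_affine[of r 0] \<open>r > 0\<close> by simp
      also have "\<dots> = ennreal r * emeasure lborel ((\<lambda>z. r * z) -` A k)"
        using \<open>r > 0\<close> by (simp add: emeasure_density_const emeasure_distr)
      finally show "ennreal r * emeasure lborel ((\<lambda>z. r * z) -` A k) = emeasure lborel (A k)" ..
    qed simp
    finally show "emeasure (density (distr (leb d) (leb d) ?T) (\<lambda>_. ennreal (r ^ d))) (Pi\<^sub>E {..<d} A)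
        = (\<Prod>k<d. emeasure lborel (A k))" .
  qed auto
  then have "(\<integral>\<^sup>+x. f x \<partial>leb d) = (\<integral>\<^sup>+x. f x \<partial>density (distr (leb d) (leb d) ?T) (\<lambda>_. ennreal (r ^ d)))"
    by simp
  also have "\<dots> = ennreal (r ^ d) * (\<integral>\<^sup>+x. f (?T x) \<partial>leb d)"
    by (simp add: nn_integral_density nn_integral_cmult nn_integral_distr)
  finally show ?thesis .
qed

text \<open>The Householder reflection in the hyperplane orthogonal to \<open>v\<close>. If
  \<open>v\<close> vanishes on the first \<open>d\<close> coordinates, division by zero gives 0 and
  the map is the identity on vectors, so degenerate \<open>v\<close> are harmless.\<close>

definition reflect :: "nat \<Rightarrow> (nat \<Rightarrow> real) \<Rightarrow> (nat \<Rightarrow> real) \<Rightarrow> nat \<Rightarrow> real" where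
  "reflect d v x = (\<lambda>k\<in>{..<d}. x k - 2 * sphere_inner d v x / sphere_inner d v v * v k)"

lemma sphere_inner_measurable [measurable]:
  assumes [measurable]: "f \<in> M \<rightarrow>\<^sub>M Pi\<^sub>M {..<d} (\<lambda>_. borel)" "g \<in> M \<rightarrow>\<^sub>M Pi\<^sub>M {..<d} (\<lambda>_. borel)"
  shows "(\<lambda>x. sphere_inner d (f x) (g x)) \<in> borel_measurable M"
proof -
  have "(\<lambda>x. f x k) \<in> borel_measurable M" "(\<lambda>x. g x k) \<in> borel_measurable M" if "k < d" for k
    using that by (auto intro!: measurable_compose[OF assms(1)] measurable_compose[OF assms(2)]
        measurable_component_singleton)
  then show ?thesis unfolding sphere_inner_def by (intro borel_measurable_sum borel_measurable_times) auto
qed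

lemma reflect_measurable [measurable]:
  "reflect d v \<in> Pi\<^sub>M {..<d} (\<lambda>_. borel) \<rightarrow>\<^sub>M Pi\<^sub>M {..<d} (\<lambda>_. borel)"
  unfolding reflect_def sphere_inner_def by measurable

lemma reflect_measurable_leb [measurable]: "reflect d v \<in> leb d \<rightarrow>\<^sub>M leb d"
  unfolding reflect_def sphere_inner_def by measurable

lemma sphere_inner_commute: "sphere_inner d x y = sphere_inner d y x"
  by (simp add: sphere_inner_def mult.commute)

lemma sphere_inner_self: "sphere_inner d x x = (L2_set x {..<d})\<^sup>2"
  by (simp add: sphere_inner_def L2_set_def sum_nonneg power2_eq_square[symmetric])

lemma sphere_inner_self_eq_0: "sphere_inner d v v = 0 \<longleftrightarrow> (\<forall>k<d. v k = 0)"
  by (auto simp: sphere_inner_self L2_set_eq_0_iff)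

lemma sphere_inner_reflect:
  "sphere_inner d (reflect d v x) (reflect d v y) = sphere_inner d x y"
proof (cases "sphere_inner d v v = 0")
  case True
  then show ?thesis by (simp add: sphere_inner_def reflect_def)
next
  case False
  define a where "a = 2 * sphere_inner d v x / sphere_inner d v v"
  define b where "b = 2 * sphere_inner d v y / sphere_inner d v v"
  have "sphere_inner d (reflect d v x) (reflect d v y)
     = (\<Sum>k<d. x k * y k - b * (v k * x k) - a * (v k * y k) + a * b * (v k * v k))"
    unfolding sphere_inner_def reflect_def a_def[unfolded sphere_inner_def, symmetric]
      b_def[unfolded sphere_inner_def, symmetric]
    by (intro sum.cong) (auto simp: algebra_simps)
  also have "\<dots> = sphere_inner d x y - b * sphere_inner d v x - a * sphere_inner d v y
      + a * b * sphere_inner d v v"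
    by (simp add: sphere_inner_def sum.distrib sum_subtractf sum_distrib_left)
  also have "\<dots> = sphere_inner d x y"
    using False by (simp add: a_def b_def field_simps)
  finally show ?thesis .
qed

lemma L2_set_reflect: "L2_set (reflect d v x) {..<d} = L2_set x {..<d}"
  using sphere_inner_reflect[of d v x x] by (simp add: sphere_inner_self)

lemma sphere_inner_add_right:
  "sphere_inner d v (\<lambda>k\<in>{..<d}. x k + y k) = sphere_inner d v x + sphere_inner d v y"
  by (simp add: sphere_inner_def algebra_simps sum.distrib)

lemma reflect_add:
  "reflect d v (\<lambda>k\<in>{..<d}. x k + y k) = (\<lambda>k\<in>{..<d}. reflect d v x k + reflect d v y k)"
  unfolding reflect_def sphere_inner_add_right
  by (auto simp: fun_eq_iff algebra_simps add_divide_distrib)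

lemma reflect_reflect:
  assumes "x \<in> extensional {..<d}"
  shows "reflect d v (reflect d v x) = x"
proof (cases "sphere_inner d v v = 0")
  case True
  then show ?thesis using assms by (auto simp: reflect_def fun_eq_iff extensional_def)
next
  case False
  define a where "a = 2 * sphere_inner d v x / sphere_inner d v v"
  have "sphere_inner d v (reflect d v x) = (\<Sum>k<d. v k * x k - a * (v k * v k))"
    unfolding sphere_inner_def reflect_def a_def[unfolded sphere_inner_def, symmetric]
    by (intro sum.cong) (auto simp: algebra_simps)
  also have "\<dots> = sphere_inner d v x - a * sphere_inner d v v"
    by (simp add: sphere_inner_def sum_subtractf sum_distrib_left)
  also have "\<dots> = - sphere_inner d v x"
    using False by (simp add: a_def)
  finally have *: "sphere_inner d v (reflect d v x) = - sphere_inner d v x" .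
  have "reflect d v (reflect d v x)
      = (\<lambda>k\<in>{..<d}. reflect d v x k + 2 * sphere_inner d v x / sphere_inner d v v * v k)"
    by (subst (1) reflect_def) (simp add: *)
  also have "\<dots> = x"
    using assms by (auto simp: reflect_def fun_eq_iff extensional_def)
  finally show ?thesis .
qed

lemma L2_set_minus_commute: "L2_set (\<lambda>k. x k - y k) A = L2_set (\<lambda>k. y k - x k) A" for x y :: "'a \<Rightarrow> real"
  by (simp add: L2_set_def power2_commute)

text \<open>
  The uniqueness argument for translation invariant measures: with \<open>g\<close> the indicator of the
  ball and \<open>T\<close> the reflection, Fubini and the translations \<open>x \<mapsto> x + T y\<close>, \<open>y \<mapsto> y - T x\<close>
  turn the product of the integrals of \<open>f \<circ> T\<close> and \<open>g\<close> into that of \<open>f\<close> and \<open>g\<close>.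
\<close>

lemma nn_integral_leb_reflect:
  assumes f[measurable]: "f \<in> borel_measurable (leb d)"
  shows "(\<integral>\<^sup>+x. f (reflect d v x) \<partial>leb d) = (\<integral>\<^sup>+x. f x \<partial>leb d)"
proof -
  let ?L = "leb d" and ?T = "reflect d v"
  define N where "N x = L2_set x {..<d}" for x :: "nat \<Rightarrow> real"
  define g :: "(nat \<Rightarrow> real) \<Rightarrow> ennreal" where "g x = indicator {..1} (N x)" for x
  interpret P: pair_sigma_finite ?L ?L by (rule pair_sigma_finite_leb)
  have N[measurable]: "N \<in> borel_measurable ?L"
    unfolding N_def by measurable
  have g[measurable]: "g \<in> borel_measurable ?L"
    unfolding g_def by measurable
  let ?p = "\<lambda>x y. \<lambda>k\<in>{..<d}. x k + y k"
  let ?m = "\<lambda>x y. \<lambda>k\<in>{..<d}. x k - y k"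
  have [measurable]: "(\<lambda>(x, y). ?p x y) \<in> ?L \<Otimes>\<^sub>M ?L \<rightarrow>\<^sub>M ?L" "(\<lambda>(x, y). ?m x y) \<in> ?L \<Otimes>\<^sub>M ?L \<rightarrow>\<^sub>M ?L"
    by measurable
  have T[measurable]: "?T \<in> ?L \<rightarrow>\<^sub>M ?L" by measurable
  have [measurable]: "(\<lambda>(x, y). ?p (?T x) y) \<in> ?L \<Otimes>\<^sub>M ?L \<rightarrow>\<^sub>M ?L" "(\<lambda>(x, y). ?m y (?T x)) \<in> ?L \<Otimes>\<^sub>M ?L \<rightarrow>\<^sub>M ?L"
    by measurable
  have eq1: "(\<integral>\<^sup>+x. f (?T x) \<partial>?L) = (\<integral>\<^sup>+x. f (?p (?T x) y) \<partial>?L)" if y: "y \<in> space ?L" for y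
  proof -
    have "(\<integral>\<^sup>+x. f (?T x) \<partial>?L) = (\<integral>\<^sup>+x. f (?T (?p x (?T y))) \<partial>?L)"
      by (rule nn_integral_leb_translate[symmetric]) measurable
    also have "\<dots> = (\<integral>\<^sup>+x. f (?p (?T x) y) \<partial>?L)"
      using y by (intro nn_integral_cong) (simp add: reflect_add reflect_reflect space_PiM PiE_iff)
    finally show ?thesis .
  qed
  have eq2: "(\<integral>\<^sup>+y. f (?p (?T x) y) * g y \<partial>?L) = (\<integral>\<^sup>+y. f y * g (?m y (?T x)) \<partial>?L)" for x
  proof -
    have "(\<integral>\<^sup>+y. f y * g (?m y (?T x)) \<partial>?L) = (\<integral>\<^sup>+y. f (?p y (?T x)) * g (?m (?p y (?T x)) (?T x)) \<partial>?L)"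
      by (rule nn_integral_leb_translate[symmetric]) measurable
    also have "\<dots> = (\<integral>\<^sup>+y. f (?p (?T x) y) * g y \<partial>?L)"
    proof (rule nn_integral_cong)
      fix y assume y: "y \<in> space ?L"
      have "?m (?p y (?T x)) (?T x) = y"
        using y by (auto simp: space_PiM PiE_iff extensional_def fun_eq_iff)
      moreover have "?p y (?T x) = ?p (?T x) y" by (simp add: add.commute)
      ultimately show "f (?p y (?T x)) * g (?m (?p y (?T x)) (?T x)) = f (?p (?T x) y) * g y"
        by simp
    qed
    finally show ?thesis ..
  qed
  \<comment> \<open>The reflection is a linear isometric involution, so y - T x and T y - x have
    equal norm; hence \<open>g\<close> is evaluated, up to sign, at a translate of
    \<open>x\<close>.\<close>
  have eq3: "(\<integral>\<^sup>+x. g (?m y (?T x)) \<partial>?L) = (\<integral>\<^sup>+x. g x \<partial>?L)" if y: "y \<in> space ?L" for y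
  proof -
    have "(\<integral>\<^sup>+x. g x \<partial>?L) = (\<integral>\<^sup>+x. g (?p x (\<lambda>k. - ?T y k)) \<partial>?L)"
      by (rule nn_integral_leb_translate[symmetric]) measurable
    also have "\<dots> = (\<integral>\<^sup>+x. g (?m y (?T x)) \<partial>?L)"
    proof (rule nn_integral_cong)
      fix x assume x: "x \<in> space ?L"
      have "?T (?m y (?T x)) = ?m (?T y) x"
      proof -
        have "?T (?p (?m y (?T x)) (?T x)) = ?p (?T (?m y (?T x))) (?T (?T x))"
          by (rule reflect_add)
        moreover have "?p (?m y (?T x)) (?T x) = y"
          using y by (auto simp: space_PiM PiE_iff extensional_def fun_eq_iff)
        moreover have "?T (?T x) = x"
          using x by (simp add: reflect_reflect space_PiM PiE_iff)
        ultimately have "?T y = ?p (?T (?m y (?T x))) x" by simp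
        then have "k < d \<Longrightarrow> ?T (?m y (?T x)) k = ?T y k - x k" for k by simp
        then show ?thesis
          by (auto simp: fun_eq_iff reflect_def)
      qed
      then have "N (?m y (?T x)) = N (?m (?T y) x)"
        unfolding N_def by (metis L2_set_reflect)
      also have "\<dots> = N (?p x (\<lambda>k. - ?T y k))"
        unfolding N_def by (subst L2_set_cong[OF refl, of _ _ "\<lambda>k. ?T y k - x k"], simp)
          (subst L2_set_minus_commute, auto intro: L2_set_cong)
      finally show "g (?p x (\<lambda>k. - ?T y k)) = g (?m y (?T x))"
        by (simp add: g_def)
    qed
    finally show ?thesis ..
  qed
  have "(\<integral>\<^sup>+x. f (?T x) \<partial>?L) * (\<integral>\<^sup>+y. g y \<partial>?L) = (\<integral>\<^sup>+y. (\<integral>\<^sup>+x. f (?T x) \<partial>?L) * g y \<partial>?L)"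
    by (simp add: nn_integral_cmult)
  also have "\<dots> = (\<integral>\<^sup>+y. (\<integral>\<^sup>+x. f (?p (?T x) y) * g y \<partial>?L) \<partial>?L)"
    by (intro nn_integral_cong) (simp add: eq1 nn_integral_multc)
  also have "\<dots> = (\<integral>\<^sup>+x. (\<integral>\<^sup>+y. f (?p (?T x) y) * g y \<partial>?L) \<partial>?L)"
    by (rule P.Fubini'[symmetric]) measurable
  also have "\<dots> = (\<integral>\<^sup>+x. (\<integral>\<^sup>+y. f y * g (?m y (?T x)) \<partial>?L) \<partial>?L)"
    by (simp add: eq2)
  also have "\<dots> = (\<integral>\<^sup>+y. (\<integral>\<^sup>+x. f y * g (?m y (?T x)) \<partial>?L) \<partial>?L)"
    by (rule P.Fubini') measurable
  also have "\<dots> = (\<integral>\<^sup>+y. f y * (\<integral>\<^sup>+x. g x \<partial>?L) \<partial>?L)"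
    by (intro nn_integral_cong) (simp add: eq3 nn_integral_cmult)
  also have "\<dots> = (\<integral>\<^sup>+y. f y \<partial>?L) * (\<integral>\<^sup>+y. g y \<partial>?L)"
    by (simp add: nn_integral_multc)
  finally have *: "(\<integral>\<^sup>+x. f (?T x) \<partial>?L) * (\<integral>\<^sup>+y. g y \<partial>?L) = (\<integral>\<^sup>+y. f y \<partial>?L) * (\<integral>\<^sup>+y. g y \<partial>?L)" .
  have "(\<integral>\<^sup>+y. g y \<partial>?L) = (\<integral>\<^sup>+y. indicator (euclidean_ball d) y \<partial>?L)"
    by (intro nn_integral_cong) (auto simp: g_def N_def euclidean_ball_def indicator_def)
  also have "\<dots> = emeasure ?L (euclidean_ball d)"
    by (intro nn_integral_indicator) (simp add: euclidean_ball_def)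
  also have "\<dots> = ennreal (unit_ball_vol (real d))"
    by (rule emeasure_euclidean_ball)
  finally have G: "(\<integral>\<^sup>+y. g y \<partial>?L) = ennreal (unit_ball_vol (real d))" .
  \<comment> \<open>The common factor is the volume of the unit ball, positive and finite, and can
    be cancelled.\<close>
  show ?thesis
    using * unfolding G using unit_ball_vol_pos[of "real d"]
    by (auto simp: mult.commute[of _ "ennreal (unit_ball_vol _)"] ennreal_mult_cancel_left
        simp del: unit_ball_vol_pos)
qed

section \<open>The Gaussian measure and the uniform distribution on the sphere\<close>

definition std_gauss :: "real measure" where
  "std_gauss = density lborel std_normal_density"

abbreviation gauss :: "nat \<Rightarrow> (nat \<Rightarrow> real) measure" where
  "gauss d \<equiv> Pi\<^sub>M {..<d} (\<lambda>_. std_gauss)"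

abbreviation gauss_points :: "nat \<Rightarrow> nat \<Rightarrow> (nat \<Rightarrow> nat \<Rightarrow> real) measure" where
  "gauss_points n d \<equiv> Pi\<^sub>M {1..n} (\<lambda>_. gauss d)"

lemma sets_std_gauss [simp, measurable_cong]: "sets std_gauss = sets borel"
  by (simp add: std_gauss_def)

lemma space_std_gauss [simp]: "space std_gauss = UNIV"
  by (simp add: std_gauss_def)

lemma prob_space_std_gauss: "prob_space std_gauss"
  unfolding std_gauss_def by (rule prob_space_normal_density) simp

interpretation std_gauss: prob_space std_gauss
  by (rule prob_space_std_gauss)

interpretation gauss: product_sigma_finite "\<lambda>_::nat. std_gauss"
  by (simp add: product_sigma_finite_def std_gauss.sigma_finite_measure_axioms)

lemma prob_space_gauss: "prob_space (gauss d)"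
  by (intro prob_space_PiM prob_space_std_gauss)

interpretation gauss_points: product_sigma_finite "\<lambda>_::nat. gauss d" for d
  by (simp add: product_sigma_finite_def prob_space_imp_sigma_finite prob_space_gauss)

lemma prob_space_gauss_points: "prob_space (gauss_points n d)"
  by (intro prob_space_PiM prob_space_gauss)

abbreviation gauss_weight :: "nat \<Rightarrow> (nat \<Rightarrow> real) \<Rightarrow> ennreal" where
  "gauss_weight d x \<equiv> ennreal ((1 / sqrt (2 * pi)) ^ d * exp (- (L2_set x {..<d})\<^sup>2 / 2))"

text \<open>The product density is a function of the norm alone. This makes reflection invariance of
  Lebesgue measure pass to the Gaussian measure and reduces the law of the direction to
  scaling.\<close>

lemma gauss_eq_density:
  "gauss d = density (leb d) (gauss_weight d)"
proof (rule gauss.PiM_eqI[symmetric])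
  show "sets (density (leb d) (gauss_weight d))
      = sets (gauss d)"
    by (simp, intro sets_PiM_cong) auto
next
  fix A :: "nat \<Rightarrow> real set" assume A: "\<And>i. i \<in> {..<d} \<Longrightarrow> A i \<in> sets std_gauss"
  have prod: "gauss_weight d x
      = (\<Prod>k<d. ennreal (std_normal_density (x k)))" for x
  proof -
    have "(\<Prod>k<d. std_normal_density (x k)) = (1 / sqrt (2 * pi)) ^ d * exp (\<Sum>k<d. - (x k)\<^sup>2 / 2)"
      by (simp add: std_normal_density_def prod.distrib exp_sum prod_dividef power_divide)
    also have "(\<Sum>k<d. - (x k)\<^sup>2 / 2) = - (L2_set x {..<d})\<^sup>2 / 2"
      by (simp add: L2_set_def sum_nonneg sum_negf sum_divide_distrib)
    finally show ?thesis
      by (simp add: prod_ennreal)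
  qed
  have ind: "indicator (Pi\<^sub>E {..<d} A) x = (\<Prod>k<d. indicator (A k) (x k) :: ennreal)"
    if "x \<in> space (leb d)" for x
    using that by (auto simp: indicator_def space_PiM PiE_iff)
  have "emeasure (density (leb d) (gauss_weight d)) (Pi\<^sub>E {..<d} A)
      = (\<integral>\<^sup>+x. gauss_weight d x * indicator (Pi\<^sub>E {..<d} A) x \<partial>leb d)"
    using A by (intro emeasure_density) (auto intro!: sets_PiM_I_finite)
  also have "\<dots> = (\<integral>\<^sup>+x. (\<Prod>k<d. ennreal (std_normal_density (x k)) * indicator (A k) (x k)) \<partial>leb d)"
    by (intro nn_integral_cong) (simp only: prod ind prod.distrib)
  also have "\<dots> = (\<Prod>k<d. \<integral>\<^sup>+z. ennreal (std_normal_density z) * indicator (A k) z \<partial>lborel)"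
    using A by (intro leb.product_nn_integral_prod) auto
  also have "\<dots> = (\<Prod>k<d. emeasure std_gauss (A k))"
    using A by (intro prod.cong) (auto simp: std_gauss_def emeasure_density)
  finally show "emeasure (density (leb d) (gauss_weight d)) (Pi\<^sub>E {..<d} A)
      = (\<Prod>k<d. emeasure std_gauss (A k))" .
qed simp

lemma sets_gauss: "sets (gauss d) = sets (Pi\<^sub>M {..<d} (\<lambda>_. borel))"
  by (intro sets_PiM_cong) auto

lemma sets_gauss_leb: "sets (gauss d) = sets (leb d)"
  by (intro sets_PiM_cong) auto

lemma nn_integral_gauss:
  assumes "f \<in> borel_measurable (gauss d)"
  shows "(\<integral>\<^sup>+x. f x \<partial>gauss d)
    = (\<integral>\<^sup>+x. gauss_weight d x * f x \<partial>leb d)"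
proof -
  have [measurable]: "f \<in> borel_measurable (leb d)"
    using assms by (simp cong: measurable_cong_sets add: sets_gauss_leb)
  show ?thesis
    unfolding gauss_eq_density by (rule nn_integral_density) measurable
qed

lemma reflect_measurable_gauss [measurable]: "reflect d v \<in> gauss d \<rightarrow>\<^sub>M gauss d"
  using reflect_measurable[of d v] by (simp cong: measurable_cong_sets add: sets_gauss)

lemma distr_gauss_reflect: "distr (gauss d) (gauss d) (reflect d v) = gauss d"
proof (rule measure_eqI)
  fix A assume "A \<in> sets (distr (gauss d) (gauss d) (reflect d v))"
  then have A[measurable]: "A \<in> sets (gauss d)" by simp
  then have A'[measurable]: "A \<in> sets (leb d)" by (simp add: sets_gauss_leb)
  let ?w = "\<lambda>x. gauss_weight d x"
  have "emeasure (distr (gauss d) (gauss d) (reflect d v)) A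
      = (\<integral>\<^sup>+x. indicator A (reflect d v x) \<partial>gauss d)"
    by (simp add: nn_integral_distr flip: nn_integral_indicator)
  also have "\<dots> = (\<integral>\<^sup>+x. ?w (reflect d v x) * indicator A (reflect d v x) \<partial>leb d)"
    by (subst nn_integral_gauss) (simp_all add: L2_set_reflect)
  also have "\<dots> = (\<integral>\<^sup>+x. ?w x * indicator A x \<partial>leb d)"
    by (rule nn_integral_leb_reflect) measurable
  also have "\<dots> = (\<integral>\<^sup>+x. indicator A x \<partial>gauss d)"
    by (subst nn_integral_gauss) simp_all
  finally show "emeasure (distr (gauss d) (gauss d) (reflect d v)) A = emeasure (gauss d) A"
    by simp
qed simp

section \<open>The direction of a Gaussian vector\<close>

definition direction :: "nat \<Rightarrow> (nat \<Rightarrow> real) \<Rightarrow> nat \<Rightarrow> real" where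
  "direction d x = (\<lambda>k\<in>{..<d}. x k / L2_set x {..<d})"

lemma direction_measurable_leb: "direction d \<in> leb d \<rightarrow>\<^sub>M Pi\<^sub>M {..<d} (\<lambda>_. borel)"
  using measurable_normalise[of d] unfolding direction_def .

lemma direction_measurable [measurable]: "direction d \<in> gauss d \<rightarrow>\<^sub>M Pi\<^sub>M {..<d} (\<lambda>_. borel)"
  using direction_measurable_leb[of d] by (simp cong: measurable_cong_sets add: sets_gauss_leb)

lemma L2_set_scale:
  fixes r :: real
  assumes "0 \<le> r"
  shows "L2_set (\<lambda>k\<in>A. r * x k) A = r * L2_set x A"
proof -
  have "L2_set (\<lambda>k\<in>A. r * x k) A = L2_set (\<lambda>k. r * x k) A"
    by (intro L2_set_cong) auto
  then show ?thesis using assms by (simp add: L2_set_right_distrib)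
qed

lemma direction_scale: "r > 0 \<Longrightarrow> direction d (\<lambda>k\<in>{..<d}. r * x k) = direction d x"
  by (auto simp: direction_def L2_set_scale)

text \<open>Layer-cake form of the radial Gaussian weight: with \<open>s\<close> the norm of a
  vector, the indicator says that the vector lies in the ball of radius \<open>r\<close>.\<close>

lemma nn_integral_exp_tail:
  assumes "0 \<le> s"
  shows "(\<integral>\<^sup>+r. ennreal (r * exp (- r\<^sup>2 / 2)) * indicator {s..} r \<partial>lborel) = ennreal (exp (- s\<^sup>2 / 2))"
proof -
  have "(\<integral>\<^sup>+r. ennreal (r * exp (- r\<^sup>2 / 2)) * indicator {s..} r \<partial>lborel)
      = ennreal (0 - - exp (- s\<^sup>2 / 2))"
  proof (rule nn_integral_FTC_atLeast)
    show "((\<lambda>r. - exp (- r\<^sup>2 / 2 :: real)) \<longlongrightarrow> 0) at_top"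
      by real_asymp
  qed (use assms in \<open>auto intro!: derivative_eq_intros simp: power2_eq_square\<close>)
  then show ?thesis by simp
qed

text \<open>
  Slicing the Gaussian density into indicators of balls of radius \<open>r\<close>; by scaling each ball
  contributes a multiple of the contribution of the unit ball.
\<close>

lemma distr_gauss_direction: "distr (gauss d) (Pi\<^sub>M {..<d} (\<lambda>_. borel)) (direction d) = uniform_sphere d"
proof -
  let ?B = "Pi\<^sub>M {..<d} (\<lambda>_. borel :: real measure)"
  let ?N = "\<lambda>x. L2_set x {..<d}"
  interpret S: pair_sigma_finite "leb d" "lborel :: real measure"
    by (simp add: pair_sigma_finite_def sigma_finite_leb sigma_finite_lborel)
  define c where "c = (1 / sqrt (2 * pi)) ^ d"
  have "c \<ge> 0" by (simp add: c_def)
  define I where "I f = (\<integral>\<^sup>+x. f (direction d x) * indicator {..1} (?N x) \<partial>leb d)"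
    for f :: "(nat \<Rightarrow> real) \<Rightarrow> ennreal"
  define \<kappa> where "\<kappa> = (\<integral>\<^sup>+r. ennreal (c * (r * exp (- r\<^sup>2 / 2))) * indicator {0..} r * ennreal (r ^ d) \<partial>lborel)"
  have dir[measurable]: "direction d \<in> leb d \<rightarrow>\<^sub>M ?B"
    by (rule direction_measurable_leb)
  have main: "(\<integral>\<^sup>+x. f (direction d x) \<partial>gauss d) = \<kappa> * I f" if f[measurable]: "f \<in> borel_measurable ?B" for f
  proof -
    have "(\<integral>\<^sup>+x. f (direction d x) \<partial>gauss d) = (\<integral>\<^sup>+x. ennreal (c * exp (- (?N x)\<^sup>2 / 2)) * f (direction d x) \<partial>leb d)"
      by (subst nn_integral_gauss) (simp_all add: c_def)
    also have "\<dots> = (\<integral>\<^sup>+x. (\<integral>\<^sup>+r. ennreal (c * (r * exp (- r\<^sup>2 / 2))) * indicator {0..} r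
        * (f (direction d x) * indicator {..r} (?N x)) \<partial>lborel) \<partial>leb d)"
    proof (rule nn_integral_cong)
      fix x :: "nat \<Rightarrow> real"
      have "ennreal (c * exp (- (?N x)\<^sup>2 / 2)) * f (direction d x)
        = ennreal c * f (direction d x) * (\<integral>\<^sup>+r. ennreal (r * exp (- r\<^sup>2 / 2)) * indicator {?N x..} r \<partial>lborel)"
        using \<open>c \<ge> 0\<close> by (subst nn_integral_exp_tail) (simp_all add: ennreal_mult ac_simps)
      also have "\<dots> = (\<integral>\<^sup>+r. ennreal c * f (direction d x) * (ennreal (r * exp (- r\<^sup>2 / 2)) * indicator {?N x..} r) \<partial>lborel)"
        by (simp add: nn_integral_cmult)
      also have "\<dots> = (\<integral>\<^sup>+r. ennreal (c * (r * exp (- r\<^sup>2 / 2))) * indicator {0..} r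
        * (f (direction d x) * indicator {..r} (?N x)) \<partial>lborel)"
        using \<open>c \<ge> 0\<close>
        by (intro nn_integral_cong)
          (auto simp: indicator_def ennreal_mult' ac_simps dest: order_trans[OF L2_set_nonneg])
      finally show "ennreal (c * exp (- (?N x)\<^sup>2 / 2)) * f (direction d x)
        = (\<integral>\<^sup>+r. ennreal (c * (r * exp (- r\<^sup>2 / 2))) * indicator {0..} r
        * (f (direction d x) * indicator {..r} (?N x)) \<partial>lborel)" .
    qed
    also have "\<dots> = (\<integral>\<^sup>+r. (\<integral>\<^sup>+x. ennreal (c * (r * exp (- r\<^sup>2 / 2))) * indicator {0..} r
        * (f (direction d x) * indicator {..r} (?N x)) \<partial>leb d) \<partial>lborel)"
      by (rule S.Fubini'[symmetric]) (unfold indicator_def atMost_iff, measurable)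
    also have "\<dots> = (\<integral>\<^sup>+r. ennreal (c * (r * exp (- r\<^sup>2 / 2))) * indicator {0..} r * ennreal (r ^ d) * I f \<partial>lborel)"
    proof (rule nn_integral_cong)
      fix r :: real
      show "(\<integral>\<^sup>+x. ennreal (c * (r * exp (- r\<^sup>2 / 2))) * indicator {0..} r
        * (f (direction d x) * indicator {..r} (?N x)) \<partial>leb d)
        = ennreal (c * (r * exp (- r\<^sup>2 / 2))) * indicator {0..} r * ennreal (r ^ d) * I f"
      proof (cases "r > 0")
        case True
        have "(\<integral>\<^sup>+x. f (direction d x) * indicator {..r} (?N x) \<partial>leb d)
          = ennreal (r ^ d) * (\<integral>\<^sup>+x. f (direction d (\<lambda>k\<in>{..<d}. r * x k)) * indicator {..r} (?N (\<lambda>k\<in>{..<d}. r * x k)) \<partial>leb d)"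
          using True by (intro nn_integral_leb_scale) measurable
        also have "\<dots> = ennreal (r ^ d) * I f"
          unfolding I_def using True
          by (intro arg_cong[where f="\<lambda>z. _ * z"] nn_integral_cong)
            (simp add: direction_scale L2_set_scale indicator_def mult_le_cancel_left1)
        finally show ?thesis by (simp add: nn_integral_cmult mult.assoc)
      next
        case False
        then show ?thesis by (cases "r = 0") (auto simp: indicator_def)
      qed
    qed
    also have "\<dots> = \<kappa> * I f"
      unfolding \<kappa>_def by (rule nn_integral_multc) measurable
    finally show ?thesis .
  qed
  define V where "V = emeasure (leb d) (euclidean_ball d)"
  have V: "V \<noteq> 0" "V \<noteq> \<infinity>"
    using unit_ball_vol_pos[of "real d"] unfolding V_def emeasure_euclidean_ball
    by (auto simp del: unit_ball_vol_pos)
  have ball[measurable]: "euclidean_ball d \<in> sets (leb d)"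
    unfolding euclidean_ball_def by measurable
  have ball_ind: "indicator {..1} (?N x) = (indicator (euclidean_ball d) x :: ennreal)"
    if "x \<in> space (leb d)" for x
    using that by (auto simp: indicator_def euclidean_ball_def)
  have I1: "I (\<lambda>_. 1) = V"
  proof -
    have "I (\<lambda>_. 1) = (\<integral>\<^sup>+x. indicator (euclidean_ball d) x \<partial>leb d)"
      unfolding I_def by (intro nn_integral_cong) (simp add: ball_ind)
    then show ?thesis by (simp add: V_def)
  qed
  \<comment> \<open>The radial integral \<open>\<kappa>\<close> need not be evaluated:
    \<open>f = 1\<close> determines it from the total mass.\<close>
  have "\<kappa> * V = 1"
    using main[of "\<lambda>_. 1"] prob_space.emeasure_space_1[OF prob_space_gauss[of d]] by (simp add: I1)
  then have \<kappa>: "\<kappa> = 1 / V"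
    using V by (metis ennreal_top_neq_one ennreal_divide_times mult.commute mult_divide_eq_ennreal infinity_ennreal_def)
  show ?thesis
  proof (rule measure_eqI)
    show "sets (distr (gauss d) ?B (direction d)) = sets (uniform_sphere d)"
      by (simp add: sets_uniform_sphere)
    fix A assume "A \<in> sets (distr (gauss d) ?B (direction d))"
    then have A[measurable]: "A \<in> sets ?B" by simp
    have "emeasure (distr (gauss d) ?B (direction d)) A = (\<integral>\<^sup>+x. indicator A (direction d x) \<partial>gauss d)"
      by (simp add: nn_integral_distr flip: nn_integral_indicator)
    also have "\<dots> = I (indicator A) / V"
      by (subst main) (simp_all add: \<kappa> ennreal_divide_times)
    also have "I (indicator A) = (\<integral>\<^sup>+x. indicator A (direction d x) * indicator (euclidean_ball d) x \<partial>leb d)"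
      unfolding I_def by (intro nn_integral_cong) (simp add: ball_ind)
    also have "\<dots> / V = (\<integral>\<^sup>+x. indicator A (direction d x) \<partial>uniform_measure (leb d) (euclidean_ball d))"
      unfolding V_def by (subst nn_integral_uniform_measure) simp_all
    also have "\<dots> = emeasure (uniform_sphere d) A"
      unfolding uniform_sphere_def direction_def[symmetric]
      by (simp add: nn_integral_distr flip: nn_integral_indicator)
    finally show "emeasure (distr (gauss d) ?B (direction d)) A = emeasure (uniform_sphere d) A" .
  qed
qed

lemma distr_gauss_points_direction:
  "distr (gauss_points n d) (sphere_points n d) (compose {1..n} (direction d)) = sphere_points n d"
proof -
  have [measurable]: "direction d \<in> gauss d \<rightarrow>\<^sub>M uniform_sphere d"
    using direction_measurable[of d] by (simp cong: measurable_cong_sets add: sets_uniform_sphere)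
  have "distr (gauss_points n d) (sphere_points n d) (compose {1..n} (direction d))
      = Pi\<^sub>M {1..n} (\<lambda>_. distr (gauss d) (uniform_sphere d) (direction d))"
    unfolding sphere_points_def
    by (rule distr_PiM_finite_prob_space')
      (simp_all add: prob_space_gauss prob_space_uniform_sphere)
  also have "distr (gauss d) (uniform_sphere d) (direction d) = uniform_sphere d"
    unfolding distr_gauss_direction[of d, symmetric] by (intro distr_cong) simp_all
  finally show ?thesis by (simp add: sphere_points_def)
qed

definition cosine :: "nat \<Rightarrow> (nat \<Rightarrow> real) \<Rightarrow> (nat \<Rightarrow> real) \<Rightarrow> real" where
  "cosine d x y = sphere_inner d x y / (L2_set x {..<d} * L2_set y {..<d})"

lemma sphere_inner_direction: "sphere_inner d (direction d x) (direction d y) = cosine d x y"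
  by (simp add: sphere_inner_def direction_def cosine_def sum_divide_distrib)

lemma cosine_commute: "cosine d x y = cosine d y x"
  by (simp add: cosine_def sphere_inner_commute mult.commute)

section \<open>Triangular form of a Gaussian sample\<close>

text \<open>The Householder normal form of \<open>x\<close> when the first \<open>a\<close>
  coordinates are to be kept: the remaining ones are rotated onto the axis of index
  \<open>a\<close>. Vertices are numbered from 1 and coordinates from 0, so vertex \<open>i\<close>
  uses \<open>a = i - 1\<close>, and vertex 1 keeps only its norm.\<close>

definition triang :: "nat \<Rightarrow> nat \<Rightarrow> (nat \<Rightarrow> real) \<Rightarrow> nat \<Rightarrow> real" where
  "triang d a x = (\<lambda>k\<in>{..<d}. if k < a then x k else if k = a then L2_set x {a..<d} else 0)"

lemma triang_measurable [measurable]: "triang d a \<in> gauss d \<rightarrow>\<^sub>M gauss d"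
  unfolding triang_def L2_set_def by measurable

lemma L2_set_split:
  fixes a d :: nat
  assumes "a \<le> d"
  shows "(L2_set x {..<d})\<^sup>2 = (\<Sum>k<a. (x k)\<^sup>2) + (L2_set x {a..<d})\<^sup>2"
proof -
  have "{..<d} = {..<a} \<union> {a..<d}" using assms by auto
  moreover have "(\<Sum>k\<in>{..<a} \<union> {a..<d}. (x k)\<^sup>2) = (\<Sum>k<a. (x k)\<^sup>2) + (\<Sum>k\<in>{a..<d}. (x k)\<^sup>2)"
    by (intro sum.union_disjoint) auto
  ultimately show ?thesis by (simp add: L2_set_def sum_nonneg)
qed

lemma sum_triang_split:
  assumes "a < d"
  shows "(\<Sum>k<d. f k (triang d a x k) :: real) = (\<Sum>k<a. f k (x k)) + f a (L2_set x {a..<d}) + (\<Sum>k\<in>{Suc a..<d}. f k 0)"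
proof -
  have "{..<d} = ({..<a} \<union> {a}) \<union> {Suc a..<d}" using assms by auto
  moreover have "(\<Sum>k\<in>({..<a} \<union> {a}) \<union> {Suc a..<d}. f k (triang d a x k))
     = (\<Sum>k\<in>{..<a} \<union> {a}. f k (triang d a x k)) + (\<Sum>k\<in>{Suc a..<d}. f k (triang d a x k))"
    by (intro sum.union_disjoint) auto
  moreover have "(\<Sum>k\<in>{..<a} \<union> {a}. f k (triang d a x k)) = (\<Sum>k<a. f k (triang d a x k)) + f a (triang d a x a)"
    by (subst sum.union_disjoint) auto
  ultimately show ?thesis
    using assms by (simp add: triang_def)
qed

lemma L2_set_triang:
  assumes "a < d"
  shows "L2_set (triang d a x) {..<d} = L2_set x {..<d}"
proof -
  have "(\<Sum>k<d. (triang d a x k)\<^sup>2) = (\<Sum>k<a. (x k)\<^sup>2) + (L2_set x {a..<d})\<^sup>2"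
    using sum_triang_split[OF assms, of "\<lambda>_ z. z\<^sup>2"] by simp
  also have "\<dots> = (L2_set x {..<d})\<^sup>2"
    using assms by (subst L2_set_split[of a]) auto
  finally have "(L2_set (triang d a x) {..<d})\<^sup>2 = (L2_set x {..<d})\<^sup>2"
    by (simp add: L2_set_def sum_nonneg)
  then show ?thesis by (simp add: power2_eq_iff_nonneg)
qed

text \<open>The first vector vanishes beyond index \<open>a\<close>, and up to that index the second
  one is still unchanged because \<open>a < b\<close>. Thus the coordinate \<open>y a\<close> meets
  the long tail norm of \<open>x\<close>; this single coordinate will decide the edge.\<close>

lemma sphere_inner_triang:
  assumes "a < b" "b < d"
  shows "sphere_inner d (triang d a x) (triang d b y) = (\<Sum>k<a. x k * y k) + L2_set x {a..<d} * y a"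
proof -
  have "sphere_inner d (triang d a x) (triang d b y)
     = (\<Sum>k<a. x k * triang d b y k) + L2_set x {a..<d} * triang d b y a"
    unfolding sphere_inner_def
    using sum_triang_split[of a d "\<lambda>k z. z * triang d b y k" x] assms by simp
  also have "(\<Sum>k<a. x k * triang d b y k) = (\<Sum>k<a. x k * y k)"
    using assms by (intro sum.cong) (auto simp: triang_def)
  also have "triang d b y a = y a" using assms by (simp add: triang_def)
  finally show ?thesis .
qed

text \<open>Two vectors of equal norm are exchanged by the reflection orthogonal to their
  difference. Here \<open>v\<close> is \<open>x\<close> minus its triangular form, which vanishes
  below index \<open>a\<close>.\<close>

lemma reflect_eq_triang:
  assumes "a < d" "x \<in> extensional {..<d}"
  obtains v where "\<forall>k<a. v k = 0" "reflect d v x = triang d a x"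
proof -
  define v where "v k = x k - triang d a x k" for k
  have "sphere_inner d v v = (\<Sum>k<d. x k * x k + triang d a x k * triang d a x k - 2 * (triang d a x k * x k))"
    by (simp add: sphere_inner_def v_def algebra_simps)
  also have "\<dots> = sphere_inner d x x + sphere_inner d (triang d a x) (triang d a x) - 2 * sphere_inner d (triang d a x) x"
    by (simp add: sphere_inner_def sum.distrib sum_subtractf sum_distrib_left)
  also have "sphere_inner d (triang d a x) (triang d a x) = sphere_inner d x x"
    using assms by (simp add: sphere_inner_self L2_set_triang)
  finally have "sphere_inner d v v = 2 * (sphere_inner d x x - sphere_inner d (triang d a x) x)" by simp
  also have "sphere_inner d x x - sphere_inner d (triang d a x) x = sphere_inner d v x"
    by (simp add: sphere_inner_def v_def algebra_simps sum_subtractf)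
  finally have vv: "sphere_inner d v v = 2 * sphere_inner d v x" .
  have "reflect d v x = triang d a x"
  proof (cases "sphere_inner d v v = 0")
    case True
    then have "\<forall>k<d. x k = triang d a x k" by (simp add: sphere_inner_self_eq_0 v_def)
    with True assms show ?thesis
      by (auto simp: reflect_def fun_eq_iff extensional_def triang_def)
  next
    case False
    then show ?thesis
      using vv by (auto simp: reflect_def v_def fun_eq_iff triang_def)
  qed
  moreover have "\<forall>k<a. v k = 0"
    using assms by (simp add: v_def triang_def)
  ultimately show ?thesis using that by blast
qed

text \<open>The supports are disjoint: the triangular vector lives on indices at most
  \<open>b\<close>, the vector \<open>v\<close> on indices at least \<open>a > b\<close>, so they
  are orthogonal.\<close>

lemma reflect_triang_fixed:
  assumes "b < a" "\<forall>k<a. v k = 0"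
  shows "reflect d v (triang d b x) = triang d b x"
proof -
  have "v k * triang d b x k = 0" if "k < d" for k
    using assms that by (cases "k < a") (auto simp: triang_def)
  then have "sphere_inner d v (triang d b x) = 0"
    unfolding sphere_inner_def by (intro sum.neutral) auto
  then show ?thesis by (auto simp: reflect_def triang_def fun_eq_iff)
qed

lemma extensional_gauss: "x \<in> space (gauss d) \<Longrightarrow> x \<in> extensional {..<d}"
  by (simp add: space_PiM PiE_iff)

text \<open>
  A QR decomposition in law. The vectors are treated one after the other: given the vector
  \<open>y\<close> in position \<open>r + 1\<close>, a reflection fixing the first \<open>r\<close> coordinate directions maps \<open>y\<close>
  to its triangular form; it fixes the vectors already treated and preserves the law of
  the later ones.
\<close>

lemma nn_integral_gauss_points_triang:
  fixes F :: "(nat \<Rightarrow> nat \<Rightarrow> real) \<Rightarrow> ennreal"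
  assumes F: "F \<in> borel_measurable (gauss_points n d)" and "n \<le> d"
    and inv: "\<And>v X. X \<in> space (gauss_points n d) \<Longrightarrow> F (\<lambda>i\<in>{1..n}. reflect d v (X i)) = F X"
  shows "(\<integral>\<^sup>+X. F X \<partial>gauss_points n d) = (\<integral>\<^sup>+X. F (\<lambda>i\<in>{1..n}. triang d (i - 1) (X i)) \<partial>gauss_points n d)"
proof -
  define part where "part r X = (\<lambda>i\<in>{1..n}. if i \<le> r then triang d (i - 1) (X i) else X i)" for r X
  have part[measurable]: "part r \<in> gauss_points n d \<rightarrow>\<^sub>M gauss_points n d" for r
    unfolding part_def by measurable
  note F[measurable]
  have step: "(\<integral>\<^sup>+X. F (part r X) \<partial>gauss_points n d) = (\<integral>\<^sup>+X. F (part (Suc r) X) \<partial>gauss_points n d)"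
    if "r < n" for r
  proof -
    define i where "i = Suc r"
    define I where "I = {1..n} - {i}"
    have I: "finite I" "i \<notin> I" and ins: "{1..n} = insert i I"
      using that by (auto simp: I_def i_def)
    let ?P = "Pi\<^sub>M I (\<lambda>_. gauss d)"
    \<comment> \<open>The vector in position \<open>i\<close> is the outer variable: the reflection
      may be chosen from it before the other vectors are integrated.\<close>
    note Fub = gauss_points.product_nn_integral_insert_rev[OF I, of _ d, folded ins]
    have meas: "(\<lambda>X. F (part q X)) \<in> borel_measurable (gauss_points n d)" for q
      by measurable
    have "(\<integral>\<^sup>+x. F (part r (x(i := y))) \<partial>?P) = (\<integral>\<^sup>+x. F (part (Suc r) (x(i := y))) \<partial>?P)"
      if y: "y \<in> space (gauss d)" for y
    proof -
      obtain v where v: "\<forall>k<r. v k = 0" "reflect d v y = triang d r y"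
        using reflect_eq_triang[of r d y] y \<open>r < n\<close> \<open>n \<le> d\<close> extensional_gauss by auto
      define R where "R x = (\<lambda>j\<in>I. (if j \<le> r then (\<lambda>z. z) else reflect d v) (x j))" for x
      have R[measurable]: "R \<in> ?P \<rightarrow>\<^sub>M ?P"
        unfolding R_def
        by (intro measurable_restrict measurable_compose[OF measurable_component_singleton])
          (auto simp: reflect_measurable_gauss)
      have "distr ?P ?P R = ?P"
        unfolding R_def using I
        by (intro gauss_points.distr_PiM_components) (auto simp: distr_gauss_reflect distr_id)
      note dR = this
      have upd[measurable]: "(\<lambda>x. x(i := y)) \<in> ?P \<rightarrow>\<^sub>M gauss_points n d"
      proof (rule measurable_fun_upd[of _ I])
        show "{1..n} = I \<union> {i}" using ins by auto
      qed (use y in auto)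
      have "(\<integral>\<^sup>+x. F (part r (x(i := y))) \<partial>?P) = (\<integral>\<^sup>+x. F (part (Suc r) ((R x)(i := y))) \<partial>?P)"
      proof (rule nn_integral_cong)
        fix x assume x: "x \<in> space ?P"
        have sp: "part r (x(i := y)) \<in> space (gauss_points n d)"
          using measurable_space[OF part measurable_space[OF upd x]] .
        have "part (Suc r) ((R x)(i := y)) j = (\<lambda>j\<in>{1..n}. reflect d v (part r (x(i := y)) j)) j" for j
        proof -
          consider "j \<notin> {1..n}" | "j \<in> {1..n}" "j \<le> r" | "j = i" "j \<in> {1..n}" | "j \<in> {1..n}" "j > i"
            by (fastforce simp: i_def)
          then show ?thesis
          proof cases
            case 2
            then have "j - 1 < r" by auto
            then show ?thesis
              using 2 reflect_triang_fixed[of "j - 1" r v d "x j"] v by (auto simp: part_def R_def i_def I_def)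
          qed (use v in \<open>auto simp: part_def R_def i_def I_def\<close>)
        qed
        then have "part (Suc r) ((R x)(i := y)) = (\<lambda>j\<in>{1..n}. reflect d v (part r (x(i := y)) j))"
          by blast
        then show "F (part r (x(i := y))) = F (part (Suc r) ((R x)(i := y)))"
          using inv[OF sp] by simp
      qed
      also have "\<dots> = (\<integral>\<^sup>+x. F (part (Suc r) (x(i := y))) \<partial>distr ?P ?P R)"
        by (subst nn_integral_distr) measurable
      finally show ?thesis by (simp add: dR)
    qed
    then show ?thesis
      unfolding Fub[OF meas] by (rule nn_integral_cong)
  qed
  have "(\<integral>\<^sup>+X. F (part r X) \<partial>gauss_points n d) = (\<integral>\<^sup>+X. F X \<partial>gauss_points n d)" if "r \<le> n" for r
    using that
  proof (induction r)
    case 0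
    have "part 0 X = X" if "X \<in> space (gauss_points n d)" for X
      using that by (auto simp: part_def space_PiM PiE_iff extensional_def fun_eq_iff)
    then show ?case by (auto intro: nn_integral_cong)
  next
    case (Suc r)
    then show ?case using step[of r] by simp
  qed
  from this[of n] show ?thesis
    by (simp add: part_def cong: restrict_cong)
qed

section \<open>Edge counts and the threshold\<close>

text \<open>Unordered pairs are encoded by their increasing representatives because the triangular
  form treats the two ends of a pair differently.\<close>

definition vpairs :: "nat \<Rightarrow> (nat \<times> nat) set" where
  "vpairs n = {(i, j). 1 \<le> i \<and> i < j \<and> j \<le> n}"

lemma finite_vpairs [simp]: "finite (vpairs n)"
  by (rule finite_subset[of _ "{1..n} \<times> {1..n}"]) (auto simp: vpairs_def)

lemma inj_on_vpairs: "inj_on (\<lambda>(i, j). {i, j}) (vpairs n)"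
  by (auto simp: inj_on_def vpairs_def doubleton_eq_iff)

lemma card_vpairs: "card (vpairs n) = n choose 2"
proof -
  have "(\<lambda>(i, j). {i, j}) ` vpairs n = {A. A \<subseteq> {1..n} \<and> card A = 2}"
  proof (intro equalityI subsetI)
    fix A assume "A \<in> {A. A \<subseteq> {1..n} \<and> card A = 2}"
    then obtain x y where A: "A = {x, y}" "x \<noteq> y" "x \<in> {1..n}" "y \<in> {1..n}"
      by (auto simp: card_2_iff)
    show "A \<in> (\<lambda>(i, j). {i, j}) ` vpairs n"
    proof (cases "x < y")
      case True
      with A show ?thesis by (intro image_eqI[of _ _ "(x, y)"]) (auto simp: vpairs_def)
    next
      case False
      with A show ?thesis by (intro image_eqI[of _ _ "(y, x)"]) (auto simp: vpairs_def)
    qed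
  qed (auto simp: vpairs_def card_2_iff)
  then have "card (vpairs n) = card {A. A \<subseteq> {1..n} \<and> card A = 2}"
    using card_image[OF inj_on_vpairs[of n]] by simp
  then show ?thesis by (simp add: n_subsets)
qed

text \<open>The relation is a parameter so that one count serves points of the sphere, Gaussian
  vectors, and the decoupling argument over an arbitrary probability space.\<close>

definition ecount :: "('a \<Rightarrow> 'a \<Rightarrow> bool) \<Rightarrow> nat \<Rightarrow> (nat \<Rightarrow> 'a) \<Rightarrow> real" where
  "ecount Q n X = (\<Sum>(i, j)\<in>vpairs n. of_bool (Q (X i) (X j)))"

abbreviation edges :: "nat \<Rightarrow> real \<Rightarrow> nat \<Rightarrow> (nat \<Rightarrow> nat \<Rightarrow> real) \<Rightarrow> real" where
  "edges d t \<equiv> ecount (\<lambda>x y. t \<le> cosine d x y)"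

abbreviation edge_tail :: "nat \<Rightarrow> nat \<Rightarrow> real \<Rightarrow> real \<Rightarrow> real" where
  "edge_tail n d t a \<equiv> measure (gauss_points n d) {X \<in> space (gauss_points n d). a \<le> edges d t n X}"

abbreviation edge_mgf :: "nat \<Rightarrow> nat \<Rightarrow> real \<Rightarrow> real \<Rightarrow> real \<Rightarrow> ennreal" where
  "edge_mgf n d t l a \<equiv>
     \<integral>\<^sup>+X. ennreal (exp (l * (edges d t n X / real (n choose 2) - a))) \<partial>gauss_points n d"

lemma ecount_le: "ecount Q n X \<le> real (n choose 2)"
proof -
  have "ecount Q n X \<le> (\<Sum>(i, j)\<in>vpairs n. 1)"
    unfolding ecount_def by (intro sum_mono) auto
  then show ?thesis by (simp add: card_vpairs)
qed

lemma ecount_cong: "(\<And>i j. 1 \<le> i \<Longrightarrow> i < j \<Longrightarrow> j \<le> n \<Longrightarrow> Q (X i) (X j) = Q' (Y i) (Y j))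
    \<Longrightarrow> ecount Q n X = ecount Q' n Y"
  unfolding ecount_def by (intro sum.cong) (auto simp: vpairs_def)

lemma card_rgg_edges: "real (card (rgg_edges n d t X)) = ecount (\<lambda>x y. sphere_inner d x y \<ge> t) n X"
proof -
  let ?S = "{(i, j) \<in> vpairs n. sphere_inner d (X i) (X j) \<ge> t}"
  have "rgg_edges n d t X = (\<lambda>(i, j). {i, j}) ` ?S"
  proof (intro equalityI subsetI)
    fix e assume "e \<in> rgg_edges n d t X"
    then obtain i j where e: "e = {i, j}" "i \<in> {1..n}" "j \<in> {1..n}" "i \<noteq> j" "sphere_inner d (X i) (X j) \<ge> t"
      by (auto simp: rgg_edges_def)
    show "e \<in> (\<lambda>(i, j). {i, j}) ` ?S"
    proof (cases "i < j")
      case True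
      with e show ?thesis by (intro image_eqI[of _ _ "(i, j)"]) (auto simp: vpairs_def)
    next
      case False
      with e show ?thesis by (intro image_eqI[of _ _ "(j, i)"]) (auto simp: vpairs_def sphere_inner_commute)
    qed
  qed (fastforce simp: rgg_edges_def vpairs_def)
  moreover have "inj_on (\<lambda>(i, j). {i, j}) ?S"
    by (rule inj_on_subset[OF inj_on_vpairs]) auto
  ultimately have "card (rgg_edges n d t X) = card ?S"
    by (simp add: card_image)
  also have "real \<dots> = (\<Sum>e\<in>?S. 1)" by simp
  also have "\<dots> = (\<Sum>e\<in>vpairs n. if sphere_inner d (X (fst e)) (X (snd e)) \<ge> t then 1 else 0)"
    by (subst sum.inter_filter[symmetric]) (simp_all add: case_prod_unfold)
  finally show ?thesis
    by (simp add: ecount_def of_bool_def case_prod_unfold)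
qed

section \<open>Measurability of coordinates, norms and edge counts\<close>

lemma measurable_coordinate:
  assumes "i \<in> I" "k < d"
  shows "(\<lambda>X. X i k) \<in> borel_measurable (Pi\<^sub>M I (\<lambda>_. gauss d))"
proof -
  have "(\<lambda>X. X i k) \<in> Pi\<^sub>M I (\<lambda>_. gauss d) \<rightarrow>\<^sub>M std_gauss"
    using assms by (intro measurable_compose[OF measurable_component_singleton[of i I "\<lambda>_. gauss d"]
      measurable_component_singleton[of k "{..<d}" "\<lambda>_. std_gauss"]]) auto
  then show ?thesis
    unfolding measurable_cong_sets[OF refl sets_std_gauss] .
qed

lemma measurable_L2_set_coordinate:
  assumes "i \<in> I" "A \<subseteq> {..<d}"
  shows "(\<lambda>X. L2_set (X i) A) \<in> borel_measurable (Pi\<^sub>M I (\<lambda>_. gauss d))"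
  unfolding L2_set_def
  by (rule measurable_compose[OF _ borel_measurable_sqrt])
    (use assms in \<open>intro borel_measurable_sum borel_measurable_power measurable_coordinate; auto\<close>)

lemma measurable_gauss_coordinate: "k < d \<Longrightarrow> (\<lambda>x. x k) \<in> borel_measurable (gauss d)"
  using measurable_component_singleton[of k "{..<d}" "\<lambda>_. std_gauss"]
  unfolding measurable_cong_sets[OF refl sets_std_gauss] by simp

lemma measurable_gauss_L2_set:
  "A \<subseteq> {..<d} \<Longrightarrow> (\<lambda>x. L2_set x A) \<in> borel_measurable (gauss d)"
  unfolding L2_set_def
  by (rule measurable_compose[OF _ borel_measurable_sqrt])
    (intro borel_measurable_sum borel_measurable_power measurable_gauss_coordinate; auto)

lemma cosine_measurable [measurable]:
  assumes [measurable]: "f \<in> M \<rightarrow>\<^sub>M gauss d" "g \<in> M \<rightarrow>\<^sub>M gauss d"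
  shows "(\<lambda>x. cosine d (f x) (g x)) \<in> borel_measurable M"
proof -
  have [measurable]: "f \<in> M \<rightarrow>\<^sub>M Pi\<^sub>M {..<d} (\<lambda>_. borel)" "g \<in> M \<rightarrow>\<^sub>M Pi\<^sub>M {..<d} (\<lambda>_. borel)"
    using assms by (simp_all cong: measurable_cong_sets add: sets_gauss)
  show ?thesis unfolding cosine_def by measurable
qed

lemma ecount_measurable:
  assumes "\<And>i j. 1 \<le> i \<Longrightarrow> i < j \<Longrightarrow> j \<le> n \<Longrightarrow> {x \<in> space M. Q (f x i) (f x j)} \<in> sets M"
  shows "(\<lambda>x. ecount Q n (f x)) \<in> borel_measurable M"
proof -
  have "(\<lambda>x. of_bool (Q (f x i) (f x j)) :: real) \<in> borel_measurable M" if "(i, j) \<in> vpairs n" for i j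
    using assms[of i j] that
    by (subst measurable_cong[of _ _ "indicator {x \<in> space M. Q (f x i) (f x j)}"])
      (auto simp: vpairs_def indicator_def)
  then show ?thesis unfolding ecount_def by (intro borel_measurable_sum) auto
qed

lemma ecount_cosine_measurable [measurable]:
  "edges d t n \<in> borel_measurable (gauss_points n d)"
  by (rule ecount_measurable) measurable

text \<open>Adjacency depends on directions only, and directions of independent Gaussian vectors are
  independent uniform points. This moves the whole problem to \<open>gauss_points\<close>.\<close>

lemma measure_sphere_points_edges:
  "measure (sphere_points n d) {X \<in> space (sphere_points n d). a \<le> real (card (rgg_edges n d t X))}
     = edge_tail n d t a"
proof -
  let ?D = "compose {1..n} (direction d)"
  have "direction d \<in> gauss d \<rightarrow>\<^sub>M uniform_sphere d"
    using direction_measurable[of d] by (simp cong: measurable_cong_sets add: sets_uniform_sphere)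
  then have D: "?D \<in> gauss_points n d \<rightarrow>\<^sub>M sphere_points n d"
    unfolding sphere_points_def compose_def by measurable
  have [measurable]: "(\<lambda>X. X i) \<in> sphere_points n d \<rightarrow>\<^sub>M Pi\<^sub>M {..<d} (\<lambda>_. borel)" if "i \<in> {1..n}" for i
    using measurable_component_singleton[of i "{1..n}" "\<lambda>_. uniform_sphere d"] that
    by (simp cong: measurable_cong_sets add: sets_uniform_sphere sphere_points_def)
  have [measurable]: "ecount (\<lambda>x y. t \<le> sphere_inner d x y) n \<in> borel_measurable (sphere_points n d)"
    by (rule ecount_measurable) measurable
  have "measure (sphere_points n d) {X \<in> space (sphere_points n d). a \<le> real (card (rgg_edges n d t X))}
      = measure (distr (gauss_points n d) (sphere_points n d) ?D)
        {X \<in> space (sphere_points n d). a \<le> ecount (\<lambda>x y. t \<le> sphere_inner d x y) n X}"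
    unfolding distr_gauss_points_direction card_rgg_edges ..
  also have "\<dots> = measure (gauss_points n d)
      (?D -` {X \<in> space (sphere_points n d). a \<le> ecount (\<lambda>x y. t \<le> sphere_inner d x y) n X} \<inter> space (gauss_points n d))"
    by (rule measure_distr[OF D]) measurable
  also have "ecount (\<lambda>x y. t \<le> sphere_inner d x y) n (?D X) = edges d t n X" for X
    by (rule ecount_cong) (auto simp: compose_def sphere_inner_direction)
  then have "?D -` {X \<in> space (sphere_points n d). a \<le> ecount (\<lambda>x y. t \<le> sphere_inner d x y) n X} \<inter> space (gauss_points n d)
      = {X \<in> space (gauss_points n d). a \<le> edges d t n X}"
    using measurable_space[OF D] by auto
  finally show ?thesis .
qed

lemma emeasure_ge_eq_nn_integral:
  assumes "{x \<in> space M. a \<le> f x} \<in> sets M"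
  shows "emeasure M {x \<in> space M. a \<le> f x} = (\<integral>\<^sup>+x. indicator {a..} (f x) \<partial>M)"
  by (subst nn_integral_indicator[OF assms, symmetric]) (auto intro!: nn_integral_cong simp: indicator_def)

text \<open>The edge count is a function of norms and inner products, hence unchanged when one
  reflection is applied to all vectors; this is the invariance that the triangular reduction asks
  for.\<close>

lemma measure_edges_triang:
  assumes "n \<le> d"
  shows "edge_tail n d t a
    = measure (gauss_points n d) {X \<in> space (gauss_points n d).
        a \<le> edges d t n (\<lambda>i. triang d (i - 1) (X i))}"
    (is "measure ?G ?A = measure ?G ?B")
proof -
  let ?h = "\<lambda>X. \<lambda>i\<in>{1..n}. triang d (i - 1) (X i)"
  let ?E = "edges d t n"
  have h[measurable]: "?h \<in> ?G \<rightarrow>\<^sub>M ?G" by measurable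
  have eq: "?E (\<lambda>i. triang d (i - 1) (X i)) = ?E (?h X)" for X
    by (rule ecount_cong) auto
  have E: "?E \<in> borel_measurable ?G" "(\<lambda>X. ?E (?h X)) \<in> borel_measurable ?G"
    by measurable
  have [measurable]: "?A \<in> sets ?G" "?B \<in> sets ?G"
    unfolding eq by (intro borel_measurable_le borel_measurable_const E)+
  have "emeasure ?G ?A = (\<integral>\<^sup>+X. indicator {a..} (?E X) \<partial>?G)"
    by (rule emeasure_ge_eq_nn_integral) fact
  also have "\<dots> = (\<integral>\<^sup>+X. indicator {a..} (?E (?h X)) \<partial>?G)"
  proof (rule nn_integral_gauss_points_triang[OF _ assms])
    fix v and X :: "nat \<Rightarrow> nat \<Rightarrow> real"
    have "?E (\<lambda>i\<in>{1..n}. reflect d v (X i)) = ?E X"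
      by (rule ecount_cong) (auto simp: cosine_def sphere_inner_reflect L2_set_reflect)
    then show "indicator {a..} (?E (\<lambda>i\<in>{1..n}. reflect d v (X i))) = (indicator {a..} (?E X) :: ennreal)"
      by simp
  qed measurable
  also have "\<dots> = emeasure ?G ?B"
    unfolding eq[symmetric] by (rule emeasure_ge_eq_nn_integral[symmetric]) fact
  finally show ?thesis by (simp add: measure_def)
qed

lemma cosine_triang:
  assumes "1 \<le> i" "i < j" "j \<le> d"
  shows "cosine d (triang d (i - 1) x) (triang d (j - 1) y)
    = ((\<Sum>k<i - 1. x k * y k) + L2_set x {i - 1..<d} * y (i - 1)) / (L2_set x {..<d} * L2_set y {..<d})"
  using assms by (simp add: cosine_def L2_set_triang sphere_inner_triang)

lemma AE_gauss_L2_set: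
  assumes "d \<ge> 1"
  shows "AE x in gauss d. L2_set x {..<d} > 0"
proof -
  have "AE z in std_gauss. z \<noteq> (0 :: real)"
    unfolding std_gauss_def by (subst AE_density) (auto intro: AE_lborel_singleton[THEN AE_mp])
  then have "AE x in gauss d. x 0 \<noteq> (0 :: real)"
    using assms by (intro AE_PiM_component) (auto simp: prob_space_std_gauss)
  then show ?thesis
  proof eventually_elim
    case (elim x)
    then have "L2_set x {..<d} \<noteq> 0" using assms by (auto simp: L2_set_eq_0_iff)
    then show ?case using L2_set_nonneg[of x "{..<d}"] by linarith
  qed
qed

text \<open>For two vectors the triangular form puts the first one on the axis of index 0, where its
  norm cancels from the cosine. The threshold becomes a quantile of one coordinate of a normalised
  Gaussian vector.\<close>

lemma is_threshold_iff:
  assumes "d \<ge> 2"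
  shows "is_threshold p d t \<longleftrightarrow> measure (gauss d) {x \<in> space (gauss d). t * L2_set x {..<d} \<le> x 0} = p"
proof -
  let ?G = "gauss_points 2 d"
  have vp: "vpairs 2 = {(1, 2)}" by (auto simp: vpairs_def)
  have pt: "real (card (rgg_edges 2 d t X)) = of_bool (t \<le> sphere_inner d (X 1) (X 2))" for X
    by (simp add: card_rgg_edges ecount_def vp)
  have "measure (sphere_points 2 d) {X \<in> space (sphere_points 2 d). sphere_inner d (X 1) (X 2) \<ge> t}
     = measure (sphere_points 2 d) {X \<in> space (sphere_points 2 d). 1 \<le> real (card (rgg_edges 2 d t X))}"
    by (intro arg_cong[where f="measure (sphere_points 2 d)"] Collect_cong) (simp add: pt of_bool_def)
  also have "\<dots> = measure ?G {X \<in> space ?G.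
        1 \<le> edges d t 2 (\<lambda>i. triang d (i - 1) (X i))}"
    using assms by (subst measure_sphere_points_edges, subst measure_edges_triang) auto
  also have "\<dots> = measure ?G {X \<in> space ?G. t * L2_set (X 2) {..<d} \<le> X 2 0}"
  proof (rule measure_eq_AE)
    have AE: "AE X in ?G. L2_set (X i) {..<d} > 0" if "i \<in> {1..2}" for i
      using that AE_gauss_L2_set[of d] assms by (intro AE_PiM_component) (auto simp: prob_space_gauss)
    show "AE X in ?G. (X \<in> {X \<in> space ?G. 1 \<le> edges d t 2 (\<lambda>i. triang d (i - 1) (X i))})
        = (X \<in> {X \<in> space ?G. t * L2_set (X 2) {..<d} \<le> X 2 0})"
      using AE[of 1, simplified] AE[of 2, simplified]
    proof eventually_elim
      case (elim X)
      then show ?case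
        using cosine_triang[of 1 2 d "X 1" "X 2"] assms
        by (simp add: ecount_def vp pos_le_divide_eq atLeast0LessThan mult.assoc mult_le_cancel_left_pos
            mult.left_commute[of t])
    qed
    have "(\<lambda>X. edges d t 2 (\<lambda>i. triang d (i - 1) (X i))) \<in> borel_measurable ?G"
      by (rule ecount_measurable) measurable
    then show "{X \<in> space ?G. 1 \<le> edges d t 2 (\<lambda>i. triang d (i - 1) (X i))} \<in> sets ?G"
      by measurable
    show "{X \<in> space ?G. t * L2_set (X 2) {..<d} \<le> X 2 0} \<in> sets ?G"
      using assms
      by (intro borel_measurable_le borel_measurable_times borel_measurable_const
          measurable_L2_set_coordinate measurable_coordinate) auto
  qed
  also have "\<dots> = measure (distr ?G (gauss d) (\<lambda>X. X 2)) {x \<in> space (gauss d). t * L2_set x {..<d} \<le> x 0}"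
  proof (subst measure_distr)
    show "{x \<in> space (gauss d). t * L2_set x {..<d} \<le> x 0} \<in> sets (gauss d)"
      using assms
      by (intro borel_measurable_le borel_measurable_times borel_measurable_const
          measurable_gauss_L2_set measurable_gauss_coordinate) auto
    have *: "(\<lambda>X. X 2) \<in> ?G \<rightarrow>\<^sub>M gauss d" by measurable
    show "measure ?G {X \<in> space ?G. t * L2_set (X 2) {..<d} \<le> X 2 0}
      = measure ?G ((\<lambda>X. X 2) -` {x \<in> space (gauss d). t * L2_set x {..<d} \<le> x 0} \<inter> space ?G)"
      using measurable_space[OF *] by (intro arg_cong[where f="measure ?G"]) auto
  qed measurable
  also have "distr ?G (gauss d) (\<lambda>X. X 2) = gauss d"
    by (rule distr_PiM_component) (auto simp: prob_space_gauss)
  finally show ?thesis unfolding is_threshold_def by simp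
qed

section \<open>Gaussian estimates\<close>

text \<open>Markov's inequality with \<open>f\<close> as majorant of the indicator. If
  \<open>A\<close> is not an event, its \<open>measure\<close> is 0 and the bound is
  trivial.\<close>

lemma (in prob_space) prob_le_nn_integral:
  assumes "\<And>x. x \<in> A \<Longrightarrow> 1 \<le> f x" "(\<integral>\<^sup>+x. f x \<partial>M) \<le> ennreal c" "0 \<le> c"
  shows "prob A \<le> c"
proof (cases "A \<in> events")
  case True
  have "ennreal (prob A) = (\<integral>\<^sup>+x. indicator A x \<partial>M)"
    using True by (simp add: emeasure_eq_measure)
  also have "\<dots> \<le> (\<integral>\<^sup>+x. f x \<partial>M)"
    using assms(1) by (intro nn_integral_mono) (auto simp: indicator_def)
  also have "\<dots> \<le> ennreal c" by fact
  finally show ?thesis using assms(3) by simp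
qed (use assms in \<open>simp add: measure_notin_sets\<close>)

lemma nn_integral_gauss_points_prod:
  assumes "\<And>i k. f i k \<in> borel_measurable borel"
  shows "(\<integral>\<^sup>+X. (\<Prod>i\<in>{1..n}. \<Prod>k<d. f i k (X i k)) \<partial>gauss_points n d)
    = (\<Prod>i\<in>{1..n}. \<Prod>k<d. \<integral>\<^sup>+z. f i k z \<partial>std_gauss)"
proof -
  have f: "f i k \<in> borel_measurable std_gauss" for i k
    using assms by (simp cong: measurable_cong_sets)
  have "(\<integral>\<^sup>+X. (\<Prod>i\<in>{1..n}. \<Prod>k<d. f i k (X i k)) \<partial>gauss_points n d)
      = (\<Prod>i\<in>{1..n}. \<integral>\<^sup>+x. (\<Prod>k<d. f i k (x k)) \<partial>gauss d)"
    using assms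
    by (intro gauss_points.product_nn_integral_prod borel_measurable_prod_ennreal)
      (auto intro!: measurable_compose[OF measurable_gauss_coordinate])
  also have "\<dots> = (\<Prod>i\<in>{1..n}. \<Prod>k<d. \<integral>\<^sup>+z. f i k z \<partial>std_gauss)"
    using f by (intro prod.cong gauss.product_nn_integral_prod) auto
  finally show ?thesis .
qed

text \<open>Multiplying the standard density by exp (s z^2) yields \<sigma> times the centred normal
  density of variance \<sigma>^2 = 1 / (1 - 2 s).\<close>

lemma nn_integral_std_gauss_exp_sq:
  assumes "s < 1 / 2"
  shows "(\<integral>\<^sup>+z. ennreal (exp (s * z\<^sup>2)) \<partial>std_gauss) = ennreal (1 / sqrt (1 - 2 * s))"
proof -
  define \<sigma> where "\<sigma> = 1 / sqrt (1 - 2 * s)"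
  have \<sigma>: "\<sigma> > 0" "\<sigma>\<^sup>2 = 1 / (1 - 2 * s)"
    using assms by (auto simp: \<sigma>_def power_divide)
  have eq: "std_normal_density z * exp (s * z\<^sup>2) = \<sigma> * normal_density 0 \<sigma> z" for z
  proof -
    have "normal_density 0 \<sigma> z = 1 / (sqrt (2 * pi) * \<sigma>) * exp (- (z\<^sup>2) / (2 * \<sigma>\<^sup>2))"
      using \<sigma>(1) by (simp add: normal_density_def real_sqrt_mult)
    also have "- (z\<^sup>2) / (2 * \<sigma>\<^sup>2) = - z\<^sup>2 / 2 + s * z\<^sup>2"
      using assms by (simp add: \<sigma>(2) field_simps)
    finally show ?thesis
      using \<sigma>(1) by (simp add: std_normal_density_def flip: exp_add)
  qed
  interpret N: prob_space "density lborel (normal_density 0 \<sigma>)"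
    using \<sigma>(1) by (rule prob_space_normal_density)
  have one: "(\<integral>\<^sup>+z. ennreal (normal_density 0 \<sigma> z) \<partial>lborel) = 1"
    using N.emeasure_space_1 by (simp add: emeasure_density)
  have "(\<integral>\<^sup>+z. ennreal (exp (s * z\<^sup>2)) \<partial>std_gauss)
      = (\<integral>\<^sup>+z. ennreal (std_normal_density z) * ennreal (exp (s * z\<^sup>2)) \<partial>lborel)"
    unfolding std_gauss_def by (rule nn_integral_density) auto
  also have "\<dots> = (\<integral>\<^sup>+z. ennreal \<sigma> * ennreal (normal_density 0 \<sigma> z) \<partial>lborel)"
    using \<sigma>(1) by (intro nn_integral_cong) (simp add: eq flip: ennreal_mult)
  also have "\<dots> = ennreal \<sigma>"
    by (simp add: nn_integral_cmult one)
  finally show ?thesis by (simp add: \<sigma>_def)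
qed

lemma nn_integral_gauss_exp_norm:
  assumes "s < 1 / 2"
  shows "(\<integral>\<^sup>+x. ennreal (exp (s * ((L2_set x {..<d})\<^sup>2 - c * real d))) \<partial>gauss d)
    = ennreal ((exp (- s * c) / sqrt (1 - 2 * s)) ^ d)"
proof -
  have "exp (s * ((L2_set x {..<d})\<^sup>2 - c * real d)) = (\<Prod>k<d. exp (- s * c) * exp (s * (x k)\<^sup>2))" for x
  proof -
    have "s * ((L2_set x {..<d})\<^sup>2 - c * real d) = (\<Sum>k<d. - s * c + s * (x k)\<^sup>2)"
      by (simp add: L2_set_def sum_nonneg sum.distrib sum_subtractf sum_distrib_left algebra_simps)
    then show ?thesis by (simp only: exp_add exp_sum finite_lessThan)
  qed
  then have "(\<integral>\<^sup>+x. ennreal (exp (s * ((L2_set x {..<d})\<^sup>2 - c * real d))) \<partial>gauss d)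
      = (\<integral>\<^sup>+x. (\<Prod>k<d. ennreal (exp (- s * c)) * ennreal (exp (s * (x k)\<^sup>2))) \<partial>gauss d)"
    by (simp add: prod_ennreal flip: ennreal_mult)
  also have "\<dots> = (\<Prod>k<d. \<integral>\<^sup>+z. ennreal (exp (- s * c)) * ennreal (exp (s * z\<^sup>2)) \<partial>std_gauss)"
    by (intro gauss.product_nn_integral_prod) auto
  also have "\<dots> = (\<Prod>k<d. ennreal (exp (- s * c) / sqrt (1 - 2 * s)))"
  proof -
    have "(\<integral>\<^sup>+z. ennreal (exp (- s * c)) * ennreal (exp (s * z\<^sup>2)) \<partial>std_gauss)
        = ennreal (exp (- s * c)) * ennreal (1 / sqrt (1 - 2 * s))"
      using assms by (subst nn_integral_cmult) (simp_all add: nn_integral_std_gauss_exp_sq)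
    also have "\<dots> = ennreal (exp (- s * c) / sqrt (1 - 2 * s))"
      using assms by (subst ennreal_mult[symmetric]) auto
    finally show ?thesis by (simp only:)
  qed
  also have "\<dots> = ennreal ((exp (- s * c) / sqrt (1 - 2 * s)) ^ d)"
    unfolding prod_constant card_lessThan using assms by (intro ennreal_power) simp
  finally show ?thesis .
qed

section \<open>Concentration of the Gaussian norm\<close>

lemma measure_gauss_norm_ge:
  assumes "0 < \<delta>" "\<delta> < 1"
  shows "measure (gauss d) {x \<in> space (gauss d). (1 + \<delta>) * real d \<le> (L2_set x {..<d})\<^sup>2}
    \<le> exp (- \<delta>\<^sup>2 / 16 * real d)"
proof (rule prob_space.prob_le_nn_integral[OF prob_space_gauss])
  \<comment> \<open>By the bound on \<open>ln (1 - 2 * s)\<close> below, the exponent per coordinate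
    is at most 4 s^2 - s \<delta>; this value of \<open>s\<close> minimises it.\<close>
  define s where "s = \<delta> / 8"
  have s: "0 < s" "s < 1 / 4" using assms by (auto simp: s_def)
  show "1 \<le> ennreal (exp (s * ((L2_set x {..<d})\<^sup>2 - (1 + \<delta>) * real d)))"
    if "x \<in> {x \<in> space (gauss d). (1 + \<delta>) * real d \<le> (L2_set x {..<d})\<^sup>2}" for x
    using that s by simp
  have ln: "- (2 * s) - 2 * (2 * s)\<^sup>2 \<le> ln (1 - 2 * s)"
    using s by (intro ln_one_minus_pos_lower_bound) auto
  have "exp (- s * (1 + \<delta>)) / sqrt (1 - 2 * s) = exp (- s * (1 + \<delta>) - ln (1 - 2 * s) / 2)"
    using s by (simp add: exp_diff ln_sqrt[symmetric])
  also have "- s * (1 + \<delta>) - ln (1 - 2 * s) / 2 \<le> 4 * s\<^sup>2 - s * \<delta>"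
    using ln by (simp add: power2_eq_square algebra_simps)
  also have "4 * s\<^sup>2 - s * \<delta> = - \<delta>\<^sup>2 / 16"
    by (simp add: s_def power2_eq_square field_simps)
  finally have "(exp (- s * (1 + \<delta>)) / sqrt (1 - 2 * s)) ^ d \<le> exp (- \<delta>\<^sup>2 / 16) ^ d"
    using s by (intro power_mono) auto
  also have "\<dots> = exp (- \<delta>\<^sup>2 / 16 * real d)" by (simp add: exp_of_nat_mult[symmetric] mult.commute)
  finally show "(\<integral>\<^sup>+x. ennreal (exp (s * ((L2_set x {..<d})\<^sup>2 - (1 + \<delta>) * real d))) \<partial>gauss d)
      \<le> ennreal (exp (- \<delta>\<^sup>2 / 16 * real d))"
    using s by (subst nn_integral_gauss_exp_norm) (auto intro: ennreal_leI)
qed simp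

lemma measure_gauss_norm_le:
  assumes "0 < \<delta>" "\<delta> < 1"
  shows "measure (gauss d) {x \<in> space (gauss d). (L2_set x {..<d})\<^sup>2 \<le> (1 - \<delta>) * real d}
    \<le> exp (- \<delta>\<^sup>2 / 16 * real d)"
proof (rule prob_space.prob_le_nn_integral[OF prob_space_gauss])
  \<comment> \<open>The parameter of the upper deviation is kept, so that both deviations share the
    rate \<delta>^2 / 16; the exponent 2 s^2 - s \<delta> is even smaller here.\<close>
  define s where "s = \<delta> / 8"
  have s: "0 < s" "s < 1 / 4" using assms by (auto simp: s_def)
  show "1 \<le> ennreal (exp (- s * ((L2_set x {..<d})\<^sup>2 - (1 - \<delta>) * real d)))"
    if "x \<in> {x \<in> space (gauss d). (L2_set x {..<d})\<^sup>2 \<le> (1 - \<delta>) * real d}" for x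
    using that s by (simp add: mult_le_0_iff mult_nonneg_nonpos)
  have ln: "2 * s - (2 * s)\<^sup>2 \<le> ln (1 + 2 * s)"
    using s by (intro ln_one_plus_pos_lower_bound) auto
  have "exp (- (- s) * (1 - \<delta>)) / sqrt (1 - 2 * (- s)) = exp (s * (1 - \<delta>) - ln (1 + 2 * s) / 2)"
    using s by (simp add: exp_diff ln_sqrt[symmetric])
  also have "s * (1 - \<delta>) - ln (1 + 2 * s) / 2 \<le> 2 * s\<^sup>2 - s * \<delta>"
    using ln by (simp add: power2_eq_square algebra_simps)
  also have "2 * s\<^sup>2 - s * \<delta> \<le> - \<delta>\<^sup>2 / 16"
    by (simp add: s_def power2_eq_square field_simps)
  finally have "(exp (- (- s) * (1 - \<delta>)) / sqrt (1 - 2 * (- s))) ^ d \<le> exp (- \<delta>\<^sup>2 / 16) ^ d"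
    using s by (intro power_mono) auto
  also have "\<dots> = exp (- \<delta>\<^sup>2 / 16 * real d)" by (simp add: exp_of_nat_mult[symmetric] mult.commute)
  finally show "(\<integral>\<^sup>+x. ennreal (exp (- s * ((L2_set x {..<d})\<^sup>2 - (1 - \<delta>) * real d))) \<partial>gauss d)
      \<le> ennreal (exp (- \<delta>\<^sup>2 / 16 * real d))"
    using s by (subst nn_integral_gauss_exp_norm) (auto intro: ennreal_leI)
qed simp

section \<open>One-dimensional Gaussian probabilities\<close>

lemma measure_gauss_coordinate:
  assumes "k < d" "A \<in> sets borel"
  shows "measure (gauss d) {x \<in> space (gauss d). x k \<in> A} = measure std_gauss A"
proof -
  have "measure std_gauss A = measure (distr (gauss d) std_gauss (\<lambda>x. x k)) A"
    using assms by (subst distr_PiM_component) (auto simp: prob_space_std_gauss)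
  also have "\<dots> = measure (gauss d) ((\<lambda>x. x k) -` A \<inter> space (gauss d))"
    using assms by (intro measure_distr) auto
  also have "(\<lambda>x. x k) -` A \<inter> space (gauss d) = {x \<in> space (gauss d). x k \<in> A}" by auto
  finally show ?thesis ..
qed

lemma nn_integral_std_gauss_sq: "(\<integral>\<^sup>+z. ennreal (z\<^sup>2) \<partial>std_gauss) = 1"
  using std_normal_distribution_even_moments[of 1]
  by (simp add: std_gauss_def nn_integral_eq_integral)

lemma measure_std_gauss_tail:
  assumes "L > 0"
  shows "measure std_gauss {z. L \<le> \<bar>z\<bar>} \<le> 1 / L\<^sup>2"
proof (rule std_gauss.prob_le_nn_integral)
  show "1 \<le> ennreal (1 / L\<^sup>2) * ennreal (z\<^sup>2)" if "z \<in> {z. L \<le> \<bar>z\<bar>}" for z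
  proof -
    have "L\<^sup>2 \<le> \<bar>z\<bar>\<^sup>2" using that assms by (intro power_mono) auto
    then show ?thesis using assms by (simp flip: ennreal_mult)
  qed
  show "(\<integral>\<^sup>+z. ennreal (1 / L\<^sup>2) * ennreal (z\<^sup>2) \<partial>std_gauss) \<le> ennreal (1 / L\<^sup>2)"
    by (subst nn_integral_cmult) (auto simp: nn_integral_std_gauss_sq)
qed (use assms in simp)

lemma std_normal_density_le_1: "std_normal_density z \<le> 1"
proof -
  have "1 \<le> sqrt (2 * pi)" using pi_gt3 by (intro real_le_rsqrt) simp
  then have "1 / sqrt (2 * pi) * exp (- z\<^sup>2 / 2) \<le> 1 * 1" by (intro mult_mono) auto
  then show ?thesis by (simp add: std_normal_density_def)
qed

lemma measure_std_gauss_Icc_le: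
  assumes "a \<le> b"
  shows "measure std_gauss {a..b} \<le> b - a"
proof -
  have "ennreal (measure std_gauss {a..b}) = (\<integral>\<^sup>+z. ennreal (std_normal_density z) * indicator {a..b} z \<partial>lborel)"
    unfolding std_gauss.emeasure_eq_measure[symmetric] by (simp add: std_gauss_def emeasure_density)
  also have "\<dots> \<le> (\<integral>\<^sup>+z. indicator {a..b} z \<partial>lborel)"
    using std_normal_density_le_1 by (intro nn_integral_mono) (auto simp: indicator_def)
  also have "\<dots> = ennreal (b - a)" using assms by simp
  finally show ?thesis using assms by simp
qed

lemma measure_std_gauss_Icc_ge:
  assumes "0 \<le> a" "a \<le> b"
  shows "(b - a) * std_normal_density b \<le> measure std_gauss {a..b}"
proof -
  have "ennreal (std_normal_density b * (b - a)) = (\<integral>\<^sup>+z. ennreal (std_normal_density b) * indicator {a..b} z \<partial>lborel)"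
    using assms by (subst nn_integral_cmult) (simp_all add: ennreal_mult)
  also have "\<dots> \<le> (\<integral>\<^sup>+z. ennreal (std_normal_density z) * indicator {a..b} z \<partial>lborel)"
  proof (rule nn_integral_mono)
    fix z show "ennreal (std_normal_density b) * indicator {a..b} z \<le> ennreal (std_normal_density z) * indicator {a..b} z"
    proof (cases "z \<in> {a..b}")
      case True
      then have "z\<^sup>2 \<le> b\<^sup>2" using assms by (intro power_mono) auto
      then show ?thesis
        using True by (auto simp: std_normal_density_def intro!: ennreal_leI divide_right_mono)
    qed simp
  qed
  also have "\<dots> = ennreal (measure std_gauss {a..b})"
    unfolding std_gauss.emeasure_eq_measure[symmetric] by (simp add: std_gauss_def emeasure_density)
  finally show ?thesis by (simp add: mult.commute)
qed

section \<open>Location of the threshold\<close>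

lemma exp_neg_le_eventually:
  assumes "c > 0" "e > 0"
  obtains d0 :: nat where "\<And>d. d \<ge> d0 \<Longrightarrow> exp (- c * real d) \<le> e"
proof
  fix d assume "d \<ge> nat \<lceil>- ln e / c\<rceil>"
  then have "- ln e / c \<le> real d" by linarith
  then have "- ln e \<le> real d * c" using assms by (simp only: pos_divide_le_eq)
  then have "exp (- c * real d) \<le> exp (ln e)" by (simp add: mult.commute)
  then show "exp (- c * real d) \<le> e" using assms by simp
qed

lemma threshold_set_measurable:
  "d \<ge> 1 \<Longrightarrow> {x \<in> space (gauss d). t * L2_set x {..<d} \<le> x 0} \<in> sets (gauss d)"
  by (intro borel_measurable_le borel_measurable_times borel_measurable_const
      measurable_gauss_L2_set measurable_gauss_coordinate) auto

lemma gauss_norm_sets: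
  "{x \<in> space (gauss d). a \<le> (L2_set x {..<d})\<^sup>2} \<in> sets (gauss d)"
  "{x \<in> space (gauss d). (L2_set x {..<d})\<^sup>2 \<le> a} \<in> sets (gauss d)"
  by (intro borel_measurable_le borel_measurable_power borel_measurable_const measurable_gauss_L2_set; simp)+

lemma gauss_coordinate_sets:
  "k < d \<Longrightarrow> A \<in> sets borel \<Longrightarrow> {x \<in> space (gauss d). x k \<in> A} \<in> sets (gauss d)"
  using measurable_sets[OF measurable_gauss_coordinate, of k d A] by (simp add: vimage_def Int_def conj_commute)

lemma borel_abs_ge_sets: "{z::real. a \<le> \<bar>z\<bar>} \<in> sets borel"
  by measurable

text \<open>A large |t| forces either the edge event or its complement into the set where |x 0| is
  at least |t| times the norm. Unless the norm is atypically small, |x 0| is then at least |t| sqrt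
  (d / 2), which Chebyshev's inequality makes unlikely. Both events have probability at least
  p.\<close>

lemma threshold_sqrt_bound:
  assumes "0 < p" "p \<le> 1 / 2"
  obtains d0 where "\<And>d t. d \<ge> d0 \<Longrightarrow> is_threshold p d t \<Longrightarrow> \<bar>t\<bar> * sqrt (real d) \<le> 2 / sqrt p"
proof -
  \<comment> \<open>The rate 1/64 is \<delta>^2 / 16 at \<delta> = 1/2.\<close>
  obtain d1 where d1: "\<And>d. d \<ge> d1 \<Longrightarrow> exp (- (1 / 64) * real d) \<le> p / 2"
    using exp_neg_le_eventually[of "1/64" "p/2"] assms by auto
  show ?thesis
  proof
    fix d t assume d: "d \<ge> max 2 d1" and thr: "is_threshold p d t"
    interpret G: prob_space "gauss d" by (rule prob_space_gauss)
    let ?A = "{x \<in> space (gauss d). t * L2_set x {..<d} \<le> x 0}"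
    let ?B = "{x \<in> space (gauss d). (L2_set x {..<d})\<^sup>2 \<le> (1 - 1 / 2) * real d}"
    let ?L = "\<bar>t\<bar> * sqrt (real d / 2)"
    let ?C = "{x \<in> space (gauss d). x 0 \<in> {z. ?L \<le> \<bar>z\<bar>}}"
    have pA: "measure (gauss d) ?A = p" using thr d by (simp add: is_threshold_iff)
    show "\<bar>t\<bar> * sqrt (real d) \<le> 2 / sqrt p"
    proof (cases "t = 0")
      case False
      have meas: "?A \<in> sets (gauss d)" "?B \<in> sets (gauss d)" "?C \<in> sets (gauss d)"
        using d by (intro threshold_set_measurable gauss_norm_sets gauss_coordinate_sets borel_abs_ge_sets; simp)+
      have key: "x \<in> ?B \<union> ?C" if x: "x \<in> space (gauss d)" "\<bar>t\<bar> * L2_set x {..<d} \<le> \<bar>x 0\<bar>" for x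
      proof (cases "(L2_set x {..<d})\<^sup>2 \<le> (1 - 1 / 2) * real d")
        case False
        then have "sqrt (real d / 2) \<le> L2_set x {..<d}"
          by (intro real_le_lsqrt) auto
        then have "?L \<le> \<bar>t\<bar> * L2_set x {..<d}" by (intro mult_left_mono) auto
        then show ?thesis using x by auto
      qed (use x in auto)
      have "p \<le> measure (gauss d) (?B \<union> ?C)"
      proof (cases "t > 0")
        case True
        have "?A \<subseteq> ?B \<union> ?C"
        proof
          fix x assume "x \<in> ?A"
          then have x: "x \<in> space (gauss d)" "t * L2_set x {..<d} \<le> x 0" by auto
          with True have "\<bar>t\<bar> * L2_set x {..<d} \<le> \<bar>x 0\<bar>" by (simp add: abs_if)
          with x show "x \<in> ?B \<union> ?C" by (intro key)
        qed
        then have "measure (gauss d) ?A \<le> measure (gauss d) (?B \<union> ?C)"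
          using meas by (intro G.finite_measure_mono sets.Un)
        then show ?thesis by (simp only: pA)
      next
        \<comment> \<open>For negative \<open>t\<close> the complement of the edge event is the rare
          one; its probability is 1 - p, at least p since p is at most 1/2.\<close>
        case neg: False
        have "space (gauss d) - ?A \<subseteq> ?B \<union> ?C"
        proof
          fix x assume "x \<in> space (gauss d) - ?A"
          then have x: "x \<in> space (gauss d)" "x 0 < t * L2_set x {..<d}" by auto
          have "t * L2_set x {..<d} \<le> 0" using neg by (intro mult_nonpos_nonneg) auto
          with x neg have "\<bar>t\<bar> * L2_set x {..<d} \<le> \<bar>x 0\<bar>" by (simp add: abs_if)
          with x show "x \<in> ?B \<union> ?C" by (intro key)
        qed
        then have "measure (gauss d) (space (gauss d) - ?A) \<le> measure (gauss d) (?B \<union> ?C)"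
          using meas by (intro G.finite_measure_mono sets.Un)
        then have "1 - p \<le> measure (gauss d) (?B \<union> ?C)"
          unfolding G.prob_compl[OF meas(1)] pA .
        then show ?thesis using assms by linarith
      qed
      also have "\<dots> \<le> measure (gauss d) ?B + measure (gauss d) ?C"
        using meas by (intro measure_Un_le)
      also have "measure (gauss d) ?B \<le> p / 2"
        using measure_gauss_norm_le[of "1/2" d] d1[of d] d by (simp add: power_divide)
      also have "measure (gauss d) ?C \<le> 1 / ?L\<^sup>2"
        using d False by (subst measure_gauss_coordinate) (auto intro!: measure_std_gauss_tail)
      finally have "p / 2 \<le> 1 / ?L\<^sup>2" by simp
      also have "?L\<^sup>2 = t\<^sup>2 * real d / 2" by (simp add: power_mult_distrib)
      finally have "p * (t\<^sup>2 * real d) \<le> 4"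
        using False d by (simp add: field_simps)
      then have "(\<bar>t\<bar> * sqrt (real d))\<^sup>2 \<le> (2 / sqrt p)\<^sup>2"
        using assms by (simp add: power_mult_distrib power_divide field_simps)
      then show ?thesis by (rule power2_le_imp_le) (use assms in simp)
    qed (use assms in simp)
  qed
qed

text \<open>If \<open>t\<close> exceeded \<open>s\<close>, an edge would place the vector in a
  narrow cone about axis 0, where |x 1| \<le> \<kappa> |x 0|. Then |x 0| \<ge> \<open>L\<close> or
  |x 1| \<le> \<kappa> \<open>L\<close>; each has probability at most p/4, which contradicts edge
  probability p. The hypothesis \<open>d \<ge> 2\<close> provides the coordinate
  \<open>x 1\<close>.\<close>

lemma threshold_bounded_away:
  assumes "0 < p"
  obtains s where "0 < s" "s < 1" "\<And>d t. d \<ge> 2 \<Longrightarrow> is_threshold p d t \<Longrightarrow> t \<le> s"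
proof -
  define L where "L = 2 / sqrt p"
  \<comment> \<open>The interval of half-width \<kappa> \<open>L\<close> has length p/4, and
    \<open>s\<close> is the cosine of the angle with tangent \<kappa>.\<close>
  define \<kappa> where "\<kappa> = p / (8 * L)"
  define s where "s = 1 / sqrt (1 + \<kappa>\<^sup>2)"
  have L: "L > 0" "1 / L\<^sup>2 = p / 4" using assms by (auto simp: L_def power_divide)
  have \<kappa>: "\<kappa> > 0" "2 * (\<kappa> * L) = p / 4" using assms L by (auto simp: \<kappa>_def)
  have s: "0 < s" "s < 1" "s\<^sup>2 * (1 + \<kappa>\<^sup>2) = 1"
  proof -
    have pos: "0 < 1 + \<kappa>\<^sup>2" using \<kappa> by (simp add: add_pos_nonneg)
    then show "0 < s" by (simp add: s_def)
    have "1 < sqrt (1 + \<kappa>\<^sup>2)" using \<kappa> by simp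
    then show "s < 1" unfolding s_def by (subst divide_less_eq_1_pos) linarith+
    show "s\<^sup>2 * (1 + \<kappa>\<^sup>2) = 1" using pos by (simp add: s_def power_divide)
  qed
  have "t \<le> s" if d: "d \<ge> 2" and thr: "is_threshold p d t" for d t
  proof (rule ccontr)
    assume "\<not> t \<le> s"
    then have t: "t > s" by simp
    interpret G: prob_space "gauss d" by (rule prob_space_gauss)
    let ?A = "{x \<in> space (gauss d). t * L2_set x {..<d} \<le> x 0}"
    let ?B = "{x \<in> space (gauss d). x 0 \<in> {z. L \<le> \<bar>z\<bar>}}"
    let ?C = "{x \<in> space (gauss d). x 1 \<in> {- (\<kappa> * L)..\<kappa> * L}}"
    have "?A \<subseteq> ?B \<union> ?C"
    proof
      fix x assume x: "x \<in> ?A"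
      let ?N = "L2_set x {..<d}"
      have "s * ?N \<le> t * ?N" using t by (intro mult_right_mono) auto
      then have sx: "s * ?N \<le> x 0" using x by simp
      then have "(s * ?N)\<^sup>2 \<le> (x 0)\<^sup>2" using s by (intro power_mono) auto
      then have 1: "s\<^sup>2 * ?N\<^sup>2 \<le> (x 0)\<^sup>2" by (simp add: power_mult_distrib)
      have "(\<Sum>k\<in>{0, 1}. (x k)\<^sup>2) \<le> (\<Sum>k<d. (x k)\<^sup>2)"
        using d by (intro sum_mono2) auto
      then have "(x 0)\<^sup>2 + (x 1)\<^sup>2 \<le> ?N\<^sup>2" by (simp add: L2_set_def sum_nonneg)
      then have "s\<^sup>2 * ((x 0)\<^sup>2 + (x 1)\<^sup>2) \<le> s\<^sup>2 * ?N\<^sup>2" by (intro mult_left_mono) auto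
      with 1 have 2: "s\<^sup>2 * ((x 0)\<^sup>2 + (x 1)\<^sup>2) \<le> (x 0)\<^sup>2" by linarith
      also have "(x 0)\<^sup>2 = s\<^sup>2 * ((x 0)\<^sup>2 + \<kappa>\<^sup>2 * (x 0)\<^sup>2)"
        using s(3) by (metis distrib_right mult.assoc mult_1)
      finally have "(x 1)\<^sup>2 \<le> (\<kappa> * x 0)\<^sup>2"
        using s by (simp add: power_mult_distrib)
      then have 3: "\<bar>x 1\<bar> \<le> \<kappa> * \<bar>x 0\<bar>"
        using \<kappa> by (simp add: abs_le_square_iff[symmetric] abs_mult)
      show "x \<in> ?B \<union> ?C"
      proof (cases "L \<le> \<bar>x 0\<bar>")
        case False
        then have "\<kappa> * \<bar>x 0\<bar> \<le> \<kappa> * L" using \<kappa> by (intro mult_left_mono) auto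
        with 3 x show ?thesis by (auto simp: abs_le_iff)
      qed (use x in auto)
    qed
    moreover have meas: "?A \<in> sets (gauss d)" "?B \<in> sets (gauss d)" "?C \<in> sets (gauss d)"
      using d by (auto intro!: threshold_set_measurable gauss_coordinate_sets simp del: space_PiM)
    ultimately have "measure (gauss d) ?A \<le> measure (gauss d) (?B \<union> ?C)"
      by (intro G.finite_measure_mono sets.Un)
    also have "\<dots> \<le> measure (gauss d) ?B + measure (gauss d) ?C"
      using meas by (intro measure_Un_le)
    also have "measure (gauss d) ?B \<le> p / 4"
      using d L measure_std_gauss_tail[of L] by (subst measure_gauss_coordinate) auto
    also have "measure (gauss d) ?C = measure std_gauss {- (\<kappa> * L)..\<kappa> * L}"
      using d by (intro measure_gauss_coordinate) auto
    also have "\<dots> \<le> \<kappa> * L - - (\<kappa> * L)"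
      using L(1) \<kappa>(1) by (intro measure_std_gauss_Icc_le) simp
    also have "\<dots> = p / 4" using \<kappa>(2) by linarith
    finally show False using thr d assms by (simp add: is_threshold_iff)
  qed
  with s that show ?thesis by blast
qed

text \<open>When the norm is within a factor 1 \<plusminus> \<delta> of sqrt d, the condition
  \<open>x 0\<close> \<ge> t * norm can differ from \<open>x 0\<close> \<ge> t sqrt d only in a
  short window around t sqrt d, and the density is at most 1. The margin \<open>\<eta>\<close> is
  room for the later error in comparing an edge with its deciding coordinate.\<close>

lemma threshold_gauss_tail:
  assumes "0 < p" "p \<le> 1 / 2" "0 < \<zeta>"
  obtains \<eta> d0 where "\<eta> > 0"
    "\<And>d t. d \<ge> d0 \<Longrightarrow> is_threshold p d t \<Longrightarrow> measure std_gauss {t * sqrt (real d) - \<eta>..} \<le> p + \<zeta>"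
proof -
  define \<Theta> where "\<Theta> = 2 / sqrt p"
  define \<eta> where "\<eta> = \<zeta> / 4"
  \<comment> \<open>The excess \<zeta> is spent on the two norm events, \<zeta>/4 each, and on a
    window of length \<Theta> \<delta> + \<eta>, at most \<zeta>/2.\<close>
  define \<delta> where "\<delta> = min (1 / 2) (\<zeta> / (4 * \<Theta>))"
  have \<Theta>: "\<Theta> > 0" using assms by (simp add: \<Theta>_def)
  have \<delta>: "0 < \<delta>" "\<delta> < 1" "\<delta> \<le> \<zeta> / (4 * \<Theta>)" using assms \<Theta> by (auto simp: \<delta>_def)
  then have \<Theta>\<delta>: "\<Theta> * \<delta> \<le> \<zeta> / 4" using \<Theta> by (simp add: field_simps)
  obtain d1 where d1: "\<And>d t. d \<ge> d1 \<Longrightarrow> is_threshold p d t \<Longrightarrow> \<bar>t\<bar> * sqrt (real d) \<le> \<Theta>"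
    using threshold_sqrt_bound[OF assms(1,2)] unfolding \<Theta>_def by metis
  obtain d2 where d2: "\<And>d. d \<ge> d2 \<Longrightarrow> exp (- (\<delta>\<^sup>2 / 16) * real d) \<le> \<zeta> / 4"
    using exp_neg_le_eventually[of "\<delta>\<^sup>2 / 16" "\<zeta> / 4"] assms \<delta> by auto
  have "measure std_gauss {t * sqrt (real d) - \<eta>..} \<le> p + \<zeta>"
    if d: "d \<ge> Max {2, d1, d2}" and thr: "is_threshold p d t" for d t
  proof -
    have d: "d \<ge> 2" "d \<ge> d1" "d \<ge> d2" using d by auto
    interpret G: prob_space "gauss d" by (rule prob_space_gauss)
    define \<theta> where "\<theta> = t * sqrt (real d)"
    have \<theta>: "\<bar>\<theta>\<bar> \<le> \<Theta>" using d1[OF d(2) thr] by (simp add: \<theta>_def abs_mult)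
    let ?A = "{x \<in> space (gauss d). t * L2_set x {..<d} \<le> x 0}"
    let ?B = "{x \<in> space (gauss d). (1 + \<delta>) * real d \<le> (L2_set x {..<d})\<^sup>2}"
    let ?C = "{x \<in> space (gauss d). (L2_set x {..<d})\<^sup>2 \<le> (1 - \<delta>) * real d}"
    let ?D = "{x \<in> space (gauss d). x 0 \<in> {\<theta> - \<eta>..\<theta> + \<Theta> * \<delta>}}"
    let ?E = "{x \<in> space (gauss d). x 0 \<in> {\<theta> - \<eta>..}}"
    have meas: "?A \<in> sets (gauss d)" "?B \<in> sets (gauss d)" "?C \<in> sets (gauss d)"
        "?D \<in> sets (gauss d)" "?E \<in> sets (gauss d)"
      using d by (intro threshold_set_measurable gauss_norm_sets gauss_coordinate_sets borel_abs_ge_sets; simp)+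
    have "?E \<subseteq> ?A \<union> (?B \<union> (?C \<union> ?D))"
    proof
      fix x assume x: "x \<in> ?E"
      let ?N = "L2_set x {..<d}"
      show "x \<in> ?A \<union> (?B \<union> (?C \<union> ?D))"
      proof (rule ccontr)
        assume "x \<notin> ?A \<union> (?B \<union> (?C \<union> ?D))"
        with x have *: "x 0 < t * ?N" "?N\<^sup>2 < (1 + \<delta>) * real d" "(1 - \<delta>) * real d < ?N\<^sup>2"
          "\<theta> + \<Theta> * \<delta> < x 0" by auto
        have "(1 + \<delta>) * real d \<le> (1 + \<delta>)\<^sup>2 * real d"
          using \<delta> by (intro mult_right_mono self_le_power) auto
        with *(2) have "?N\<^sup>2 \<le> ((1 + \<delta>) * sqrt (real d))\<^sup>2" by (simp add: power_mult_distrib)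
        then have up: "?N \<le> (1 + \<delta>) * sqrt (real d)"
          using \<delta> by (intro power2_le_imp_le[of ?N]) auto
        have "(1 - \<delta>)\<^sup>2 * real d \<le> (1 - \<delta>) * real d"
          using \<delta> by (intro mult_right_mono) (auto simp: power2_eq_square mult_left_le)
        with *(3) have "((1 - \<delta>) * sqrt (real d))\<^sup>2 \<le> ?N\<^sup>2" by (simp add: power_mult_distrib)
        then have lo: "(1 - \<delta>) * sqrt (real d) \<le> ?N"
          by (rule power2_le_imp_le) auto
        have "t * ?N \<le> \<theta> + \<bar>\<theta>\<bar> * \<delta>"
        proof (cases "t \<ge> 0")
          case True
          then have "t * ?N \<le> t * ((1 + \<delta>) * sqrt (real d))" using up by (intro mult_left_mono)
          then show ?thesis using True by (simp add: \<theta>_def algebra_simps)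
        next
          case False
          then have "t * ?N \<le> t * ((1 - \<delta>) * sqrt (real d))" using lo by (intro mult_left_mono_neg) auto
          moreover have "\<bar>\<theta>\<bar> = - \<theta>" using False by (simp add: \<theta>_def abs_mult)
          ultimately show ?thesis by (simp add: \<theta>_def algebra_simps)
        qed
        also have "\<bar>\<theta>\<bar> * \<delta> \<le> \<Theta> * \<delta>" using \<theta> \<delta> by (intro mult_right_mono) auto
        finally show False using * by simp
      qed
    qed
    then have "measure (gauss d) ?E \<le> measure (gauss d) (?A \<union> (?B \<union> (?C \<union> ?D)))"
      using meas by (intro G.finite_measure_mono sets.Un)
    also have "\<dots> \<le> measure (gauss d) ?A + (measure (gauss d) ?B + (measure (gauss d) ?C + measure (gauss d) ?D))"
      using meas by (intro order_trans[OF measure_Un_le] add_left_mono sets.Un order_refl)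
    also have "measure (gauss d) ?A = p" using thr d by (simp add: is_threshold_iff)
    also have "measure (gauss d) ?B \<le> \<zeta> / 4"
      using measure_gauss_norm_ge[OF \<delta>(1,2), of d] d2[OF d(3)] by simp
    also have "measure (gauss d) ?C \<le> \<zeta> / 4"
      using measure_gauss_norm_le[OF \<delta>(1,2), of d] d2[OF d(3)] by simp
    also have "measure (gauss d) ?D = measure std_gauss {\<theta> - \<eta>..\<theta> + \<Theta> * \<delta>}"
      using d by (intro measure_gauss_coordinate) auto
    also have "\<dots> \<le> \<zeta> / 2"
    proof -
      have "0 \<le> \<Theta> * \<delta>" using \<Theta> \<delta> by simp
      then show ?thesis
        using measure_std_gauss_Icc_le[of "\<theta> - \<eta>" "\<theta> + \<Theta> * \<delta>"] \<Theta>\<delta> assms(3) unfolding \<eta>_def by linarith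
    qed
    also have "measure (gauss d) ?E = measure std_gauss {\<theta> - \<eta>..}"
      using d by (intro measure_gauss_coordinate) auto
    finally show ?thesis by (simp add: \<theta>_def)
  qed
  moreover have "\<eta> > 0" using assms by (simp add: \<eta>_def)
  ultimately show ?thesis using that by blast
qed

section \<open>Decoupling into blocks\<close>

lemma sum_ordered_pairs:
  fixes e :: "nat \<Rightarrow> nat \<Rightarrow> real"
  assumes sym: "\<And>i j. e i j = e j i"
  shows "(\<Sum>(i, j)\<in>{(i, j). i \<in> {1..n} \<and> j \<in> {1..n} \<and> i \<noteq> j}. e i j) = 2 * (\<Sum>(i, j)\<in>vpairs n. e i j)"
proof -
  have "{(i, j). i \<in> {1..n} \<and> j \<in> {1..n} \<and> i \<noteq> j} = vpairs n \<union> prod.swap ` vpairs n"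
  proof (intro equalityI subsetI)
    fix z assume "z \<in> {(i, j). i \<in> {1..n} \<and> j \<in> {1..n} \<and> i \<noteq> j}"
    then obtain i j where z: "z = (i, j)" "i \<in> {1..n}" "j \<in> {1..n}" "i \<noteq> j" by auto
    show "z \<in> vpairs n \<union> prod.swap ` vpairs n"
    proof (cases "i < j")
      case False
      with z have "(j, i) \<in> vpairs n" by (auto simp: vpairs_def)
      then have "prod.swap (j, i) \<in> prod.swap ` vpairs n" by (rule imageI)
      with z show ?thesis by simp
    qed (use z in \<open>auto simp: vpairs_def\<close>)
  qed (auto simp: vpairs_def)
  moreover have "vpairs n \<inter> prod.swap ` vpairs n = {}"
    by (auto simp: vpairs_def)
  ultimately have "(\<Sum>(i, j)\<in>{(i, j). i \<in> {1..n} \<and> j \<in> {1..n} \<and> i \<noteq> j}. e i j)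
      = (\<Sum>(i, j)\<in>vpairs n. e i j) + (\<Sum>(i, j)\<in>prod.swap ` vpairs n. e i j)"
    by (simp add: sum.union_disjoint)
  also have "(\<Sum>(i, j)\<in>prod.swap ` vpairs n. e i j) = (\<Sum>(i, j)\<in>vpairs n. e i j)"
    by (subst sum.reindex) (auto intro!: sum.cong simp: sym)
  finally show ?thesis by simp
qed

text \<open>The sum over permutations does not depend on the pair (a, b), as composition with a
  fixed permutation carries any pair to any other. It equals its average over ordered pairs, and
  there each permutation merely rearranges the pairs.\<close>

lemma sum_permutations_pair:
  fixes e :: "nat \<Rightarrow> nat \<Rightarrow> real"
  assumes sym: "\<And>i j. e i j = e j i" and ab: "a \<in> {1..n}" "b \<in> {1..n}" "a \<noteq> b"
  shows "(\<Sum>\<pi> | \<pi> permutes {1..n}. e (\<pi> a) (\<pi> b)) * real (n choose 2) = fact n * (\<Sum>(i, j)\<in>vpairs n. e i j)"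
proof -
  let ?S = "{\<pi>. \<pi> permutes {1..n}}"
  let ?D = "{(i, j). i \<in> {1..n} \<and> j \<in> {1..n} \<and> i \<noteq> j}"
  define c where "c = (\<Sum>\<pi>\<in>?S. e (\<pi> a) (\<pi> b))"
  have c: "(\<Sum>\<pi>\<in>?S. e (\<pi> i) (\<pi> j)) = c" if ij: "i \<in> {1..n}" "j \<in> {1..n}" "i \<noteq> j" for i j
  proof -
    define j' where "j' = Transposition.transpose i a j"
    \<comment> \<open>Move \<open>i\<close> to \<open>a\<close>, then the current image
      \<open>j'\<close> of \<open>j\<close> to \<open>b\<close>. The second transposition leaves
      \<open>a\<close> in place because \<open>a\<close> differs from \<open>j'\<close> and
      \<open>b\<close>.\<close>
    define \<tau> where "\<tau> = Transposition.transpose j' b \<circ> Transposition.transpose i a"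
    have j': "j' \<in> {1..n}" "j' \<noteq> a"
      using ij ab by (auto simp: j'_def Transposition.transpose_def)
    have \<tau>: "\<tau> permutes {1..n}"
      unfolding \<tau>_def using ij ab j' by (intro permutes_compose permutes_swap_id)
    have "\<tau> i = a" "\<tau> j = b"
      using ij ab j' by (auto simp: \<tau>_def j'_def[symmetric])
    then have "(\<Sum>\<pi>\<in>?S. e (\<pi> a) (\<pi> b)) = (\<Sum>\<pi>\<in>?S. e ((\<pi> \<circ> \<tau>) i) ((\<pi> \<circ> \<tau>) j))"
      by simp
    also have "\<dots> = (\<Sum>\<pi>\<in>?S. e (\<pi> i) (\<pi> j))"
      using sum_permutations_compose_right[OF \<tau>, of "\<lambda>\<pi>. e (\<pi> i) (\<pi> j)"] by simp
    finally show ?thesis by (simp add: c_def)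
  qed
  have perm: "(\<Sum>(i, j)\<in>?D. e (\<pi> i) (\<pi> j)) = (\<Sum>(i, j)\<in>?D. e i j)" if "\<pi> \<in> ?S" for \<pi>
  proof (rule sum.reindex_bij_witness[of _ "map_prod (inv \<pi>) (inv \<pi>)" "map_prod \<pi> \<pi>"])
    have \<pi>: "\<pi> permutes {1..n}" using that by simp
    fix z
    show "map_prod (inv \<pi>) (inv \<pi>) (map_prod \<pi> \<pi> z) = z"
      using permutes_inverses[OF \<pi>] by (cases z) simp
    show "map_prod \<pi> \<pi> (map_prod (inv \<pi>) (inv \<pi>) z) = z"
      using permutes_inverses[OF \<pi>] by (cases z) simp
    show "map_prod \<pi> \<pi> z \<in> ?D" if "z \<in> ?D"
    proof -
      obtain i j where z: "z = (i, j)" by (cases z)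
      then have "i \<in> {1..n}" "j \<in> {1..n}" "\<pi> i \<noteq> \<pi> j"
        using that permutes_inj[OF \<pi>] by (auto simp: inj_def)
      then show ?thesis using z permutes_in_image[OF \<pi>] by auto
    qed
    show "map_prod (inv \<pi>) (inv \<pi>) z \<in> ?D" if "z \<in> ?D"
    proof -
      note \<pi>' = permutes_inv[OF \<pi>]
      obtain i j where z: "z = (i, j)" by (cases z)
      then have "i \<in> {1..n}" "j \<in> {1..n}" "inv \<pi> i \<noteq> inv \<pi> j"
        using that permutes_inj[OF \<pi>'] by (auto simp: inj_def)
      then show ?thesis using z permutes_in_image[OF \<pi>'] by auto
    qed
  qed (auto simp: case_prod_unfold)
  have D: "(\<Sum>(i, j)\<in>?D. c) = (\<Sum>(i, j)\<in>?D. \<Sum>\<pi>\<in>?S. e (\<pi> i) (\<pi> j))"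
    by (intro sum.cong) (auto simp: c simp del: One_nat_def)
  also have "\<dots> = (\<Sum>\<pi>\<in>?S. \<Sum>(i, j)\<in>?D. e (\<pi> i) (\<pi> j))"
    unfolding case_prod_unfold by (rule sum.swap)
  also have "\<dots> = (\<Sum>\<pi>\<in>?S. \<Sum>(i, j)\<in>?D. e i j)"
    by (intro sum.cong perm) auto
  also have "\<dots> = fact n * (\<Sum>(i, j)\<in>?D. e i j)"
    using card_permutations[of "{1..n}" n] by simp
  also have "(\<Sum>(i, j)\<in>?D. e i j) = 2 * (\<Sum>(i, j)\<in>vpairs n. e i j)"
    using sym by (rule sum_ordered_pairs)
  finally have "(\<Sum>(i, j)\<in>?D. c) = fact n * (2 * (\<Sum>(i, j)\<in>vpairs n. e i j))" .
  moreover have "(\<Sum>(i, j)\<in>?D. c) = 2 * (\<Sum>(i, j)\<in>vpairs n. c)"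
    by (rule sum_ordered_pairs) simp
  ultimately show ?thesis
    by (simp add: c_def card_vpairs mult.commute)
qed

lemma block_le:
  fixes b k m n :: nat
  assumes "b < k" "k * m \<le> n"
  shows "b * m + m \<le> n"
proof -
  have "Suc b * m \<le> k * m" using assms by (intro mult_le_mono1) simp
  with assms show ?thesis by simp
qed

lemma permutes_block:
  fixes b m n :: nat
  assumes "\<pi> permutes {1..n}" "b * m + m \<le> n" "i \<in> {1..m}"
  shows "\<pi> (b * m + i) \<in> {1..n}"
  unfolding permutes_in_image[OF assms(1)] using assms by simp

text \<open>Under a uniform permutation, any two positions of a block receive a uniform pair of
  vertices. The remainder of n modulo m leaves some vertices outside the blocks for each
  permutation, but averaging treats all pairs alike.\<close>

lemma ecount_average_blocks:
  fixes Q :: "'a \<Rightarrow> 'a \<Rightarrow> bool"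
  assumes sym: "\<And>x y. Q x y = Q y x" and m: "2 \<le> m" "m \<le> n"
  shows "ecount Q n X / real (n choose 2) = (\<Sum>\<pi> | \<pi> permutes {1..n}.
    (1 / fact n) * ((\<Sum>b<n div m. ecount Q m (\<lambda>i. X (\<pi> (b * m + i)))) / (real (n div m) * real (m choose 2))))"
proof -
  define k where "k = n div m"
  let ?S = "{\<pi>. \<pi> permutes {1..n}}"
  let ?N = "real (n choose 2)" and ?M = "real (m choose 2)"
  define e where "e i j = (of_bool (Q (X i) (X j)) :: real)" for i j
  have e: "e i j = e j i" for i j by (simp add: e_def sym)
  have pos: "?N > 0" "?M > 0" "k > 0" using m by (auto simp: k_def div_greater_zero_iff)
  have E: "ecount Q n X = (\<Sum>(i, j)\<in>vpairs n. e i j)" by (simp add: ecount_def e_def)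
  have pair: "(\<Sum>\<pi>\<in>?S. e (\<pi> (b * m + i)) (\<pi> (b * m + j))) = fact n * ecount Q n X / ?N"
    if "b < k" "(i, j) \<in> vpairs m" for b i j
  proof -
    have "b * m + m \<le> n"
      using \<open>b < k\<close> by (rule block_le) (simp add: k_def)
    then have "(\<Sum>\<pi>\<in>?S. e (\<pi> (b * m + i)) (\<pi> (b * m + j))) * ?N = fact n * (\<Sum>(i, j)\<in>vpairs n. e i j)"
      using that(2) by (intro sum_permutations_pair e) (auto simp: vpairs_def)
    then show ?thesis using pos by (simp add: E field_simps)
  qed
  have "(\<Sum>\<pi>\<in>?S. \<Sum>b<k. ecount Q m (\<lambda>i. X (\<pi> (b * m + i))))
      = (\<Sum>b<k. \<Sum>(i, j)\<in>vpairs m. \<Sum>\<pi>\<in>?S. e (\<pi> (b * m + i)) (\<pi> (b * m + j)))"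
    unfolding ecount_def e_def case_prod_unfold
    by (subst sum.swap, rule sum.cong[OF refl], rule sum.swap)
  also have "\<dots> = (\<Sum>b<k. \<Sum>(i, j)\<in>vpairs m. fact n * ecount Q n X / ?N)"
    by (intro sum.cong refl) (auto simp: pair simp del: One_nat_def)
  also have "\<dots> = real k * ?M * (fact n * ecount Q n X / ?N)"
    by (simp add: card_vpairs)
  finally have *: "(\<Sum>\<pi>\<in>?S. \<Sum>b<k. ecount Q m (\<lambda>i. X (\<pi> (b * m + i)))) = real k * ?M * (fact n * ecount Q n X / ?N)" .
  have "(\<Sum>\<pi>\<in>?S. (1 / fact n) * ((\<Sum>b<k. ecount Q m (\<lambda>i. X (\<pi> (b * m + i)))) / (real k * ?M)))
      = (1 / (fact n * (real k * ?M))) * (\<Sum>\<pi>\<in>?S. \<Sum>b<k. ecount Q m (\<lambda>i. X (\<pi> (b * m + i))))"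
    by (subst sum_distrib_left, intro sum.cong refl) simp
  also have "\<dots> = ecount Q n X / ?N"
  proof -
    have "1 / (F * A) * (A * (F * E / N)) = E / N" if "A \<noteq> 0" "F \<noteq> 0" for A F E N :: real
      using that by simp
    then show ?thesis unfolding * using pos by (metis fact_nonzero less_irrefl mult_eq_0_iff of_nat_0_less_iff)
  qed
  finally show ?thesis by (simp add: k_def)
qed

lemma indep_vars_PiM_coordinates:
  assumes "prob_space M" "I \<noteq> {}"
  shows "prob_space.indep_vars (Pi\<^sub>M I (\<lambda>_. M)) (\<lambda>_. M) (\<lambda>i X. X i) I"
proof -
  interpret P: prob_space "Pi\<^sub>M I (\<lambda>_. M)" by (intro prob_space_PiM assms)
  have "distr (Pi\<^sub>M I (\<lambda>_. M)) (Pi\<^sub>M I (\<lambda>_. M)) (\<lambda>X. \<lambda>i\<in>I. X i) = distr (Pi\<^sub>M I (\<lambda>_. M)) (Pi\<^sub>M I (\<lambda>_. M)) (\<lambda>X. X)"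
    by (intro distr_cong refl) (auto simp: space_PiM PiE_iff extensional_def fun_eq_iff)
  also have "\<dots> = Pi\<^sub>M I (\<lambda>_. M)" by (rule distr_id)
  also have "\<dots> = Pi\<^sub>M I (\<lambda>i. distr (Pi\<^sub>M I (\<lambda>_. M)) M (\<lambda>X. X i))"
    by (intro PiM_cong refl, subst distr_PiM_component) (use assms in auto)
  finally show ?thesis
    using assms by (subst P.indep_vars_iff_distr_eq_PiM') auto
qed

text \<open>Images of distinct blocks under \<open>\<pi>\<close> are disjoint index sets, so the
  blocks are independent, and each has the law of m fresh points.\<close>

lemma nn_integral_blocks:
  fixes g :: "(nat \<Rightarrow> 'a) \<Rightarrow> ennreal"
  assumes M: "prob_space M" and g: "g \<in> borel_measurable (Pi\<^sub>M {1..m} (\<lambda>_. M))"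
    and \<pi>: "\<pi> permutes {1..n}" and m: "1 \<le> m" and k: "k * m \<le> n" "1 \<le> n"
  shows "(\<integral>\<^sup>+X. (\<Prod>b<k. g (\<lambda>i\<in>{1..m}. X (\<pi> (b * m + i)))) \<partial>Pi\<^sub>M {1..n} (\<lambda>_. M))
    = (\<integral>\<^sup>+Y. g Y \<partial>Pi\<^sub>M {1..m} (\<lambda>_. M)) ^ k"
proof -
  let ?P = "Pi\<^sub>M {1..n} (\<lambda>_. M)" and ?R = "Pi\<^sub>M {1..m} (\<lambda>_. M)"
  interpret P: prob_space ?P by (intro prob_space_PiM M)
  define J where "J b = (\<lambda>i. \<pi> (b * m + i)) ` {1..m}" for b
  have bm: "b * m + m \<le> n" if "b < k" for b
    using that k(1) by (rule block_le)
  have into: "(\<lambda>i. \<pi> (b * m + i)) \<in> {1..m} \<rightarrow> {1..n}" if "b < k" for b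
    using permutes_block[OF \<pi> bm[OF that]] by blast
  then have J: "J b \<subseteq> {1..n}" if "b < k" for b
    using that unfolding J_def by blast
  have inj: "inj_on (\<lambda>i. \<pi> (b * m + i)) {1..m}" for b
    by (intro inj_onI) (auto dest: injD[OF permutes_inj[OF \<pi>]])
  have disj: "disjoint_family_on J {..<k}"
  proof (unfold disjoint_family_on_def, intro ballI impI)
    fix b c assume bc: "b \<in> {..<k}" "c \<in> {..<k}" "b \<noteq> c"
    have "b * m + i \<noteq> c * m + j" if "i \<in> {1..m}" "j \<in> {1..m}" for i j
    proof
      assume eq: "b * m + i = c * m + j"
      \<comment> \<open>Positions in a block start at 1; after the shift, \<open>i - 1\<close> is a
        remainder modulo \<open>m\<close> and division recovers the block.\<close>
      have "i - 1 < m" "j - 1 < m" using that by auto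
      then have "(b * m + (i - 1)) div m = b" "(c * m + (j - 1)) div m = c"
        by simp_all
      moreover have "b * m + (i - 1) = c * m + (j - 1)" using eq that by auto
      ultimately have "b = c" by (simp only:)
      with bc show False by simp
    qed
    then show "J b \<inter> J c = {}"
      using permutes_inj[OF \<pi>] by (auto simp: J_def inj_eq)
  qed
  have "P.indep_vars (\<lambda>_. M) (\<lambda>i X. X i) {1..n}"
    using k by (intro indep_vars_PiM_coordinates M) auto
  then have "P.indep_vars (\<lambda>b. Pi\<^sub>M (J b) (\<lambda>_. M)) (\<lambda>b X. restrict (\<lambda>i. X i) (J b)) {..<k}"
    using J disj by (intro P.indep_vars_restrict[where I = "{1..n}"]) auto
  then have "P.indep_vars (\<lambda>_. borel) (\<lambda>b X. g (\<lambda>i\<in>{1..m}. restrict X (J b) (\<pi> (b * m + i)))) {..<k}"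
  proof (rule P.indep_vars_compose2)
    fix b
    have "(\<lambda>Y. \<lambda>i\<in>{1..m}. Y (\<pi> (b * m + i))) \<in> Pi\<^sub>M (J b) (\<lambda>_. M) \<rightarrow>\<^sub>M ?R"
      by (intro measurable_restrict measurable_component_singleton) (auto simp: J_def)
    from measurable_compose[OF this g]
    show "(\<lambda>Y. g (\<lambda>i\<in>{1..m}. Y (\<pi> (b * m + i)))) \<in> borel_measurable (Pi\<^sub>M (J b) (\<lambda>_. M))" .
  qed
  moreover have "(\<lambda>i\<in>{1..m}. restrict X (J b) (\<pi> (b * m + i))) = (\<lambda>i\<in>{1..m}. X (\<pi> (b * m + i)))" for X :: "nat \<Rightarrow> 'a" and b
    by (auto simp: J_def fun_eq_iff)
  ultimately have ind: "P.indep_vars (\<lambda>_. borel) (\<lambda>b X. g (\<lambda>i\<in>{1..m}. X (\<pi> (b * m + i)))) {..<k}"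
    by simp
  have "(\<integral>\<^sup>+X. (\<Prod>b<k. g (\<lambda>i\<in>{1..m}. X (\<pi> (b * m + i)))) \<partial>?P)
      = (\<Prod>b<k. \<integral>\<^sup>+X. g (\<lambda>i\<in>{1..m}. X (\<pi> (b * m + i))) \<partial>?P)"
    by (intro P.indep_vars_nn_integral ind) auto
  also have "\<dots> = (\<Prod>b<k. \<integral>\<^sup>+Y. g Y \<partial>?R)"
  proof (intro prod.cong refl)
    fix b assume b: "b \<in> {..<k}"
    have meas: "(\<lambda>X. \<lambda>i\<in>{1..m}. X (\<pi> (b * m + i))) \<in> ?P \<rightarrow>\<^sub>M ?R"
      using into[of b] b by (intro measurable_restrict measurable_component_singleton) auto
    have "distr ?P ?R (\<lambda>X. \<lambda>i\<in>{1..m}. X (\<pi> (b * m + i))) = ?R"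
      using into[of b] b inj[of b] M by (intro distr_PiM_reindex) auto
    then have "(\<integral>\<^sup>+Y. g Y \<partial>?R) = (\<integral>\<^sup>+Y. g Y \<partial>distr ?P ?R (\<lambda>X. \<lambda>i\<in>{1..m}. X (\<pi> (b * m + i))))"
      by simp
    also have "\<dots> = (\<integral>\<^sup>+X. g (\<lambda>i\<in>{1..m}. X (\<pi> (b * m + i))) \<partial>?P)"
      using meas g by (intro nn_integral_distr) auto
    finally show "(\<integral>\<^sup>+X. g (\<lambda>i\<in>{1..m}. X (\<pi> (b * m + i))) \<partial>?P) = (\<integral>\<^sup>+Y. g Y \<partial>?R)" ..
  qed
  finally show ?thesis by simp
qed

text \<open>
  Hoeffding's decoupling of a U-statistic: the edge density is the average over permutations of
  averages of the densities of disjoint blocks, to which Jensen's inequality applies.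
\<close>

lemma ecount_tail_blocks:
  fixes Q :: "'a \<Rightarrow> 'a \<Rightarrow> bool"
  assumes M: "prob_space M" and sym: "\<And>x y. Q x y = Q y x" and m: "2 \<le> m" "m \<le> n"
    and meas: "\<And>r. ecount Q r \<in> borel_measurable (Pi\<^sub>M {1..r} (\<lambda>_. M))"
    and lam: "0 \<le> l" and c: "0 \<le> c"
    and mgf: "(\<integral>\<^sup>+Y. ennreal (exp (l * (ecount Q m Y / real (m choose 2) - a))) \<partial>Pi\<^sub>M {1..m} (\<lambda>_. M)) \<le> ennreal c"
  shows "measure (Pi\<^sub>M {1..n} (\<lambda>_. M)) {X \<in> space (Pi\<^sub>M {1..n} (\<lambda>_. M)). a * real (n choose 2) \<le> ecount Q n X}
    \<le> c ^ (n div m)"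
proof (rule prob_space.prob_le_nn_integral[OF prob_space_PiM[OF M]])
  define k where "k = n div m"
  have k: "k > 0" "k * m \<le> n" using m by (auto simp: k_def div_greater_zero_iff)
  let ?P = "Pi\<^sub>M {1..n} (\<lambda>_. M)" and ?R = "Pi\<^sub>M {1..m} (\<lambda>_. M)"
  let ?S = "{\<pi>. \<pi> permutes {1..n}}"
  let ?N = "real (n choose 2)" and ?M = "real (m choose 2)"
  have pos: "?N > 0" "?M > 0" using m by auto
  define g where "g Y = exp (l * (ecount Q m Y / ?M - a))" for Y
  define blk where "blk \<pi> X b = (\<lambda>i\<in>{1..m}. X (\<pi> (b * m + i)))" for \<pi> and X :: "nat \<Rightarrow> 'a" and b
  have g: "(\<lambda>Y. ennreal (g Y)) \<in> borel_measurable ?R"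
    unfolding g_def using meas[of m] by measurable
  have card: "card ?S = fact n" using card_permutations[of "{1..n}" n] by simp
  have fin: "finite ?S" by (rule finite_permutations) simp
  have ne: "?S \<noteq> {}" using permutes_id by blast
  have jensen: "exp (real k * l * (ecount Q n X / ?N - a)) \<le> (\<Sum>\<pi>\<in>?S. (1 / fact n) * (\<Prod>b<k. g (blk \<pi> X b)))" for X
  proof -
    \<comment> \<open>The exponential parameter is \<open>l\<close> times the number
      \<open>k\<close> of blocks: the mean over \<open>k\<close> blocks then factorises into one
      exponential of parameter \<open>l\<close> per block.\<close>
    let ?y = "\<lambda>\<pi>. real k * l * ((\<Sum>b<k. ecount Q m (\<lambda>i. X (\<pi> (b * m + i)))) / (real k * ?M) - a)"
    have avg: "real k * l * (ecount Q n X / ?N - a) = (\<Sum>\<pi>\<in>?S. (1 / fact n) *\<^sub>R ?y \<pi>)"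
    proof -
      have "(\<Sum>\<pi>\<in>?S. (1 / fact n) *\<^sub>R ?y \<pi>) = real k * l *
        (\<Sum>\<pi>\<in>?S. (1 / fact n) * ((\<Sum>b<k. ecount Q m (\<lambda>i. X (\<pi> (b * m + i)))) / (real k * ?M)) - (1 / fact n) * a)"
        unfolding sum_distrib_left by (intro sum.cong) (auto simp: algebra_simps)
      also have "\<dots> = real k * l * (ecount Q n X / ?N - a)"
        unfolding sum_subtractf ecount_average_blocks[OF sym m, where X = X, folded k_def, symmetric]
        using card by simp
      finally show ?thesis ..
    qed
    have "exp (real k * l * (ecount Q n X / ?N - a)) \<le> (\<Sum>\<pi>\<in>?S. (1 / fact n) * exp (?y \<pi>))"
      unfolding avg by (rule convex_on_sum[OF fin ne exp_convex]) (simp_all add: card del: One_nat_def)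
    also have "\<dots> = (\<Sum>\<pi>\<in>?S. (1 / fact n) * (\<Prod>b<k. g (blk \<pi> X b)))"
    proof (rule sum.cong[OF refl])
      fix \<pi>
      have "ecount Q m (blk \<pi> X b) = ecount Q m (\<lambda>i. X (\<pi> (b * m + i)))" for b
        by (rule ecount_cong) (simp add: blk_def)
      then have "(\<Prod>b<k. g (blk \<pi> X b)) = (\<Prod>b<k. exp (l * (ecount Q m (\<lambda>i. X (\<pi> (b * m + i))) / ?M - a)))"
        by (simp only: g_def)
      also have "\<dots> = exp (\<Sum>b<k. l * (ecount Q m (\<lambda>i. X (\<pi> (b * m + i))) / ?M - a))"
        by (rule exp_sum[symmetric]) simp
      moreover have "(\<Sum>b<k. l * (ecount Q m (\<lambda>i. X (\<pi> (b * m + i))) / ?M - a)) = ?y \<pi>"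
        using k pos by (simp add: sum_subtractf sum_divide_distrib[symmetric] sum_distrib_left[symmetric] field_simps)
      ultimately show "(1 / fact n) * exp (?y \<pi>) = (1 / fact n) * (\<Prod>b<k. g (blk \<pi> X b))"
        by (simp only:)
    qed
    finally show ?thesis .
  qed
  show "1 \<le> ennreal (exp (real k * l * (ecount Q n X / ?N - a)))"
    if "X \<in> {X \<in> space ?P. a * ?N \<le> ecount Q n X}" for X
  proof -
    have "a \<le> ecount Q n X / ?N" using that pos by (simp add: pos_le_divide_eq)
    then have "0 \<le> real k * l * (ecount Q n X / ?N - a)" using lam by simp
    then show ?thesis by simp
  qed
  have "(\<integral>\<^sup>+X. ennreal (exp (real k * l * (ecount Q n X / ?N - a))) \<partial>?P)
      \<le> (\<integral>\<^sup>+X. (\<Sum>\<pi>\<in>?S. ennreal (1 / fact n) * (\<Prod>b<k. ennreal (g (blk \<pi> X b)))) \<partial>?P)"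
  proof (rule nn_integral_mono)
    fix X
    have "ennreal (\<Sum>\<pi>\<in>?S. (1 / fact n) * (\<Prod>b<k. g (blk \<pi> X b)))
        = (\<Sum>\<pi>\<in>?S. ennreal (1 / fact n) * (\<Prod>b<k. ennreal (g (blk \<pi> X b))))"
      by (subst sum_ennreal[symmetric])
        (auto simp: prod_ennreal g_def prod_nonneg ennreal_mult simp flip: ennreal_mult intro!: sum.cong)
    then show "ennreal (exp (real k * l * (ecount Q n X / ?N - a)))
        \<le> (\<Sum>\<pi>\<in>?S. ennreal (1 / fact n) * (\<Prod>b<k. ennreal (g (blk \<pi> X b))))"
      using ennreal_leI[OF jensen[of X]] by simp
  qed
  also have "\<dots> = (\<Sum>\<pi>\<in>?S. ennreal (1 / fact n) * (\<integral>\<^sup>+X. (\<Prod>b<k. ennreal (g (blk \<pi> X b))) \<partial>?P))"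
  proof -
    have "(\<lambda>X. \<Prod>b<k. ennreal (g (blk \<pi> X b))) \<in> borel_measurable ?P" if \<pi>: "\<pi> \<in> ?S" for \<pi>
    proof (rule borel_measurable_prod_ennreal)
      fix b assume "b \<in> {..<k}"
      then have "b * m + m \<le> n"
        using k(2) by (intro block_le[of b k]) auto
      then have "(\<lambda>X. blk \<pi> X b) \<in> ?P \<rightarrow>\<^sub>M ?R"
        unfolding blk_def using \<pi>
        by (intro measurable_restrict measurable_component_singleton)
          (rule permutes_block, auto)
      from measurable_compose[OF this g]
      show "(\<lambda>X. ennreal (g (blk \<pi> X b))) \<in> borel_measurable ?P" .
    qed
    then show ?thesis
      by (subst nn_integral_sum) (auto intro!: sum.cong nn_integral_cmult)
  qed
  also have "\<dots> = (\<Sum>\<pi>\<in>?S. ennreal (1 / fact n) * (\<integral>\<^sup>+Y. ennreal (g Y) \<partial>?R) ^ k)"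
    unfolding blk_def using m k by (intro sum.cong refl) (simp add: nn_integral_blocks[OF M g] del: One_nat_def)
  also have "\<dots> = (\<integral>\<^sup>+Y. ennreal (g Y) \<partial>?R) ^ k"
  proof -
    have "(\<Sum>\<pi>\<in>?S. ennreal (1 / fact n)) = ennreal (\<Sum>\<pi>\<in>?S. 1 / fact n)"
      by (rule sum_ennreal) simp
    also have "\<dots> = 1" by (simp only: sum_constant card) simp
    finally show ?thesis by (simp only: sum_distrib_right[symmetric] mult_1)
  qed
  also have "\<dots> \<le> ennreal c ^ k"
    using mgf unfolding g_def by (intro power_mono) auto
  finally show "(\<integral>\<^sup>+X. ennreal (exp (real k * l * (ecount Q n X / ?N - a))) \<partial>?P) \<le> ennreal (c ^ (n div m))"
    using c by (simp add: ennreal_power k_def)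
qed (use c in simp)

section \<open>The upper tail\<close>

lemma choose_two_bounds:
  fixes n :: nat
  assumes "2 \<le> n"
  shows "(real n)\<^sup>2 / 4 \<le> real (n choose 2)" "real (n choose 2) \<le> (real n)\<^sup>2 / 2"
    "1 \<le> real (n choose 2)"
proof -
  have eq: "real (n choose 2) = real n * (real n - 1) / 2"
  proof -
    have "2 dvd n * (n - 1)" by (cases "even n") auto
    then have "real (n choose 2) = real (n * (n - 1)) / 2"
      by (simp only: choose_two real_of_nat_div of_nat_numeral)
    then show ?thesis using assms by (simp add: of_nat_diff)
  qed
  have "0 \<le> real n * (real n - 2)" using assms by simp
  then show "(real n)\<^sup>2 / 4 \<le> real (n choose 2)"
    by (simp add: eq power2_eq_square algebra_simps)
  show "real (n choose 2) \<le> (real n)\<^sup>2 / 2"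
    by (simp add: eq power2_eq_square algebra_simps)
  have "0 < n choose 2" using assms by simp
  then show "1 \<le> real (n choose 2)" by linarith
qed

text \<open>The coordinates that decide the edges in triangular form, \<open>X j (i - 1)\<close>
  with i < j, are the first j - 1 coordinates of each vector j. No coordinate serves two pairs,
  which is the source of independence.\<close>

lemma sum_vpairs:
  fixes h :: "nat \<Rightarrow> nat \<Rightarrow> real"
  shows "(\<Sum>(i, j)\<in>vpairs n. h j (i - 1)) = (\<Sum>j\<in>{1..n}. \<Sum>k<j - 1. h j k)"
proof -
  have "(\<Sum>j\<in>{1..n}. \<Sum>k<j - 1. h j k) = (\<Sum>(j, k)\<in>(SIGMA j:{1..n}. {..<j - 1}). h j k)"
    by (rule sum.Sigma) auto
  also have "\<dots> = (\<Sum>(i, j)\<in>vpairs n. h j (i - 1))"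
    by (rule sum.reindex_bij_witness[of _ "\<lambda>(i, j). (j, i - 1)" "\<lambda>(j, k). (Suc k, j)"])
      (auto simp: vpairs_def)
  finally show ?thesis ..
qed

lemma sum_pred_choose: "(\<Sum>j\<in>{1..n}. j - 1) = n choose 2"
proof -
  have "real (\<Sum>j\<in>{1..n}. j - 1) = (\<Sum>j\<in>{1..n}. \<Sum>k<j - 1. 1)"
    by (simp del: One_nat_def)
  also have "\<dots> = (\<Sum>(i, j)\<in>vpairs n. 1)"
    by (rule sum_vpairs[symmetric])
  also have "\<dots> = real (n choose 2)" by (simp add: card_vpairs)
  finally show ?thesis by linarith
qed

lemma nn_integral_exp_vpairs:
  assumes g: "g \<in> borel_measurable borel" and "n \<le> d"
  shows "(\<integral>\<^sup>+X. ennreal (exp (\<Sum>(i, j)\<in>vpairs n. g (X j (i - 1)))) \<partial>gauss_points n d)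
    = (\<integral>\<^sup>+z. ennreal (exp (g z)) \<partial>std_gauss) ^ (n choose 2)"
proof -
  let ?c = "\<integral>\<^sup>+z. ennreal (exp (g z)) \<partial>std_gauss"
  define f where "f j k z = (if k < j - 1 then ennreal (exp (g z)) else 1)" for j k :: nat and z
  have f: "f j k \<in> borel_measurable borel" for j k
    unfolding f_def using g by (cases "k < j - 1") simp_all
  have cut: "(\<Prod>k<d. if k < j - 1 then y k else 1) = (\<Prod>k<j - 1. y k)" if "j \<in> {1..n}" for j and y :: "nat \<Rightarrow> ennreal"
  proof -
    have "{..<d} \<inter> {k. k < j - 1} = {..<j - 1}" using that \<open>n \<le> d\<close> by auto
    then show ?thesis by (simp add: prod.If_cases)
  qed
  have "ennreal (exp (\<Sum>(i, j)\<in>vpairs n. g (X j (i - 1)))) = (\<Prod>j\<in>{1..n}. \<Prod>k<d. f j k (X j k))" for X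
  proof -
    have "exp (\<Sum>(i, j)\<in>vpairs n. g (X j (i - 1))) = (\<Prod>j\<in>{1..n}. \<Prod>k<j - 1. exp (g (X j k)))"
      unfolding sum_vpairs[of "\<lambda>j k. g (X j k)"] by (simp add: exp_sum)
    then have "ennreal (exp (\<Sum>(i, j)\<in>vpairs n. g (X j (i - 1)))) = (\<Prod>j\<in>{1..n}. \<Prod>k<j - 1. ennreal (exp (g (X j k))))"
      by (simp add: prod_ennreal prod_nonneg)
    also have "\<dots> = (\<Prod>j\<in>{1..n}. \<Prod>k<d. f j k (X j k))"
      unfolding f_def by (intro prod.cong refl cut[symmetric])
    finally show ?thesis .
  qed
  then have "(\<integral>\<^sup>+X. ennreal (exp (\<Sum>(i, j)\<in>vpairs n. g (X j (i - 1)))) \<partial>gauss_points n d)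
      = (\<Prod>j\<in>{1..n}. \<Prod>k<d. \<integral>\<^sup>+z. f j k z \<partial>std_gauss)"
    by (simp only: nn_integral_gauss_points_prod[OF f])
  also have "\<dots> = (\<Prod>j\<in>{1..n}. \<Prod>k<d. if k < j - 1 then ?c else 1)"
    by (intro prod.cong refl) (simp add: f_def std_gauss.emeasure_space_1[unfolded space_std_gauss])
  also have "\<dots> = (\<Prod>j\<in>{1..n}. ?c ^ (j - 1))"
    by (intro prod.cong refl) (subst cut, simp_all)
  also have "\<dots> = ?c ^ (\<Sum>j\<in>{1..n}. j - 1)"
    by (rule power_sum[symmetric])
  also have "(\<Sum>j\<in>{1..n}. j - 1) = n choose 2" by (rule sum_pred_choose)
  finally show ?thesis .
qed

lemma (in prob_space) nn_integral_exp_indicator: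
  assumes A: "A \<in> events"
  shows "(\<integral>\<^sup>+x. ennreal (exp (l * (indicator A x - a))) \<partial>M)
    = ennreal (exp (- l * a) * (1 + prob A * (exp l - 1)))"
proof -
  have "(\<integral>\<^sup>+x. ennreal (exp (l * (indicator A x - a))) \<partial>M)
      = (\<integral>\<^sup>+x. ennreal (exp (l * (1 - a))) * indicator A x + ennreal (exp (- l * a)) * indicator (space M - A) x \<partial>M)"
    by (intro nn_integral_cong) (auto simp: indicator_def)
  also have "\<dots> = ennreal (exp (l * (1 - a))) * ennreal (prob A) + ennreal (exp (- l * a)) * ennreal (1 - prob A)"
    using A by (simp add: nn_integral_add nn_integral_cmult emeasure_eq_measure prob_compl)
  also have "\<dots> = ennreal (exp (l * (1 - a)) * prob A + exp (- l * a) * (1 - prob A))"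
    by (simp add: ennreal_mult)
  also have "exp (l * (1 - a)) * prob A + exp (- l * a) * (1 - prob A)
      = exp (- l * a) * (1 + prob A * (exp l - 1))"
    by (simp add: algebra_simps exp_diff exp_minus divide_inverse)
  finally show ?thesis .
qed

lemma bernoulli_mgf_le:
  fixes l q a :: real
  assumes "0 \<le> l" "l \<le> 1" "0 \<le> q"
  shows "exp (- l * a) * (1 + q * (exp l - 1)) \<le> exp (q * (l + l\<^sup>2) - l * a)"
proof -
  have "exp l - 1 \<le> l + l\<^sup>2" using exp_bound[OF assms(1,2)] by simp
  then have "1 + q * (exp l - 1) \<le> 1 + q * (l + l\<^sup>2)" using assms by (intro add_left_mono mult_left_mono) auto
  also have "\<dots> \<le> exp (q * (l + l\<^sup>2))" by (rule exp_ge_add_one_self)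
  finally have "exp (- l * a) * (1 + q * (exp l - 1)) \<le> exp (- l * a) * exp (q * (l + l\<^sup>2))"
    by (intro mult_left_mono) auto
  also have "\<dots> = exp (q * (l + l\<^sup>2) - l * a)" by (simp flip: exp_add)
  finally show ?thesis .
qed

text \<open>Chernoff's method for a sum of i.i.d. terms over all pairs; both the exponential
  parameter and the centring are absorbed into \<open>g\<close>.\<close>

lemma measure_vpairs_sum_nonneg:
  assumes g: "g \<in> borel_measurable borel" and "n \<le> d"
    and b: "(\<integral>\<^sup>+z. ennreal (exp (g z)) \<partial>std_gauss) \<le> ennreal (exp (- b))"
  shows "measure (gauss_points n d) {X \<in> space (gauss_points n d). 0 \<le> (\<Sum>(i, j)\<in>vpairs n. g (X j (i - 1)))}
    \<le> exp (- b * real (n choose 2))"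
proof (rule prob_space.prob_le_nn_integral[OF prob_space_gauss_points])
  have "(\<integral>\<^sup>+X. ennreal (exp (\<Sum>(i, j)\<in>vpairs n. g (X j (i - 1)))) \<partial>gauss_points n d)
      = (\<integral>\<^sup>+z. ennreal (exp (g z)) \<partial>std_gauss) ^ (n choose 2)"
    using g \<open>n \<le> d\<close> by (rule nn_integral_exp_vpairs)
  also have "\<dots> \<le> ennreal (exp (- b)) ^ (n choose 2)"
    by (intro power_mono b) simp
  also have "\<dots> = ennreal (exp (- b * real (n choose 2)))"
    by (simp add: ennreal_power mult.commute flip: exp_of_nat_mult)
  finally show "(\<integral>\<^sup>+X. ennreal (exp (\<Sum>(i, j)\<in>vpairs n. g (X j (i - 1)))) \<partial>gauss_points n d)
      \<le> ennreal (exp (- b * real (n choose 2)))" .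
qed simp_all

lemma measure_count_ge:
  assumes "n \<le> d" "0 < \<zeta>" "\<zeta> \<le> 2" and q: "measure std_gauss {\<tau>..} \<le> p + \<zeta>"
  shows "measure (gauss_points n d) {X \<in> space (gauss_points n d).
      (p + 2 * \<zeta>) * real (n choose 2) \<le> (\<Sum>(i, j)\<in>vpairs n. of_bool (\<tau> \<le> X j (i - 1)))}
    \<le> exp (- (\<zeta>\<^sup>2 / 4) * real (n choose 2))"
proof -
  \<comment> \<open>With the probability bounded by 1 in the quadratic term, the exponent is at most
    s^2 - s \<zeta>, minimal at \<zeta>/2. The hypothesis \<zeta> \<le> 2 gives s \<le> 1, as
    \<open>bernoulli_mgf_le\<close> requires.\<close>
  define s where "s = \<zeta> / 2"
  have s: "0 < s" "s \<le> 1" using assms by (auto simp: s_def)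
  let ?q = "measure std_gauss {\<tau>..}"
  define g where "g z = s * (indicator {\<tau>..} z - (p + 2 * \<zeta>))" for z :: real
  have sum_g: "(\<Sum>(i, j)\<in>vpairs n. g (X j (i - 1)))
      = s * ((\<Sum>(i, j)\<in>vpairs n. of_bool (\<tau> \<le> X j (i - 1))) - (p + 2 * \<zeta>) * real (n choose 2))"
    for X :: "nat \<Rightarrow> nat \<Rightarrow> real"
    by (simp add: g_def case_prod_unfold sum_subtractf card_vpairs indicator_def of_bool_def
        right_diff_distrib sum_distrib_left mult.commute)
  have "(\<integral>\<^sup>+z. ennreal (exp (g z)) \<partial>std_gauss) = ennreal (exp (- s * (p + 2 * \<zeta>)) * (1 + ?q * (exp s - 1)))"
    unfolding g_def by (rule std_gauss.nn_integral_exp_indicator) simp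
  also have "\<dots> \<le> ennreal (exp (- (\<zeta>\<^sup>2 / 4)))"
  proof (rule ennreal_leI)
    have "?q * s \<le> (p + \<zeta>) * s" using q s by (intro mult_right_mono) auto
    moreover have "?q * s\<^sup>2 \<le> 1 * s\<^sup>2" by (intro mult_right_mono std_gauss.prob_le_1) auto
    ultimately have "?q * (s + s\<^sup>2) - s * (p + 2 * \<zeta>) \<le> s\<^sup>2 - s * \<zeta>"
      by (simp add: algebra_simps)
    also have "\<dots> = - (\<zeta>\<^sup>2 / 4)" by (simp add: s_def power2_eq_square field_simps)
    finally have "exp (?q * (s + s\<^sup>2) - s * (p + 2 * \<zeta>)) \<le> exp (- (\<zeta>\<^sup>2 / 4))" by simp
    moreover have "exp (- s * (p + 2 * \<zeta>)) * (1 + ?q * (exp s - 1)) \<le> exp (?q * (s + s\<^sup>2) - s * (p + 2 * \<zeta>))"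
      using s by (intro bernoulli_mgf_le) auto
    ultimately show "exp (- s * (p + 2 * \<zeta>)) * (1 + ?q * (exp s - 1)) \<le> exp (- (\<zeta>\<^sup>2 / 4))" by linarith
  qed
  finally have "(\<integral>\<^sup>+z. ennreal (exp (g z)) \<partial>std_gauss) \<le> ennreal (exp (- (\<zeta>\<^sup>2 / 4)))" .
  moreover have "g \<in> borel_measurable borel" unfolding g_def by measurable
  ultimately show ?thesis
    using measure_vpairs_sum_nonneg[of g n d "\<zeta>\<^sup>2 / 4"] \<open>n \<le> d\<close> s unfolding sum_g
    by (simp add: zero_le_mult_iff del: One_nat_def)
qed

lemma measure_sum_squares_ge:
  assumes "n \<le> d"
  shows "measure (gauss_points n d) {X \<in> space (gauss_points n d).
      4 * real (n choose 2) \<le> (\<Sum>(i, j)\<in>vpairs n. (X j (i - 1))\<^sup>2)} \<le> exp (- (1 / 2) * real (n choose 2))"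
proof -
  \<comment> \<open>Exponential parameter 1/4 at level 4: the moment per entry is exp (-1) sqrt 2,
    and sqrt 2 is at most exp (1/2) because 2 \<le> exp 1.\<close>
  define g where "g z = - 1 + (1 / 4) * z\<^sup>2" for z :: real
  have sum_g: "(\<Sum>(i, j)\<in>vpairs n. g (X j (i - 1)))
      = (1 / 4) * ((\<Sum>(i, j)\<in>vpairs n. (X j (i - 1))\<^sup>2) - 4 * real (n choose 2))"
    for X :: "nat \<Rightarrow> nat \<Rightarrow> real"
    by (simp add: g_def case_prod_unfold sum.distrib sum_subtractf card_vpairs right_diff_distrib sum_distrib_left sum_negf sum_divide_distrib)
  have "(\<integral>\<^sup>+z. ennreal (exp (g z)) \<partial>std_gauss) = (\<integral>\<^sup>+z. ennreal (exp (- 1)) * ennreal (exp ((1 / 4) * z\<^sup>2)) \<partial>std_gauss)"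
    unfolding g_def exp_add by (simp add: ennreal_mult)
  also have "\<dots> = ennreal (exp (- 1)) * ennreal (1 / sqrt (1 - 2 * (1 / 4)))"
    by (subst nn_integral_cmult, simp) (subst nn_integral_std_gauss_exp_sq, simp_all)
  also have "\<dots> = ennreal (exp (- 1) * sqrt 2)"
    by (subst ennreal_mult[symmetric]) (auto simp: real_sqrt_divide)
  also have "\<dots> \<le> ennreal (exp (- (1 / 2)))"
  proof (rule ennreal_leI)
    have "2 \<le> exp (1 :: real)" using exp_ge_add_one_self[of 1] by simp
    then have "sqrt 2 \<le> exp (1 / 2)" by (intro real_le_lsqrt) (auto simp flip: exp_double)
    then have "exp (- 1) * sqrt 2 \<le> exp (- 1) * exp (1 / 2)" by (intro mult_left_mono) auto
    also have "\<dots> = exp (- (1 / 2))" by (simp flip: exp_add)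
    finally show "exp (- 1) * sqrt 2 \<le> exp (- (1 / 2))" .
  qed
  finally have "(\<integral>\<^sup>+z. ennreal (exp (g z)) \<partial>std_gauss) \<le> ennreal (exp (- (1 / 2)))" .
  moreover have "g \<in> borel_measurable borel" unfolding g_def by measurable
  ultimately show ?thesis
    using measure_vpairs_sum_nonneg[of g n d "1 / 2"] assms unfolding sum_g by (simp del: One_nat_def)
qed

text \<open>Here \<open>D\<close> stands for sqrt d, \<open>a\<close> and \<open>b\<close> for the
  norms, \<open>\<rho>\<close> for the tail norm, \<open>S\<close> for the inner sum and
  \<open>z\<close> for the deciding coordinate. After division by \<open>\<rho>\<close>, the product
  a b equals D up to a relative error 6 \<delta>, contributing 6 \<Theta> \<delta>, and S becomes at
  most 2 \<delta>.\<close>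

lemma edge_imp_coordinate_ge:
  fixes a b \<rho> D S t z \<delta> \<Theta> :: real
  assumes \<delta>: "0 < \<delta>" "\<delta> \<le> 1 / 4" and D: "0 < D" and nn: "0 \<le> a" "0 \<le> b" "0 \<le> \<rho>"
    and a: "(1 - \<delta>) * D\<^sup>2 \<le> a\<^sup>2" "a\<^sup>2 \<le> (1 + \<delta>) * D\<^sup>2"
    and b: "(1 - \<delta>) * D\<^sup>2 \<le> b\<^sup>2" "b\<^sup>2 \<le> (1 + \<delta>) * D\<^sup>2"
    and \<rho>: "(1 - 2 * \<delta>) * D\<^sup>2 \<le> \<rho>\<^sup>2" "\<rho>\<^sup>2 \<le> (1 + \<delta>) * D\<^sup>2"
    and S: "\<bar>S\<bar> \<le> \<delta> * D" and t: "\<bar>t\<bar> * D \<le> \<Theta>" "t \<le> (S + \<rho> * z) / (a * b)"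
  shows "t * D - (6 * \<Theta> + 2) * \<delta> \<le> z"
proof -
  have upper: "a * b \<le> (1 + \<delta>) * D\<^sup>2"
  proof (rule power2_le_imp_le)
    show "(a * b)\<^sup>2 \<le> ((1 + \<delta>) * D\<^sup>2)\<^sup>2"
      unfolding power_mult_distrib[of a] power2_eq_square[of "(1 + \<delta>) * D\<^sup>2"]
      by (rule mult_mono[OF a(2) b(2)]) (use \<delta> in auto)
  qed (use \<delta> in simp)
  have lower: "(1 - \<delta>) * D\<^sup>2 \<le> a * b"
  proof (rule power2_le_imp_le)
    show "((1 - \<delta>) * D\<^sup>2)\<^sup>2 \<le> (a * b)\<^sup>2"
      unfolding power_mult_distrib[of a] power2_eq_square[of "(1 - \<delta>) * D\<^sup>2"]
      by (rule mult_mono[OF a(1) b(1)]) (use \<delta> in auto)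
  qed (use nn in simp)
  have \<rho>lo: "(1 - 2 * \<delta>) * D \<le> \<rho>"
  proof (rule power2_le_imp_le)
    have "(1 - 2 * \<delta>)\<^sup>2 \<le> 1 - 2 * \<delta>" using \<delta> by (simp add: power2_eq_square mult_left_le)
    then have "((1 - 2 * \<delta>) * D)\<^sup>2 \<le> (1 - 2 * \<delta>) * D\<^sup>2"
      unfolding power_mult_distrib by (intro mult_right_mono) auto
    then show "((1 - 2 * \<delta>) * D)\<^sup>2 \<le> \<rho>\<^sup>2" using \<rho>(1) by linarith
  qed (use nn in simp)
  have \<rho>up: "\<rho> \<le> (1 + \<delta>) * D"
  proof (rule power2_le_imp_le)
    have "1 + \<delta> \<le> (1 + \<delta>)\<^sup>2" using \<delta> by (intro self_le_power) auto
    then have "(1 + \<delta>) * D\<^sup>2 \<le> ((1 + \<delta>) * D)\<^sup>2"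
      unfolding power_mult_distrib by (intro mult_right_mono) auto
    then show "\<rho>\<^sup>2 \<le> ((1 + \<delta>) * D)\<^sup>2" using \<rho>(2) by linarith
  qed (use \<delta> D in simp)
  have half: "D / 2 \<le> \<rho>" 
  proof -
    have "D / 2 \<le> (1 - 2 * \<delta>) * D" using \<delta> D by (simp add: field_simps)
    then show ?thesis using \<rho>lo by linarith
  qed
  then have \<rho>pos: "0 < \<rho>" using D by linarith
  \<comment> \<open>This fixes the constant 6: the difference of the two sides is \<delta> (3 - 12
    \<delta>), nonnegative for \<delta> \<le> 1/4.\<close>
  have "1 + \<delta> \<le> (1 + 6 * \<delta>) * (1 - 2 * \<delta>)"
  proof -
    have "0 \<le> \<delta> * (3 - 12 * \<delta>)" using \<delta> by (intro mult_nonneg_nonneg) auto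
    then show ?thesis by (simp add: algebra_simps)
  qed
  then have "(1 + \<delta>) * D\<^sup>2 \<le> (1 + 6 * \<delta>) * (1 - 2 * \<delta>) * D\<^sup>2" by (intro mult_right_mono) auto
  also have "\<dots> = (1 + 6 * \<delta>) * D * ((1 - 2 * \<delta>) * D)" by (simp add: power2_eq_square)
  also have "\<dots> \<le> (1 + 6 * \<delta>) * D * \<rho>" using \<rho>lo \<delta> D by (intro mult_left_mono) auto
  finally have up: "a * b \<le> (1 + 6 * \<delta>) * D * \<rho>" using upper by linarith
  have lo: "(1 - 6 * \<delta>) * D * \<rho> \<le> a * b"
  proof (cases "1 - 6 * \<delta> \<ge> 0")
    case True
    then have "(1 - 6 * \<delta>) * D * \<rho> \<le> (1 - 6 * \<delta>) * D * ((1 + \<delta>) * D)"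
      using \<rho>up D by (intro mult_left_mono) auto
    also have "\<dots> = (1 - 6 * \<delta>) * (1 + \<delta>) * D\<^sup>2" by (simp add: power2_eq_square)
    also have "\<dots> \<le> (1 - \<delta>) * D\<^sup>2"
      using \<delta> by (intro mult_right_mono) (auto simp: algebra_simps)
    finally show ?thesis using lower by linarith
  next
    case False
    then have "(1 - 6 * \<delta>) * (D * \<rho>) \<le> 0" using D \<rho>pos by (intro mult_nonpos_nonneg) auto
    moreover have "0 \<le> a * b" using nn by simp
    ultimately show ?thesis by (simp add: mult.assoc)
  qed
  have "0 < (1 - \<delta>) * D\<^sup>2" using \<delta> D by simp
  then have ab: "0 < a * b" using lower by linarith
  then have "t * (a * b) \<le> S + \<rho> * z" using t(2) by (simp add: pos_le_divide_eq)
  moreover have "\<bar>S\<bar> \<le> 2 * \<delta> * \<rho>"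
  proof -
    have "\<delta> * D \<le> \<delta> * (2 * \<rho>)" using half \<delta> by (intro mult_left_mono) auto
    then show ?thesis using S by linarith
  qed
  moreover have "t * D * \<rho> - 6 * \<delta> * (\<bar>t\<bar> * D) * \<rho> \<le> t * (a * b)"
  proof (cases "t \<ge> 0")
    case True
    then have "t * ((1 - 6 * \<delta>) * D * \<rho>) \<le> t * (a * b)" using lo by (intro mult_left_mono)
    then show ?thesis using True by (simp add: algebra_simps)
  next
    case False
    then have "t * ((1 + 6 * \<delta>) * D * \<rho>) \<le> t * (a * b)" using up by (intro mult_left_mono_neg) auto
    then show ?thesis using False by (simp add: algebra_simps)
  qed
  moreover have "6 * \<delta> * (\<bar>t\<bar> * D) * \<rho> \<le> 6 * \<delta> * \<Theta> * \<rho>"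
    using t(1) \<delta> \<rho>pos by (intro mult_right_mono mult_left_mono) auto
  ultimately have "(t * D - (6 * \<Theta> + 2) * \<delta>) * \<rho> \<le> z * \<rho>"
    by (simp add: algebra_simps)
  then show ?thesis using \<rho>pos by simp
qed

text \<open>
  The inner sums \<open>S i j\<close> are the only obstruction; by Cauchy-Schwarz the sum of their squares is
  at most the square of the sum of all squares below the diagonal.
\<close>

lemma ecount_triang_le:
  fixes \<delta> \<zeta> \<Theta> t :: real and n d :: nat and X :: "nat \<Rightarrow> nat \<Rightarrow> real"
  defines "\<tau> \<equiv> t * sqrt (real d) - (6 * \<Theta> + 2) * \<delta>"
  assumes \<delta>: "0 < \<delta>" "\<delta> \<le> 1 / 4" and n: "2 \<le> n" and \<zeta>: "0 < \<zeta>"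
    and K: "1 \<le> K" "2 \<le> K * \<delta>" "8 \<le> K * (\<delta>\<^sup>2 * \<zeta>)" and d: "K * (real n)\<^sup>2 \<le> real d"
    and t: "\<bar>t\<bar> * sqrt (real d) \<le> \<Theta>"
    and norm: "\<And>i. i \<in> {1..n} \<Longrightarrow> (1 - \<delta>) * real d \<le> (L2_set (X i) {..<d})\<^sup>2"
      "\<And>i. i \<in> {1..n} \<Longrightarrow> (L2_set (X i) {..<d})\<^sup>2 \<le> (1 + \<delta>) * real d"
    and W: "(\<Sum>(i, j)\<in>vpairs n. (X j (i - 1))\<^sup>2) \<le> 4 * real (n choose 2)"
  shows "edges d t n (\<lambda>i. triang d (i - 1) (X i))
    \<le> (\<Sum>(i, j)\<in>vpairs n. of_bool (\<tau> \<le> X j (i - 1))) + \<zeta> * real (n choose 2)"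
proof -
  let ?N = "real (n choose 2)"
  define W where "W = (\<Sum>(i, j)\<in>vpairs n. (X j (i - 1))\<^sup>2)"
  define w where "w j = (\<Sum>k<j - 1. (X j k)\<^sup>2)" for j
  define S where "S i j = (\<Sum>k<i - 1. X i k * X j k)" for i j
  have Ww: "W = (\<Sum>j\<in>{1..n}. w j)"
    unfolding W_def w_def by (rule sum_vpairs[of "\<lambda>j k. (X j k)\<^sup>2"])
  have w0: "0 \<le> w j" for j by (simp add: w_def sum_nonneg)
  have "1 * (real n)\<^sup>2 \<le> K * (real n)\<^sup>2" using K by (intro mult_right_mono) auto
  then have nd2: "(real n)\<^sup>2 \<le> real d" using d by linarith
  have "real n * 1 \<le> real n * real n" using n by (intro mult_left_mono) auto
  then have nd: "n \<le> d" using nd2 by (simp add: power2_eq_square)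
  have dpos: "0 < real d" using nd n by simp
  have N2: "?N \<le> (real n)\<^sup>2 / 2" using choose_two_bounds[OF n] by blast
  have Wd: "W \<le> \<delta> * real d"
  proof -
    have "W \<le> 4 * ?N" using W by (simp add: W_def)
    also have "\<dots> \<le> 2 * (real n)\<^sup>2" using N2 by simp
    also have "\<dots> \<le> K * \<delta> * (real n)\<^sup>2" using K(2) by (intro mult_right_mono) auto
    also have "\<dots> = \<delta> * (K * (real n)\<^sup>2)" by simp
    also have "\<dots> \<le> \<delta> * real d" using d \<delta> by (intro mult_left_mono) auto
    finally show ?thesis .
  qed
  have wW: "w j \<le> W" if "j \<in> {1..n}" for j
    unfolding Ww using that w0 by (intro member_le_sum) auto
  have SS: "(S i j)\<^sup>2 \<le> w i * w j" if "i < j" for i j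
  proof -
    have "(S i j)\<^sup>2 \<le> (\<Sum>k<i - 1. (X i k)\<^sup>2) * (\<Sum>k<i - 1. (X j k)\<^sup>2)"
      unfolding S_def by (rule Cauchy_Schwarz_ineq_sum)
    also have "\<dots> \<le> w i * w j"
      unfolding w_def using that by (intro mult_left_mono sum_mono2 sum_nonneg) auto
    finally show ?thesis .
  qed
  \<comment> \<open>A pair with inner sum above \<delta> sqrt d is charged the last term, which is
    then at least 1. For all other edges the deciding coordinate must exceed
    \<open>\<tau>\<close>.\<close>
  have edge: "of_bool (t \<le> cosine d (triang d (i - 1) (X i)) (triang d (j - 1) (X j)))
      \<le> of_bool (\<tau> \<le> X j (i - 1)) + w i * w j / (\<delta>\<^sup>2 * real d)" if ij: "(i, j) \<in> vpairs n" for i j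
  proof (cases "t \<le> cosine d (triang d (i - 1) (X i)) (triang d (j - 1) (X j)) \<and> \<bar>S i j\<bar> \<le> \<delta> * sqrt (real d)")
    case True
    have ij': "i \<in> {1..n}" "j \<in> {1..n}" "1 \<le> i" "i < j" "j \<le> d" using ij nd by (auto simp: vpairs_def)
    let ?\<rho> = "L2_set (X i) {i - 1..<d}"
    have split: "(L2_set (X i) {..<d})\<^sup>2 = w i + ?\<rho>\<^sup>2"
      unfolding w_def using ij' by (intro L2_set_split) auto
    have "\<tau> \<le> X j (i - 1)"
      unfolding \<tau>_def
    proof (rule edge_imp_coordinate_ge[where a = "L2_set (X i) {..<d}" and b = "L2_set (X j) {..<d}" and \<rho> = ?\<rho> and S = "S i j"])
      show "(1 - 2 * \<delta>) * (sqrt (real d))\<^sup>2 \<le> ?\<rho>\<^sup>2"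
        using split norm(1)[OF ij'(1)] wW[OF ij'(1)] Wd by (simp add: algebra_simps)
      show "?\<rho>\<^sup>2 \<le> (1 + \<delta>) * (sqrt (real d))\<^sup>2"
        using split norm(2)[OF ij'(1)] w0[of i] by simp
      show "t \<le> (S i j + ?\<rho> * X j (i - 1)) / (L2_set (X i) {..<d} * L2_set (X j) {..<d})"
        using True ij' cosine_triang[of i j d "X i" "X j"] by (simp add: S_def)
    qed (use True \<delta> dpos norm[OF ij'(1)] norm[OF ij'(2)] t in auto)
    then show ?thesis using w0 \<delta> by simp
  next
    case False
    have "1 \<le> w i * w j / (\<delta>\<^sup>2 * real d)" if "\<not> \<bar>S i j\<bar> \<le> \<delta> * sqrt (real d)"
    proof -
      have "(\<delta> * sqrt (real d))\<^sup>2 \<le> \<bar>S i j\<bar>\<^sup>2" using that \<delta> by (intro power_mono) auto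
      also have "\<dots> \<le> w i * w j" using SS[of i j] ij by (simp add: vpairs_def)
      finally show ?thesis using \<delta> dpos by (simp add: power_mult_distrib)
    qed
    moreover have "0 \<le> w i * w j / (\<delta>\<^sup>2 * real d)" using w0 by simp
    ultimately show ?thesis using False by (auto simp: of_bool_def)
  qed
  have "edges d t n (\<lambda>i. triang d (i - 1) (X i))
      \<le> (\<Sum>(i, j)\<in>vpairs n. of_bool (\<tau> \<le> X j (i - 1)) + w i * w j / (\<delta>\<^sup>2 * real d))"
    unfolding ecount_def using edge by (intro sum_mono) auto
  also have "\<dots> = (\<Sum>(i, j)\<in>vpairs n. of_bool (\<tau> \<le> X j (i - 1))) + (\<Sum>(i, j)\<in>vpairs n. w i * w j) / (\<delta>\<^sup>2 * real d)"
    by (simp add: case_prod_unfold sum.distrib sum_divide_distrib)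
  \<comment> \<open>The numerator is at most 16 N^2, hence 8 N n^2, with N the number of pairs; the
    third condition on \<open>K\<close> is made for this.\<close>
  also have "(\<Sum>(i, j)\<in>vpairs n. w i * w j) / (\<delta>\<^sup>2 * real d) \<le> \<zeta> * ?N"
  proof -
    have "(\<Sum>(i, j)\<in>vpairs n. w i * w j) \<le> (\<Sum>(i, j)\<in>{1..n} \<times> {1..n}. w i * w j)"
      using w0 by (intro sum_mono2) (auto simp: vpairs_def)
    also have "\<dots> = W\<^sup>2"
      by (simp add: Ww power2_eq_square sum_product sum.cartesian_product)
    also have "\<dots> \<le> (4 * ?N)\<^sup>2"
      using W w0 by (intro power_mono) (auto simp: W_def Ww[unfolded W_def] intro!: sum_nonneg)
    also have "\<dots> = 16 * ?N * ?N" by (simp add: power2_eq_square)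
    also have "\<dots> \<le> 16 * ?N * ((real n)\<^sup>2 / 2)" using N2 by (intro mult_left_mono) auto
    also have "\<dots> = ?N * (real n)\<^sup>2 * 8" by simp
    also have "\<dots> \<le> ?N * (real n)\<^sup>2 * (K * (\<delta>\<^sup>2 * \<zeta>))" using K by (intro mult_left_mono) auto
    also have "\<dots> = ?N * \<delta>\<^sup>2 * \<zeta> * (K * (real n)\<^sup>2)" by simp
    also have "\<dots> \<le> ?N * \<delta>\<^sup>2 * \<zeta> * real d" using d \<zeta> by (intro mult_left_mono) auto
    finally show ?thesis using \<delta> dpos by (simp add: field_simps)
  qed
  finally show ?thesis by simp
qed

section \<open>Tail bound in the dense regime\<close>

lemma gauss_points_component_sets:
  assumes "i \<in> {1..n}" "A \<in> sets (gauss d)"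
  shows "{X \<in> space (gauss_points n d). X i \<in> A} \<in> sets (gauss_points n d)"
proof -
  have "(\<lambda>X. X i) -` A \<inter> space (gauss_points n d) \<in> sets (gauss_points n d)"
    using assms by (intro measurable_sets[OF measurable_component_singleton])
  then show ?thesis by (simp only: vimage_def Int_def mem_Collect_eq conj_commute)
qed

lemma measure_gauss_points_component:
  assumes "i \<in> {1..n}" "A \<in> sets (gauss d)"
  shows "measure (gauss_points n d) {X \<in> space (gauss_points n d). X i \<in> A} = measure (gauss d) A"
proof -
  have "measure (gauss d) A = measure (distr (gauss_points n d) (gauss d) (\<lambda>X. X i)) A"
    using assms by (subst distr_PiM_component) (auto simp: prob_space_gauss simp del: One_nat_def)
  also have "\<dots> = measure (gauss_points n d) ((\<lambda>X. X i) -` A \<inter> space (gauss_points n d))"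
    using assms by (intro measure_distr) auto
  also have "(\<lambda>X. X i) -` A \<inter> space (gauss_points n d) = {X \<in> space (gauss_points n d). X i \<in> A}"
    by (simp only: vimage_def Int_def mem_Collect_eq conj_commute)
  finally show ?thesis ..
qed

text \<open>The deterministic comparison applies outside three events: too many large deciding
  coordinates, too large a sum of squares, or some atypical norm. The first two are Chernoff bounds
  in n^2; the third is a union bound over the vertices, whence the factor n, and d \<ge> n^2 brings
  its rate to order n^2.\<close>

lemma dense_regime_tail:
  fixes p \<zeta> :: real
  assumes p: "0 < p" "p \<le> 1 / 2" and \<zeta>: "0 < \<zeta>" "\<zeta> \<le> 2"
  obtains K C d0 where "K \<ge> 1" "C > 0"
    "\<And>n d t. 2 \<le> n \<Longrightarrow> d0 \<le> d \<Longrightarrow> K * (real n)\<^sup>2 \<le> real d \<Longrightarrow> is_threshold p d t \<Longrightarrow>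
      edge_tail n d t ((p + 4 * \<zeta>) * real (n choose 2))
      \<le> 4 * real n * exp (- C * (real n)\<^sup>2)"
proof -
  define \<Theta> where "\<Theta> = 2 / sqrt p"
  have \<Theta>: "0 < \<Theta>" using p by (simp add: \<Theta>_def)
  obtain \<eta> d1 where \<eta>: "0 < \<eta>"
    and d1: "\<And>d t. d \<ge> d1 \<Longrightarrow> is_threshold p d t \<Longrightarrow> measure std_gauss {t * sqrt (real d) - \<eta>..} \<le> p + \<zeta>"
    using threshold_gauss_tail[OF p \<zeta>(1)] by metis
  obtain d2 where d2: "\<And>d t. d \<ge> d2 \<Longrightarrow> is_threshold p d t \<Longrightarrow> \<bar>t\<bar> * sqrt (real d) \<le> \<Theta>"
    using threshold_sqrt_bound[OF p] unfolding \<Theta>_def by metis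
  \<comment> \<open>The loss (6 \<Theta> + 2) \<delta> in the coordinate threshold must fit into the
    margin \<eta>.\<close>
  define \<delta> where "\<delta> = min (1 / 4) (\<eta> / (6 * \<Theta> + 2))"
  have \<delta>: "0 < \<delta>" "\<delta> \<le> 1 / 4" "(6 * \<Theta> + 2) * \<delta> \<le> \<eta>"
  proof -
    show "\<delta> \<le> 1 / 4" by (simp only: \<delta>_def min.cobounded1)
    show "0 < \<delta>" using \<eta> \<Theta> by (simp add: \<delta>_def)
    have "\<delta> \<le> \<eta> / (6 * \<Theta> + 2)" by (simp add: \<delta>_def)
    then show "(6 * \<Theta> + 2) * \<delta> \<le> \<eta>" using \<Theta> by (simp add: pos_le_divide_eq mult.commute)
  qed
  \<comment> \<open>One summand for each of the three conditions on \<open>K\<close> in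
    \<open>ecount_triang_le\<close>.\<close>
  define K where "K = 1 + 2 / \<delta> + 8 / (\<delta>\<^sup>2 * \<zeta>)"
  have K: "1 \<le> K" "2 \<le> K * \<delta>" "8 \<le> K * (\<delta>\<^sup>2 * \<zeta>)"
    using \<delta> \<zeta> by (auto simp: K_def distrib_right)
  \<comment> \<open>The rates \<zeta>^2 / 4 and 1/2 per pair lose a factor 4 because the number of
    pairs is at least n^2 / 4.\<close>
  define C where "C = min (\<zeta>\<^sup>2 / 16) (min (1 / 8) (\<delta>\<^sup>2 / 16))"
  have C: "0 < C" "C \<le> \<zeta>\<^sup>2 / 16" "C \<le> 1 / 8" "C \<le> \<delta>\<^sup>2 / 16" using \<zeta> \<delta> by (auto simp: C_def)
  have "edge_tail n d t ((p + 4 * \<zeta>) * real (n choose 2))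
      \<le> 4 * real n * exp (- C * (real n)\<^sup>2)"
    if n: "2 \<le> n" and d: "max d1 d2 \<le> d" "K * (real n)\<^sup>2 \<le> real d" and thr: "is_threshold p d t" for n d t
  proof -
    let ?G = "gauss_points n d" and ?N = "real (n choose 2)"
    let ?\<tau> = "t * sqrt (real d) - (6 * \<Theta> + 2) * \<delta>"
    let ?E = "\<lambda>X. edges d t n (\<lambda>i. triang d (i - 1) (X i))"
    interpret G: prob_space ?G by (rule prob_space_gauss_points)
    have "1 * (real n)\<^sup>2 \<le> K * (real n)\<^sup>2" using K by (intro mult_right_mono) auto
    then have nd2: "(real n)\<^sup>2 \<le> real d" using d by linarith
    have "real n * 1 \<le> real n * real n" using n by (intro mult_left_mono) auto
    then have nd: "n \<le> d" using nd2 by (simp add: power2_eq_square)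
    let ?A = "{X \<in> space ?G. (p + 4 * \<zeta>) * ?N \<le> ?E X}"
    let ?Z = "{X \<in> space ?G. (p + 2 * \<zeta>) * ?N \<le> (\<Sum>(i, j)\<in>vpairs n. of_bool (?\<tau> \<le> X j (i - 1)))}"
    let ?W = "{X \<in> space ?G. 4 * ?N \<le> (\<Sum>(i, j)\<in>vpairs n. (X j (i - 1))\<^sup>2)}"
    let ?u = "{x \<in> space (gauss d). (1 + \<delta>) * real d \<le> (L2_set x {..<d})\<^sup>2}"
    let ?l = "{x \<in> space (gauss d). (L2_set x {..<d})\<^sup>2 \<le> (1 - \<delta>) * real d}"
    let ?B = "\<Union>i\<in>{1..n}. {X \<in> space ?G. X i \<in> ?u} \<union> {X \<in> space ?G. X i \<in> ?l}"
    have coord: "(\<lambda>X. X j (i - 1)) \<in> borel_measurable ?G" if "(i, j) \<in> vpairs n" for i j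
      using that nd by (intro measurable_coordinate) (auto simp: vpairs_def)
    have mZ: "?Z \<in> sets ?G"
    proof (intro borel_measurable_le borel_measurable_const)
      have "(\<lambda>X. of_bool (?\<tau> \<le> X j (i - 1)) :: real) \<in> borel_measurable ?G" if "(i, j) \<in> vpairs n" for i j
        using measurable_compose[OF coord[OF that], of "\<lambda>z. of_bool (?\<tau> \<le> z) :: real" borel] by simp
      then show "(\<lambda>X. \<Sum>(i, j)\<in>vpairs n. of_bool (?\<tau> \<le> X j (i - 1)) :: real) \<in> borel_measurable ?G"
        by (intro borel_measurable_sum) auto
    qed
    have mW: "?W \<in> sets ?G"
      using coord by (intro borel_measurable_le borel_measurable_const borel_measurable_sum) auto
    note mul = gauss_points_component_sets[OF _ gauss_norm_sets(1)] gauss_points_component_sets[OF _ gauss_norm_sets(2)]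
    have mB: "?B \<in> sets ?G" by (intro sets.finite_UN sets.Un mul) auto
    have sub: "?A \<subseteq> ?Z \<union> (?W \<union> ?B)"
    proof
      fix X assume X: "X \<in> ?A"
      show "X \<in> ?Z \<union> (?W \<union> ?B)"
      proof (rule ccontr)
        assume "X \<notin> ?Z \<union> (?W \<union> ?B)"
        then have notin: "X \<notin> ?Z" "X \<notin> ?W" "X \<notin> ?B" by blast+
        have Xs: "X \<in> space ?G" using X by blast
        have Xi: "X i \<in> space (gauss d)" if "i \<in> {1..n}" for i
          by (rule measurable_space[OF measurable_component_singleton[OF that] Xs])
        have norm: "(1 - \<delta>) * real d \<le> (L2_set (X i) {..<d})\<^sup>2" "(L2_set (X i) {..<d})\<^sup>2 \<le> (1 + \<delta>) * real d"
          if "i \<in> {1..n}" for i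
        proof -
          have "X i \<notin> ?u" "X i \<notin> ?l" using notin(3) that Xs by blast+
          then show "(1 - \<delta>) * real d \<le> (L2_set (X i) {..<d})\<^sup>2" "(L2_set (X i) {..<d})\<^sup>2 \<le> (1 + \<delta>) * real d"
            using Xi[OF that] by (simp_all only: mem_Collect_eq simp_thms not_le less_imp_le)
        qed
        have "?E X \<le> (\<Sum>(i, j)\<in>vpairs n. of_bool (?\<tau> \<le> X j (i - 1))) + \<zeta> * ?N"
          using notin(2) Xs d d2[OF _ thr]
          by (intro ecount_triang_le[OF \<delta>(1,2) n \<zeta>(1) K d(2)] norm) auto
        also have "\<dots> < (p + 2 * \<zeta>) * ?N + \<zeta> * ?N" using notin(1) Xs by auto
        also have "\<dots> \<le> (p + 4 * \<zeta>) * ?N"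
          using \<zeta> by (simp add: algebra_simps)
        finally show False using X by auto
      qed
    qed
    have "measure ?G {X \<in> space ?G. (p + 4 * \<zeta>) * ?N \<le> edges d t n X} = measure ?G ?A"
      by (rule measure_edges_triang[OF nd])
    also have "\<dots> \<le> measure ?G (?Z \<union> (?W \<union> ?B))"
      by (intro G.finite_measure_mono sub sets.Un mZ mW mB)
    also have "\<dots> \<le> measure ?G ?Z + (measure ?G ?W + measure ?G ?B)"
      by (intro order_trans[OF measure_Un_le] add_left_mono sets.Un order_refl mZ mW mB)
    also have "measure ?G ?Z \<le> exp (- C * (real n)\<^sup>2)"
    proof -
      have "measure std_gauss {?\<tau>..} \<le> p + \<zeta>"
      proof -
        have "measure std_gauss {?\<tau>..} \<le> measure std_gauss {t * sqrt (real d) - \<eta>..}"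
          using \<delta>(3) by (intro std_gauss.finite_measure_mono) auto
        also have "\<dots> \<le> p + \<zeta>" using d by (intro d1 thr) simp
        finally show ?thesis .
      qed
      then have "measure ?G ?Z \<le> exp (- (\<zeta>\<^sup>2 / 4) * ?N)"
        using nd \<zeta> by (intro measure_count_ge)
      also have "\<dots> \<le> exp (- C * (real n)\<^sup>2)"
      proof -
        have "C * (real n)\<^sup>2 \<le> \<zeta>\<^sup>2 / 16 * (real n)\<^sup>2" using C by (intro mult_right_mono) auto
        also have "\<dots> = \<zeta>\<^sup>2 / 4 * ((real n)\<^sup>2 / 4)" by simp
        also have "\<dots> \<le> \<zeta>\<^sup>2 / 4 * ?N" using choose_two_bounds[OF n] by (intro mult_left_mono) auto
        finally show ?thesis by simp
      qed
      finally show ?thesis .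
    qed
    also have "measure ?G ?W \<le> exp (- C * (real n)\<^sup>2)"
    proof -
      have "measure ?G ?W \<le> exp (- (1 / 2) * ?N)" by (rule measure_sum_squares_ge[OF nd])
      also have "\<dots> \<le> exp (- C * (real n)\<^sup>2)"
      proof -
        have "C * (real n)\<^sup>2 \<le> 1 / 8 * (real n)\<^sup>2" using C by (intro mult_right_mono) auto
        then show ?thesis using choose_two_bounds[OF n] by simp
      qed
      finally show ?thesis .
    qed
    also have "measure ?G ?B \<le> 2 * real n * exp (- C * (real n)\<^sup>2)"
    proof -
      have e: "exp (- \<delta>\<^sup>2 / 16 * real d) \<le> exp (- C * (real n)\<^sup>2)"
      proof -
        have "C * (real n)\<^sup>2 \<le> \<delta>\<^sup>2 / 16 * real d" using C nd2 by (intro mult_mono) auto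
        then show ?thesis by simp
      qed
      have "measure ?G ?B \<le> (\<Sum>i\<in>{1..n}. measure ?G ({X \<in> space ?G. X i \<in> ?u} \<union> {X \<in> space ?G. X i \<in> ?l}))"
        by (intro measure_UNION_le sets.Un mul) auto
      also have "\<dots> \<le> (\<Sum>i\<in>{1..n}. 2 * exp (- C * (real n)\<^sup>2))"
      proof (rule sum_mono)
        fix i assume i: "i \<in> {1..n}"
        have "measure ?G ({X \<in> space ?G. X i \<in> ?u} \<union> {X \<in> space ?G. X i \<in> ?l})
            \<le> measure ?G {X \<in> space ?G. X i \<in> ?u} + measure ?G {X \<in> space ?G. X i \<in> ?l}"
          by (intro measure_Un_le mul i)
        also have "\<dots> = measure (gauss d) ?u + measure (gauss d) ?l"
          by (simp only: measure_gauss_points_component[OF i gauss_norm_sets(1)] measure_gauss_points_component[OF i gauss_norm_sets(2)])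
        also have "\<dots> \<le> exp (- \<delta>\<^sup>2 / 16 * real d) + exp (- \<delta>\<^sup>2 / 16 * real d)"
          using \<delta> by (intro add_mono measure_gauss_norm_ge measure_gauss_norm_le) auto
        also have "\<dots> \<le> 2 * exp (- C * (real n)\<^sup>2)" using e by simp
        finally show "measure ?G ({X \<in> space ?G. X i \<in> ?u} \<union> {X \<in> space ?G. X i \<in> ?l}) \<le> 2 * exp (- C * (real n)\<^sup>2)" .
      qed
      also have "\<dots> = 2 * real n * exp (- C * (real n)\<^sup>2)" by simp
      finally show ?thesis .
    qed
    finally have "measure ?G {X \<in> space ?G. (p + 4 * \<zeta>) * ?N \<le> edges d t n X}
        \<le> (2 + 2 * real n) * exp (- C * (real n)\<^sup>2)" by (simp add: algebra_simps)
    also have "\<dots> \<le> 4 * real n * exp (- C * (real n)\<^sup>2)" using n by (intro mult_right_mono) auto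
    finally show ?thesis .
  qed
  with K(1) C(1) that show ?thesis by blast
qed

section \<open>Exponential moments of the edge density of a block\<close>

lemma (in prob_space) nn_integral_const_plus_indicator:
  assumes "A \<in> events"
  shows "(\<integral>\<^sup>+x. b + c * indicator A x \<partial>M) = b + c * ennreal (prob A)"
  using assms by (subst nn_integral_add) (simp_all add: nn_integral_cmult emeasure_eq_measure prob_space)

lemma exp_sq_absorbs_linear:
  assumes "0 < C"
  obtains n0 :: nat where "\<And>n. n0 \<le> n \<Longrightarrow> 5 * real n * exp (- (2 * C) * (real n)\<^sup>2) \<le> exp (- C * (real n)\<^sup>2)"
proof -
  have "((\<lambda>n. 5 * real n * exp (- C * (real n)\<^sup>2)) \<longlongrightarrow> 0) at_top"
    using assms by real_asymp
  then have "eventually (\<lambda>n. 5 * real n * exp (- C * (real n)\<^sup>2) < 1) at_top"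
    by (rule order_tendstoD) simp
  then obtain n0 where n0: "\<And>n. n0 \<le> n \<Longrightarrow> 5 * real n * exp (- C * (real n)\<^sup>2) < 1"
    by (auto simp: eventually_at_top_linorder)
  show ?thesis
  proof
    fix n assume "n0 \<le> n"
    have "5 * real n * exp (- (2 * C) * (real n)\<^sup>2) = (5 * real n * exp (- C * (real n)\<^sup>2)) * exp (- C * (real n)\<^sup>2)"
      by (simp add: algebra_simps flip: exp_add)
    also have "\<dots> \<le> 1 * exp (- C * (real n)\<^sup>2)"
      using n0[OF \<open>n0 \<le> n\<close>] by (intro mult_right_mono) auto
    finally show "5 * real n * exp (- (2 * C) * (real n)\<^sup>2) \<le> exp (- C * (real n)\<^sup>2)" by simp
  qed
qed

text \<open>The exponential is split according to the density p + 4 \<zeta>: below it the exponent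
  is at most - 4 \<zeta> l, above it at most l, with the probability controlled by the dense tail
  bound. A lower bound \<open>n0\<close> on n absorbs the linear prefactor.\<close>

lemma dense_regime_mgf:
  fixes p \<epsilon> :: real
  assumes p: "0 < p" "p \<le> 1 / 2" and \<epsilon>: "0 < \<epsilon>" "(1 + \<epsilon>) * p < 1"
  obtains K C d0 n0 where "K \<ge> 1" "C > 0"
    "\<And>n d t. 2 \<le> n \<Longrightarrow> n0 \<le> n \<Longrightarrow> d0 \<le> d \<Longrightarrow> K * (real n)\<^sup>2 \<le> real d \<Longrightarrow> is_threshold p d t \<Longrightarrow>
      \<exists>l\<ge>0. edge_mgf n d t l ((1 + \<epsilon>) * p) \<le> ennreal (exp (- C * (real n)\<^sup>2))"
proof -
  \<comment> \<open>Then (1 + \<epsilon>) p = p + 8 \<zeta>, twice the excess of the tail bound; the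
    difference 4 \<zeta> is the gain below the splitting level.\<close>
  define \<zeta> where "\<zeta> = \<epsilon> * p / 8"
  have "\<epsilon> * p < 1" using \<epsilon> p by (simp add: algebra_simps)
  then have \<zeta>: "0 < \<zeta>" "\<zeta> \<le> 2" "(1 + \<epsilon>) * p = p + 8 * \<zeta>"
    using \<epsilon> p by (auto simp: \<zeta>_def algebra_simps)
  obtain K C d0 where K: "K \<ge> 1" and C: "C > 0" and
    tail: "\<And>n d t. 2 \<le> n \<Longrightarrow> d0 \<le> d \<Longrightarrow> K * (real n)\<^sup>2 \<le> real d \<Longrightarrow> is_threshold p d t \<Longrightarrow>
      edge_tail n d t ((p + 4 * \<zeta>) * real (n choose 2))
      \<le> 4 * real n * exp (- C * (real n)\<^sup>2)"
    by (rule dense_regime_tail[OF p \<zeta>(1,2)]) (rule that)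
  \<comment> \<open>The minimum collects the rates of the two parts for the parameter
    \<open>l\<close> chosen below; the final halving pays for the factor 5 n.\<close>
  define D where "D = min (2 * \<zeta> * C) (C / 2) / 2"
  have D: "0 < D" "2 * D \<le> 2 * \<zeta> * C" "2 * D \<le> C / 2" using \<zeta> C by (auto simp: D_def)
  obtain n0 where n0: "\<And>n. n0 \<le> n \<Longrightarrow> 5 * real n * exp (- (2 * D) * (real n)\<^sup>2) \<le> exp (- D * (real n)\<^sup>2)"
    using exp_sq_absorbs_linear[OF D(1)] by blast
  have "\<exists>l\<ge>0. edge_mgf n d t l ((1 + \<epsilon>) * p) \<le> ennreal (exp (- D * (real n)\<^sup>2))"
    if n: "2 \<le> n" "n0 \<le> n" and d: "d0 \<le> d" "K * (real n)\<^sup>2 \<le> real d" and thr: "is_threshold p d t" for n d t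
  proof (intro exI conjI)
    \<comment> \<open>Large enough for decay of order n^2 below the splitting level, yet small
      enough that exp l times exp (- C n^2) still decays like exp (- C n^2 / 2).\<close>
    define l where "l = C / 2 * (real n)\<^sup>2"
    show l: "0 \<le> l" using C by (simp add: l_def)
    let ?G = "gauss_points n d" and ?N = "real (n choose 2)"
    let ?E = "edges d t n"
    interpret G: prob_space ?G by (rule prob_space_gauss_points)
    define A where "A = {X \<in> space ?G. (p + 4 * \<zeta>) * ?N \<le> ?E X}"
    have A[measurable]: "A \<in> sets ?G"
      unfolding A_def by (intro borel_measurable_le borel_measurable_const ecount_cosine_measurable)
    have N: "?N \<ge> 1" using choose_two_bounds[OF n(1)] by blast
    have "(\<integral>\<^sup>+X. ennreal (exp (l * (?E X / ?N - (1 + \<epsilon>) * p))) \<partial>?G)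
        \<le> (\<integral>\<^sup>+X. ennreal (exp (- (4 * \<zeta> * l))) + ennreal (exp l) * indicator A X \<partial>?G)"
    proof (rule nn_integral_mono)
      fix X assume X: "X \<in> space ?G"
      show "ennreal (exp (l * (?E X / ?N - (1 + \<epsilon>) * p))) \<le> ennreal (exp (- (4 * \<zeta> * l))) + ennreal (exp l) * indicator A X"
      proof (cases "X \<in> A")
        case True
        have "?E X \<le> 1 * ?N" using ecount_le[of _ n X] by simp
        moreover have "0 < ?N" using N by linarith
        ultimately have "?E X / ?N \<le> 1" by (simp only: pos_divide_le_eq)
        then have "?E X / ?N - (1 + \<epsilon>) * p \<le> 1" using p \<epsilon> by (smt (verit) mult_nonneg_nonneg)
        then have "l * (?E X / ?N - (1 + \<epsilon>) * p) \<le> l * 1" using l by (intro mult_left_mono)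
        then have "ennreal (exp (l * (?E X / ?N - (1 + \<epsilon>) * p))) \<le> ennreal (exp l)" by (intro ennreal_leI) simp
        also have "\<dots> \<le> ennreal (exp (- (4 * \<zeta> * l))) + ennreal (exp l) * indicator A X" using True by simp
        finally show ?thesis .
      next
        case False
        then have "?E X < (p + 4 * \<zeta>) * ?N" using X by (simp only: A_def mem_Collect_eq simp_thms not_le)
        moreover have "0 < ?N" using N by linarith
        ultimately have "?E X / ?N < p + 4 * \<zeta>" by (simp only: pos_divide_less_eq)
        then have "?E X / ?N - (1 + \<epsilon>) * p \<le> - (4 * \<zeta>)" using \<zeta>(3) by linarith
        then have "l * (?E X / ?N - (1 + \<epsilon>) * p) \<le> l * - (4 * \<zeta>)" using l by (intro mult_left_mono)
        then show ?thesis using False by (auto intro!: ennreal_leI simp: mult.commute)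
      qed
    qed
    also have "\<dots> = ennreal (exp (- (4 * \<zeta> * l))) + ennreal (exp l) * ennreal (measure ?G A)"
      by (rule G.nn_integral_const_plus_indicator[OF A])
    also have "\<dots> = ennreal (exp (- (4 * \<zeta> * l)) + exp l * measure ?G A)"
      by (simp add: ennreal_mult)
    also have "\<dots> \<le> ennreal (exp (- D * (real n)\<^sup>2))"
    proof (rule ennreal_leI)
      let ?x = "exp (- (2 * D) * (real n)\<^sup>2)"
      have "2 * D * (real n)\<^sup>2 \<le> 2 * \<zeta> * C * (real n)\<^sup>2" using D by (intro mult_right_mono) auto
      then have 1: "exp (- (4 * \<zeta> * l)) \<le> ?x" by (simp add: l_def mult.commute mult.left_commute)
      have "exp l * measure ?G A \<le> exp l * (4 * real n * exp (- C * (real n)\<^sup>2))"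
        unfolding A_def by (intro mult_left_mono tail n d thr) simp
      also have "\<dots> = 4 * real n * exp (- (C / 2) * (real n)\<^sup>2)"
        by (simp add: l_def flip: exp_add)
      also have "\<dots> \<le> 4 * real n * ?x"
      proof -
        have "2 * D * (real n)\<^sup>2 \<le> C / 2 * (real n)\<^sup>2" using D by (intro mult_right_mono) auto
        then show ?thesis by (intro mult_left_mono) auto
      qed
      finally have "exp (- (4 * \<zeta> * l)) + exp l * measure ?G A \<le> ?x + 4 * real n * ?x"
        using 1 by linarith
      also have "\<dots> = (1 + 4 * real n) * ?x" by (simp add: distrib_right)
      also have "\<dots> \<le> 5 * real n * ?x" using n by (intro mult_right_mono) auto
      also have "\<dots> \<le> exp (- D * (real n)\<^sup>2)" by (rule n0[OF n(2)])
      finally show "exp (- (4 * \<zeta> * l)) + exp l * measure ?G A \<le> exp (- D * (real n)\<^sup>2)" .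
    qed
    finally show "(\<integral>\<^sup>+X. ennreal (exp (l * (?E X / ?N - (1 + \<epsilon>) * p))) \<partial>?G) \<le> ennreal (exp (- D * (real n)\<^sup>2))" .
  qed
  with K D(1) that show ?thesis by blast
qed

lemma vpairs_two: "vpairs 2 = {(1, 2)}"
  by (auto simp: vpairs_def)

lemma measure_pair_edge:
  assumes "is_threshold p d t"
  shows "measure (gauss_points 2 d) {X \<in> space (gauss_points 2 d). t \<le> cosine d (X 1) (X 2)} = p"
proof -
  have 1: "1 \<le> edges d t 2 X \<longleftrightarrow> t \<le> cosine d (X 1) (X 2)" for X
    by (simp add: ecount_def vpairs_two)
  have 2: "1 \<le> real (card (rgg_edges 2 d t X)) \<longleftrightarrow> t \<le> sphere_inner d (X 1) (X 2)" for X
    unfolding card_rgg_edges by (simp add: ecount_def vpairs_two)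
  show ?thesis
    using measure_sphere_points_edges[of 2 d 1 t] assms unfolding is_threshold_def 1 2 by metis
qed

text \<open>A block of two vertices carries a single Bernoulli edge of mean exactly p. This needs
  neither n nor d to be large and covers the ranges outside the dense estimate.\<close>

lemma pair_mgf:
  fixes p \<epsilon> :: real
  assumes p: "0 < p" and \<epsilon>: "0 < \<epsilon>"
  obtains l C where "0 \<le> l" "C > 0"
    "\<And>d t. is_threshold p d t \<Longrightarrow>
      edge_mgf 2 d t l ((1 + \<epsilon>) * p) \<le> ennreal (exp (- C))"
proof -
  \<comment> \<open>With l \<le> \<epsilon>/2 the quadratic loss p l^2 is at most half of the gain p
    l \<epsilon>.\<close>
  define l where "l = min 1 (\<epsilon> / 2)"
  have l: "0 < l" "l \<le> 1" "l \<le> \<epsilon> / 2" using \<epsilon> by (auto simp: l_def)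
  define C where "C = p * l * \<epsilon> / 2"
  have C: "0 < C" using p l \<epsilon> by (simp add: C_def)
  have "edge_mgf 2 d t l ((1 + \<epsilon>) * p) \<le> ennreal (exp (- C))" if thr: "is_threshold p d t" for d t
  proof -
    let ?G = "gauss_points 2 d"
    interpret G: prob_space ?G by (rule prob_space_gauss_points)
    define A where "A = {X \<in> space ?G. t \<le> cosine d (X 1) (X 2)}"
    have pA: "measure ?G A = p" unfolding A_def by (rule measure_pair_edge[OF thr])
    have A: "A \<in> sets ?G" using pA p by (metis less_irrefl measure_notin_sets)
    have "(\<integral>\<^sup>+X. ennreal (exp (l * (edges d t 2 X / real (2 choose 2) - (1 + \<epsilon>) * p))) \<partial>?G)
        = (\<integral>\<^sup>+X. ennreal (exp (l * (indicator A X - (1 + \<epsilon>) * p))) \<partial>?G)"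
    proof (rule nn_integral_cong)
      fix X assume "X \<in> space ?G"
      then have "edges d t 2 X = indicator A X"
        by (simp add: ecount_def vpairs_two indicator_def A_def of_bool_def del: One_nat_def)
      then show "ennreal (exp (l * (edges d t 2 X / real (2 choose 2) - (1 + \<epsilon>) * p)))
          = ennreal (exp (l * (indicator A X - (1 + \<epsilon>) * p)))" by simp
    qed
    also have "\<dots> = ennreal (exp (- l * ((1 + \<epsilon>) * p)) * (1 + p * (exp l - 1)))"
      unfolding G.nn_integral_exp_indicator[OF A] pA ..
    also have "\<dots> \<le> ennreal (exp (- C))"
    proof (rule ennreal_leI)
      have "exp (- l * ((1 + \<epsilon>) * p)) * (1 + p * (exp l - 1)) \<le> exp (p * (l + l\<^sup>2) - l * ((1 + \<epsilon>) * p))"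
        using l p by (intro bernoulli_mgf_le) auto
      also have "p * (l + l\<^sup>2) - l * ((1 + \<epsilon>) * p) = p * l * l - p * l * \<epsilon>"
        by (simp add: algebra_simps power2_eq_square)
      also have "exp (p * l * l - p * l * \<epsilon>) \<le> exp (- C)"
      proof -
        have "p * l * l \<le> p * l * (\<epsilon> / 2)" using l p by (intro mult_left_mono) auto
        then show ?thesis by (simp add: C_def)
      qed
      finally show "exp (- l * ((1 + \<epsilon>) * p)) * (1 + p * (exp l - 1)) \<le> exp (- C)" .
    qed
    finally show ?thesis .
  qed
  with that[of l C] l(1) C show ?thesis by simp
qed

text \<open>A block size m with K m^2 \<le> d gives the exponent C1 m^2 (n div m), of order n m. The
  largest such m yields n^2 if it reaches n and n sqrt d otherwise. If n or d is bounded, the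
  minimum is O(n), within reach of blocks of size two.\<close>

lemma upper_tail:
  fixes p \<epsilon> :: real
  assumes p: "0 < p" "p \<le> 1 / 2" and \<epsilon>: "0 < \<epsilon>" "(1 + \<epsilon>) * p < 1"
  obtains C where "C > 0"
    "\<And>n d t. 2 \<le> n \<Longrightarrow> 2 \<le> d \<Longrightarrow> is_threshold p d t \<Longrightarrow>
      edge_tail n d t ((1 + \<epsilon>) * p * real (n choose 2))
      \<le> exp (- C * min ((real n)\<^sup>2) (real n * sqrt (real d)))"
proof -
  obtain l2 C2 where l2: "0 \<le> l2" and C2: "C2 > 0" and mgf2:
    "\<And>d t. is_threshold p d t \<Longrightarrow>
      edge_mgf 2 d t l2 ((1 + \<epsilon>) * p) \<le> ennreal (exp (- C2))"
    by (rule pair_mgf[OF p(1) \<epsilon>(1)]) (rule that)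
  obtain K C1 d0 n0 where K: "K \<ge> 1" and C1: "C1 > 0" and mgf1:
    "\<And>n d t. 2 \<le> n \<Longrightarrow> n0 \<le> n \<Longrightarrow> d0 \<le> d \<Longrightarrow> K * (real n)\<^sup>2 \<le> real d \<Longrightarrow> is_threshold p d t \<Longrightarrow>
      \<exists>l\<ge>0. edge_mgf n d t l ((1 + \<epsilon>) * p) \<le> ennreal (exp (- C1 * (real n)\<^sup>2))"
    by (rule dense_regime_mgf[OF p \<epsilon>]) (rule that)
  define m0 where "m0 = max 2 n0"
  define d1 where "d1 = max d0 (nat \<lceil>K * (real m0)\<^sup>2\<rceil>)"
  have d1: "K * (real m0)\<^sup>2 \<le> real d" if "d1 \<le> d" for d
    using that unfolding d1_def by linarith
  define B where "B = real m0 + sqrt (real d1)"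
  have B: "0 < B" by (simp add: B_def m0_def add_pos_nonneg)
  \<comment> \<open>The first 4 comes from n \<le> 4 (n div 2). The second is the product of two
    factors 2, lost in rounding sqrt (d / K) down to \<open>q\<close> and in discarding the vertices
    left over by the blocks.\<close>
  define C where "C = min (C2 / (4 * B)) (C1 / (4 * sqrt K))"
  have C: "0 < C" using C1 C2 B K by (simp add: C_def)
  have "C \<le> C1"
  proof -
    have "1 \<le> sqrt K" using K by simp
    then have "1 \<le> 4 * sqrt K" by linarith
    then have "C1 / (4 * sqrt K) \<le> C1 / 1" using C1 K by (intro divide_left_mono) auto
    then show ?thesis by (simp add: C_def)
  qed
  have blocks: "edge_tail n d t ((1 + \<epsilon>) * p * real (n choose 2)) \<le> c ^ (n div m)"
    if "2 \<le> m" "m \<le> n" "0 \<le> l" "0 \<le> c"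
      "edge_mgf m d t l ((1 + \<epsilon>) * p) \<le> ennreal c" for n m d t l c
    using that by (intro ecount_tail_blocks prob_space_gauss ecount_cosine_measurable) (auto simp: cosine_commute)
  have "edge_tail n d t ((1 + \<epsilon>) * p * real (n choose 2))
      \<le> exp (- C * min ((real n)\<^sup>2) (real n * sqrt (real d)))"
    (is "?P \<le> exp (- C * ?min)")
    if n: "2 \<le> n" and d: "2 \<le> d" and thr: "is_threshold p d t" for n d t
  proof (cases "m0 \<le> n \<and> d1 \<le> d")
    case False
    have "?min \<le> real n * B"
    proof (cases "n < m0")
      case True
      have "?min \<le> real n * real n" by (simp add: power2_eq_square)
      also have "\<dots> \<le> real n * B" using True by (intro mult_left_mono) (auto simp: B_def add_increasing2)
      finally show ?thesis .
    next
      case 2: False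
      then have "sqrt (real d) \<le> sqrt (real d1)" using False by simp
      then have "sqrt (real d) \<le> B" unfolding B_def by linarith
      then have "real n * sqrt (real d) \<le> real n * B" by (intro mult_left_mono) auto
      then show ?thesis by simp
    qed
    then have "C * ?min \<le> C2 / (4 * B) * (real n * B)"
      using C2 B C by (intro mult_mono) (auto simp: C_def)
    also have "\<dots> = C2 * (real n / 4)" using B by simp
    also have "\<dots> \<le> C2 * real (n div 2)"
    proof -
      have "n \<le> 4 * (n div 2)" using n by linarith
      then show ?thesis using C2 by (intro mult_left_mono) auto
    qed
    finally have "C * ?min \<le> C2 * real (n div 2)" .
    moreover have "?P \<le> exp (- C2) ^ (n div 2)"
      using n by (intro blocks[OF _ _ l2 _ mgf2[OF thr]]) auto
    moreover have "exp (- C2) ^ (n div 2) = exp (- (C2 * real (n div 2)))"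
      by (simp add: mult.commute flip: exp_of_nat_mult)
    ultimately show ?thesis by (smt (verit) exp_le_cancel_iff mult_minus_left)
  next
    case True
    \<comment> \<open>The largest block size allowed in the dense regime; the definition of
      \<open>d1\<close> guarantees that it is at least \<open>m0\<close>.\<close>
    define q where "q = nat \<lfloor>sqrt (real d / K)\<rfloor>"
    have rq: "real q \<le> sqrt (real d / K)" "sqrt (real d / K) < real q + 1"
      using K unfolding q_def by (auto simp: of_nat_nat)
    have "(real m0)\<^sup>2 \<le> real d / K" using d1[of d] True K by (simp add: pos_le_divide_eq mult.commute)
    then have "real m0 \<le> sqrt (real d / K)" by (intro real_le_rsqrt)
    then have q: "m0 \<le> q" unfolding q_def by (rule le_nat_floor)
    define m where "m = min n q"
    have m: "m0 \<le> m" "m \<le> n" "2 \<le> m" using q True by (auto simp: m_def m0_def)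
    have "(real m)\<^sup>2 \<le> (sqrt (real d / K))\<^sup>2" using rq(1) by (intro power_mono) (auto simp: m_def)
    then have Km: "K * (real m)\<^sup>2 \<le> real d" using K by (simp add: pos_le_divide_eq mult.commute)
    obtain l where l: "0 \<le> l" and mgf: "edge_mgf m d t l ((1 + \<epsilon>) * p) \<le> ennreal (exp (- C1 * (real m)\<^sup>2))"
      using mgf1[OF m(3) _ _ Km thr] m True by (auto simp: m0_def d1_def)
    have P: "?P \<le> exp (- C1 * (real m)\<^sup>2) ^ (n div m)"
      using m by (intro blocks[OF _ _ l _ mgf]) auto
    also have "\<dots> = exp (- (C1 * (real m)\<^sup>2 * real (n div m)))"
      by (simp add: mult.commute flip: exp_of_nat_mult)
    also have "\<dots> \<le> exp (- (C * ?min))"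
    proof (cases "n \<le> q")
      case True
      then have "m = n" by (simp add: m_def)
      moreover have "C * ?min \<le> C1 * (real n)\<^sup>2" using \<open>C \<le> C1\<close> C C1 by (intro mult_mono) auto
      ultimately show ?thesis using n by simp
    next
      case False
      then have mq: "m = q" by (simp add: m_def)
      have q1: "1 \<le> real q" using m mq by simp
      have "real n \<le> 2 * (real q * real (n div q))"
      proof -
        have "n = q * (n div q) + n mod q" by simp
        moreover have "n mod q < q" using q1 by simp
        moreover have "q * 1 \<le> q * (n div q)" using False q1 by (intro mult_le_mono2) (simp add: div_greater_zero_iff Suc_le_eq)
        ultimately have "n \<le> 2 * (q * (n div q))" by linarith
        then show ?thesis by (metis of_nat_le_iff of_nat_mult of_nat_numeral)
      qed
      moreover have "sqrt (real d) / sqrt K \<le> 2 * real q"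
        using rq(2) q1 by (simp add: real_sqrt_divide)
      ultimately have "(sqrt (real d) / sqrt K) * real n \<le> (2 * real q) * (2 * (real q * real (n div q)))"
        using K by (intro mult_mono) auto
      then have "C1 / 4 * ((sqrt (real d) / sqrt K) * real n) \<le> C1 / 4 * ((2 * real q) * (2 * (real q * real (n div q))))"
        using C1 by (intro mult_left_mono) auto
      moreover have "C * ?min \<le> C1 / (4 * sqrt K) * (real n * sqrt (real d))"
        using C1 K C by (intro mult_mono) (auto simp: C_def)
      ultimately show ?thesis by (simp add: mq power2_eq_square algebra_simps)
    qed
    finally show ?thesis by simp
  qed
  with C that show ?thesis by blast
qed

section \<open>The lower bound on the upper tail\<close>

lemma (in product_sigma_finite) measure_PiM_box:
  assumes M: "\<And>i. i \<in> I \<Longrightarrow> prob_space (M i)" and "finite I" and A: "\<And>i. i \<in> I \<Longrightarrow> A i \<in> sets (M i)"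
  shows "measure (Pi\<^sub>M I M) {x \<in> space (Pi\<^sub>M I M). \<forall>i\<in>I. x i \<in> A i} = (\<Prod>i\<in>I. measure (M i) (A i))"
    and "{x \<in> space (Pi\<^sub>M I M). \<forall>i\<in>I. x i \<in> A i} \<in> sets (Pi\<^sub>M I M)"
proof -
  have eq: "{x \<in> space (Pi\<^sub>M I M). \<forall>i\<in>I. x i \<in> A i} = Pi\<^sub>E I A"
  proof (intro equalityI subsetI)
    fix x assume "x \<in> Pi\<^sub>E I A"
    then have "x \<in> Pi\<^sub>E I (\<lambda>i. space (M i))"
      by (rule subsetD[OF PiE_mono, rotated]) (rule sets.sets_into_space[OF A])
    with \<open>x \<in> Pi\<^sub>E I A\<close> show "x \<in> {x \<in> space (Pi\<^sub>M I M). \<forall>i\<in>I. x i \<in> A i}"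
      by (simp add: space_PiM PiE_iff)
  qed (simp add: space_PiM PiE_iff)
  show "{x \<in> space (Pi\<^sub>M I M). \<forall>i\<in>I. x i \<in> A i} \<in> sets (Pi\<^sub>M I M)"
    unfolding eq using \<open>finite I\<close> A by (intro sets_PiM_I_finite) auto
  have em: "emeasure (M i) (A i) = ennreal (measure (M i) (A i))" if "i \<in> I" for i
    using M[OF that] by (intro finite_measure.emeasure_eq_measure) (simp add: prob_space_def)
  have "emeasure (Pi\<^sub>M I M) (Pi\<^sub>E I A) = (\<Prod>i\<in>I. emeasure (M i) (A i))"
    using \<open>finite I\<close> A by (intro emeasure_PiM) auto
  also have "\<dots> = ennreal (\<Prod>i\<in>I. measure (M i) (A i))"
    by (simp add: em prod_ennreal)
  finally show "measure (Pi\<^sub>M I M) {x \<in> space (Pi\<^sub>M I M). \<forall>i\<in>I. x i \<in> A i} = (\<Prod>i\<in>I. measure (M i) (A i))"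
    unfolding eq by (simp add: measure_def prod_nonneg)
qed

section \<open>Bounded dimension: all points in one cap\<close>

lemma measure_std_gauss_Icc_pos:
  assumes "0 \<le> a" "a < b"
  shows "0 < measure std_gauss {a..b}"
proof -
  have "0 < (b - a) * std_normal_density b"
    using assms by (simp add: normal_density_pos)
  then show ?thesis using measure_std_gauss_Icc_ge[of a b] assms by linarith
qed

lemma ecount_all:
  assumes "\<And>i j. 1 \<le> i \<Longrightarrow> i < j \<Longrightarrow> j \<le> n \<Longrightarrow> Q (X i) (X j)"
  shows "ecount Q n X = real (n choose 2)"
proof -
  have "ecount Q n X = (\<Sum>(i, j)\<in>vpairs n. 1)"
    unfolding ecount_def using assms by (intro sum.cong) (auto simp: vpairs_def)
  then show ?thesis by (simp add: card_vpairs)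
qed

text \<open>Both vectors make an angle with axis 0 of cosine at least \<sigma>, and 2 \<sigma>^2 - 1
  is the cosine of the doubled angle. The bound on the remaining inner product is
  Cauchy-Schwarz.\<close>

lemma cap_edge:
  fixes x y :: "nat \<Rightarrow> real"
  assumes d: "1 \<le> d" and \<sigma>: "0 < \<sigma>" "\<sigma>\<^sup>2 < 1" and D: "0 < D" "\<sigma>\<^sup>2 * real d \<le> (1 - \<sigma>\<^sup>2) * D\<^sup>2"
    and x: "D \<le> x 0" "\<And>k. 0 < k \<Longrightarrow> k < d \<Longrightarrow> \<bar>x k\<bar> \<le> 1"
    and y: "D \<le> y 0" "\<And>k. 0 < k \<Longrightarrow> k < d \<Longrightarrow> \<bar>y k\<bar> \<le> 1"
  shows "2 * \<sigma>\<^sup>2 - 1 \<le> cosine d x y"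
proof -
  have main: "\<sigma> * L2_set z {..<d} \<le> z 0 \<and> (\<Sum>k\<in>{1..<d}. (z k)\<^sup>2) \<le> (1 - \<sigma>\<^sup>2) * (L2_set z {..<d})\<^sup>2 \<and> 0 < L2_set z {..<d}"
    if z: "D \<le> z 0" "\<And>k. 0 < k \<Longrightarrow> k < d \<Longrightarrow> \<bar>z k\<bar> \<le> 1" for z :: "nat \<Rightarrow> real"
  proof -
    define r where "r = (\<Sum>k\<in>{1..<d}. (z k)\<^sup>2)"
    have split: "(L2_set z {..<d})\<^sup>2 = (z 0)\<^sup>2 + r"
      using L2_set_split[of 1 d z] d by (simp add: r_def L2_set_def sum_nonneg)
    have "r \<le> (\<Sum>k\<in>{1..<d}. 1)"
      unfolding r_def using z(2) by (intro sum_mono) (simp add: abs_square_le_1)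
    also have "\<dots> \<le> real d" by simp
    finally have "\<sigma>\<^sup>2 * r \<le> \<sigma>\<^sup>2 * real d" by (intro mult_left_mono) auto
    also have "\<dots> \<le> (1 - \<sigma>\<^sup>2) * D\<^sup>2" by (rule D(2))
    also have "\<dots> \<le> (1 - \<sigma>\<^sup>2) * (z 0)\<^sup>2" using D z \<sigma> by (intro mult_left_mono power_mono) auto
    finally have *: "\<sigma>\<^sup>2 * r \<le> (1 - \<sigma>\<^sup>2) * (z 0)\<^sup>2" .
    then have "(\<sigma> * L2_set z {..<d})\<^sup>2 \<le> (z 0)\<^sup>2"
      unfolding power_mult_distrib split by (simp add: algebra_simps)
    then have 1: "\<sigma> * L2_set z {..<d} \<le> z 0"
      by (rule power2_le_imp_le) (use z(1) D(1) in linarith)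
    have 2: "r \<le> (1 - \<sigma>\<^sup>2) * (L2_set z {..<d})\<^sup>2"
      unfolding split using * by (simp add: algebra_simps)
    have "0 < (z 0)\<^sup>2 + r"
    proof (rule add_pos_nonneg)
      show "0 < (z 0)\<^sup>2" using z(1) D(1) by simp
      show "0 \<le> r" by (simp add: r_def sum_nonneg)
    qed
    then have "L2_set z {..<d} \<noteq> 0" using split by auto
    then have "0 < L2_set z {..<d}" using L2_set_nonneg[of z "{..<d}"] by linarith
    with 1 2 show ?thesis by (simp add: r_def)
  qed
  let ?a = "L2_set x {..<d}" and ?b = "L2_set y {..<d}"
  note mx = main[of x, OF x] and my = main[of y, OF y]
  have "{..<d} = insert 0 {1..<d}" using d by auto
  then have inner: "sphere_inner d x y = x 0 * y 0 + (\<Sum>k\<in>{1..<d}. x k * y k)"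
    unfolding sphere_inner_def by simp
  have "\<bar>\<Sum>k\<in>{1..<d}. x k * y k\<bar> \<le> (1 - \<sigma>\<^sup>2) * (?a * ?b)"
  proof -
    have "\<bar>\<Sum>k\<in>{1..<d}. x k * y k\<bar>\<^sup>2 \<le> (\<Sum>k\<in>{1..<d}. (x k)\<^sup>2) * (\<Sum>k\<in>{1..<d}. (y k)\<^sup>2)"
      using Cauchy_Schwarz_ineq_sum[of x y "{1..<d}"] by simp
    also have "\<dots> \<le> ((1 - \<sigma>\<^sup>2) * ?a\<^sup>2) * ((1 - \<sigma>\<^sup>2) * ?b\<^sup>2)"
      using mx my \<sigma> by (intro mult_mono sum_nonneg) auto
    also have "\<dots> = ((1 - \<sigma>\<^sup>2) * (?a * ?b))\<^sup>2" by (simp add: power2_eq_square algebra_simps)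
    finally show ?thesis by (rule power2_le_imp_le) (use \<sigma> in simp)
  qed
  moreover have "(\<sigma> * ?a) * (\<sigma> * ?b) \<le> x 0 * y 0"
    using mx my \<sigma> x y D by (intro mult_mono) auto
  ultimately have "(2 * \<sigma>\<^sup>2 - 1) * (?a * ?b) \<le> sphere_inner d x y"
    unfolding inner by (simp add: power2_eq_square algebra_simps)
  then show ?thesis
    unfolding cosine_def using mx my by (subst pos_le_divide_eq) auto
qed

text \<open>Since thresholds stay below \<open>s\<close> < 1, a cap of fixed opening makes the graph
  complete. For d \<le> d1, placing a point in the cap has probability bounded below, so the cost is
  exponential in n only.\<close>

lemma lower_tail_small_dim:
  fixes p :: real
  assumes p: "0 < p"
  obtains c where "c > 0"
    "\<And>n d t a. 2 \<le> n \<Longrightarrow> 2 \<le> d \<Longrightarrow> d \<le> d1 \<Longrightarrow> is_threshold p d t \<Longrightarrow> a \<le> real (n choose 2) \<Longrightarrow>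
      exp (- c * real n) \<le> edge_tail n d t a"
proof -
  obtain s where s: "0 < s" "s < 1" and ts: "\<And>d t. d \<ge> 2 \<Longrightarrow> is_threshold p d t \<Longrightarrow> t \<le> s"
    by (rule threshold_bounded_away[OF p]) (rule that)
  \<comment> \<open>Chosen so that 2 \<sigma>^2 - 1 = s.\<close>
  define \<sigma> where "\<sigma> = sqrt ((1 + s) / 2)"
  have \<sigma>: "0 < \<sigma>" "\<sigma>\<^sup>2 = (1 + s) / 2" "\<sigma>\<^sup>2 < 1" using s by (auto simp: \<sigma>_def)
  \<comment> \<open>A first coordinate of this size dominates up to \<open>d1\<close> further
    coordinates in [0, 1]; the summand 1 keeps \<open>D\<close> positive for every value of
    \<open>d1\<close>.\<close>
  define D where "D = sqrt (\<sigma>\<^sup>2 * (real d1 + 1) / (1 - \<sigma>\<^sup>2))"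
  have D: "0 < D" "(1 - \<sigma>\<^sup>2) * D\<^sup>2 = \<sigma>\<^sup>2 * (real d1 + 1)"
  proof -
    have pos: "0 < \<sigma>\<^sup>2 * (real d1 + 1) / (1 - \<sigma>\<^sup>2)" using \<sigma> by (intro divide_pos_pos mult_pos_pos) auto
    then show "0 < D" by (simp add: D_def)
    have "D\<^sup>2 = \<sigma>\<^sup>2 * (real d1 + 1) / (1 - \<sigma>\<^sup>2)" unfolding D_def using pos by (intro real_sqrt_pow2) simp
    moreover have "1 - \<sigma>\<^sup>2 \<noteq> 0" using \<sigma>(3) by linarith
    ultimately show "(1 - \<sigma>\<^sup>2) * D\<^sup>2 = \<sigma>\<^sup>2 * (real d1 + 1)" by simp
  qed
  define r where "r = min (measure std_gauss {D..D + 1}) (measure std_gauss {0..1})"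
  have r: "0 < r" "r \<le> 1" "r \<le> measure std_gauss {D..D + 1}" "r \<le> measure std_gauss {0..1}"
  proof -
    show "0 < r"
      unfolding r_def min_less_iff_conj using D(1) by (intro conjI measure_std_gauss_Icc_pos) simp_all
    show "r \<le> measure std_gauss {D..D + 1}" unfolding r_def by (rule min.cobounded1)
    show "r \<le> measure std_gauss {0..1}" unfolding r_def by (rule min.cobounded2)
    then show "r \<le> 1" using std_gauss.prob_le_1[of "{0..1}"] by linarith
  qed
  define c where "c = 1 - real d1 * ln r"
  have "ln r \<le> 0" using r by simp
  then have "real d1 * ln r \<le> 0" by (rule mult_nonneg_nonpos[rotated]) simp
  then have c: "0 < c" unfolding c_def by linarith
  have "exp (- c * real n) \<le> edge_tail n d t a"
    if n: "2 \<le> n" and d: "2 \<le> d" "d \<le> d1" and thr: "is_threshold p d t" and a: "a \<le> real (n choose 2)" for n d t a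
  proof -
    let ?G = "gauss_points n d"
    interpret G: prob_space ?G by (rule prob_space_gauss_points)
    define J where "J k = (if k = 0 then {D..D + 1} else {0..1 :: real})" for k :: nat
    have J: "J k \<in> sets std_gauss" for k by (simp add: J_def)
    define B where "B = {x \<in> space (gauss d). \<forall>k\<in>{..<d}. x k \<in> J k}"
    have B: "B \<in> sets (gauss d)" "measure (gauss d) B = (\<Prod>k<d. measure std_gauss (J k))"
      unfolding B_def
      by (rule gauss.measure_PiM_box(2) gauss.measure_PiM_box(1); rule prob_space_std_gauss finite_lessThan J)+
    have "r ^ d1 \<le> r ^ d" using r d by (intro power_decreasing) auto
    also have "r ^ d = (\<Prod>k<d. r)" by simp
    also have "\<dots> \<le> measure (gauss d) B"
      unfolding B(2) using r by (intro prod_mono) (auto simp: J_def)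
    finally have rB: "r ^ d1 \<le> measure (gauss d) B" .
    define F where "F = {X \<in> space ?G. \<forall>i\<in>{1..n}. X i \<in> B}"
    have F: "F \<in> sets ?G" "measure ?G F = (\<Prod>i\<in>{1..n}. measure (gauss d) B)"
      unfolding F_def
      by (rule gauss_points.measure_PiM_box(2) gauss_points.measure_PiM_box(1);
          rule prob_space_gauss finite_atLeastAtMost B(1))+
    have "exp (- c * real n) \<le> exp (real d1 * ln r * real n)"
      by (simp add: c_def algebra_simps)
    also have "\<dots> = (r ^ d1) ^ n"
      using r by (simp add: exp_of_nat2_mult exp_of_nat_mult)
    also have "\<dots> \<le> (measure (gauss d) B) ^ n"
      using rB r by (intro power_mono) auto
    also have "\<dots> = measure ?G F" unfolding F by simp
    also have "\<dots> \<le> measure ?G {X \<in> space ?G. a \<le> edges d t n X}"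
    proof (rule G.finite_measure_mono)
      show "{X \<in> space ?G. a \<le> edges d t n X} \<in> sets ?G"
        by (intro borel_measurable_le borel_measurable_const ecount_cosine_measurable)
      show "F \<subseteq> {X \<in> space ?G. a \<le> edges d t n X}"
      proof
        fix X assume X: "X \<in> F"
        have coord: "X i k \<in> J k" if "i \<in> {1..n}" "k < d" for i k
          using X that by (simp add: F_def B_def)
        have edge: "t \<le> cosine d (X i) (X j)" if "1 \<le> i" "i < j" "j \<le> n" for i j
        proof -
          have "2 * \<sigma>\<^sup>2 - 1 \<le> cosine d (X i) (X j)"
          proof (rule cap_edge[where D = D])
            show "\<sigma>\<^sup>2 * real d \<le> (1 - \<sigma>\<^sup>2) * D\<^sup>2"
              unfolding D(2) using d by (intro mult_left_mono) auto
            show "D \<le> X i 0" "D \<le> X j 0" using coord[of i 0] coord[of j 0] that d by (auto simp: J_def)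
            show "\<bar>X i k\<bar> \<le> 1" "\<bar>X j k\<bar> \<le> 1" if "0 < k" "k < d" for k
              using coord[of i k] coord[of j k] that \<open>1 \<le> i\<close> \<open>i < j\<close> \<open>j \<le> n\<close> by (auto simp: J_def)
          qed (use d \<sigma> D in auto)
          moreover have "2 * \<sigma>\<^sup>2 - 1 = s" unfolding \<sigma>(2) by (simp add: field_simps)
          ultimately show ?thesis using ts[OF d(1) thr] by linarith
        qed
        have "edges d t n X = real (n choose 2)"
          by (rule ecount_all) (rule edge)
        then show "X \<in> {X \<in> space ?G. a \<le> edges d t n X}"
          using X a unfolding F_def by simp
      qed
    qed
    finally show ?thesis .
  qed
  with c that show ?thesis by blast
qed

section \<open>Dense regime: a complete graph\<close>

lemma nn_integral_box_exp_tail: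
  assumes I: "I \<in> sets borel" and s: "s < 1 / 2" and "a \<le> d"
  shows "(\<integral>\<^sup>+x. (\<Prod>k<d. if k < a then indicator I (x k) else ennreal (exp (s * (x k)\<^sup>2))) \<partial>gauss d)
    = ennreal (measure std_gauss I ^ a * (1 / sqrt (1 - 2 * s)) ^ (d - a))"
proof -
  define f where "f k z = (if k < a then indicator I z else ennreal (exp (s * z\<^sup>2)))" for k and z :: real
  have f: "f k \<in> borel_measurable std_gauss" for k
    unfolding f_def using I by (cases "k < a") simp_all
  have i1: "(\<integral>\<^sup>+z. indicator I z \<partial>std_gauss) = ennreal (measure std_gauss I)"
    using I by (simp add: std_gauss.emeasure_eq_measure)
  have "(\<integral>\<^sup>+x. (\<Prod>k<d. f k (x k)) \<partial>gauss d) = (\<Prod>k<d. \<integral>\<^sup>+z. f k z \<partial>std_gauss)"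
    using f by (intro gauss.product_nn_integral_prod) auto
  also have "\<dots> = (\<Prod>k<d. ennreal (if k < a then measure std_gauss I else 1 / sqrt (1 - 2 * s)))"
    using s by (intro prod.cong refl) (simp add: f_def i1 nn_integral_std_gauss_exp_sq)
  also have "\<dots> = ennreal (\<Prod>k<d. if k < a then measure std_gauss I else 1 / sqrt (1 - 2 * s))"
    using s by (intro prod_ennreal) auto
  also have "(\<Prod>k<d. if k < a then measure std_gauss I else 1 / sqrt (1 - 2 * s))
      = measure std_gauss I ^ a * (1 / sqrt (1 - 2 * s)) ^ (d - a)"
  proof -
    have "{..<d} \<inter> {k. k < a} = {..<a}" "{..<d} \<inter> - {k. k < a} = {a..<d}" using \<open>a \<le> d\<close> by auto
    then show ?thesis by (simp add: prod.If_cases)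
  qed
  finally show ?thesis by (simp add: f_def)
qed

text \<open>The first a coordinates are independent of the tail norm. Exponential Markov bounds are
  taken together with the box event, so each of the two failures of the tail norm costs at most a
  quarter of the box probability.\<close>

lemma measure_box_tail:
  assumes I: "I \<in> sets borel" and a: "2 * a \<le> d" and d: "exp (- (1 / 8) * real d) \<le> 1 / 4"
  shows "measure std_gauss I ^ a / 2 \<le> measure (gauss d) {x \<in> space (gauss d).
      (\<forall>k<a. x k \<in> I) \<and> real d / 12 \<le> (L2_set x {a..<d})\<^sup>2 \<and> (L2_set x {a..<d})\<^sup>2 \<le> 4 * real d}"
    and "{x \<in> space (gauss d).
      (\<forall>k<a. x k \<in> I) \<and> real d / 12 \<le> (L2_set x {a..<d})\<^sup>2 \<and> (L2_set x {a..<d})\<^sup>2 \<le> 4 * real d} \<in> sets (gauss d)"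
    (is "?E \<in> _")
proof -
  interpret G: prob_space "gauss d" by (rule prob_space_gauss)
  define q where "q = measure std_gauss I"
  have q: "0 \<le> q" by (simp add: q_def)
  define T where "T x = (L2_set x {a..<d})\<^sup>2" for x :: "nat \<Rightarrow> real"
  have T: "T \<in> borel_measurable (gauss d)"
    unfolding T_def by (intro borel_measurable_power measurable_gauss_L2_set) auto
  have I': "(if k < a then I else UNIV) \<in> sets std_gauss" for k using I by simp
  define A where "A = {x \<in> space (gauss d). \<forall>k\<in>{..<d}. x k \<in> (if k < a then I else UNIV)}"
  have A: "A \<in> sets (gauss d)" "measure (gauss d) A = (\<Prod>k<d. measure std_gauss (if k < a then I else UNIV))"
    unfolding A_def
    by (rule gauss.measure_PiM_box(2) gauss.measure_PiM_box(1); rule prob_space_std_gauss finite_lessThan I')+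
  have pA: "measure (gauss d) A = q ^ a"
  proof -
    have "measure std_gauss UNIV = 1" using std_gauss.prob_space by simp
    then have "(\<Prod>k<d. measure std_gauss (if k < a then I else UNIV)) = (\<Prod>k<d. if k < a then q else 1)"
      by (intro prod.cong) (auto simp: q_def)
    also have "{..<d} \<inter> {k. k < a} = {..<a}" using a by auto
    then have "(\<Prod>k<d. if k < a then q else 1) = q ^ a" by (simp add: prod.If_cases)
    finally show ?thesis unfolding A(2) .
  qed
  have inA: "x \<in> A \<longleftrightarrow> x \<in> space (gauss d) \<and> (\<forall>k<a. x k \<in> I)" for x
    unfolding A_def using a by auto
  define U where "U = {x \<in> space (gauss d). 4 * real d < T x}"
  define L where "L = {x \<in> space (gauss d). T x < real d / 12}"
  have UL: "U \<in> sets (gauss d)" "L \<in> sets (gauss d)"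
    unfolding U_def L_def using T by (intro borel_measurable_less borel_measurable_const; simp)+
  have E: "?E = A - (U \<union> L)"
    using inA by (auto simp: U_def L_def T_def not_less)
  show "?E \<in> sets (gauss d)" unfolding E using A UL by auto
  have prodT: "(\<Prod>k<d. if k < a then indicator I (x k) else ennreal (exp (s * (x k)\<^sup>2))) = ennreal (exp (s * T x))"
    if "x \<in> A" for x s
  proof -
    have "(\<Prod>k<d. if k < a then indicator I (x k) else ennreal (exp (s * (x k)\<^sup>2)))
        = (\<Prod>k<d. if k < a then 1 else ennreal (exp (s * (x k)\<^sup>2)))"
      using that inA by (intro prod.cong refl) auto
    also have "{..<d} \<inter> {k. k < a} = {..<a}" "{..<d} \<inter> - {k. k < a} = {a..<d}" using a by auto
    then have "(\<Prod>k<d. if k < a then 1 else ennreal (exp (s * (x k)\<^sup>2))) = (\<Prod>k\<in>{a..<d}. ennreal (exp (s * (x k)\<^sup>2)))"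
      by (simp add: prod.If_cases)
    also have "\<dots> = ennreal (exp (s * T x))"
      by (simp add: prod_ennreal T_def L2_set_def sum_nonneg sum_distrib_left exp_sum)
    finally show ?thesis .
  qed
  have bound: "measure (gauss d) (A \<inter> V) \<le> exp (- b) * (q ^ a * (1 / sqrt (1 - 2 * s)) ^ (d - a))"
    if V: "\<And>x. x \<in> V \<Longrightarrow> b \<le> s * T x" and s: "s < 1 / 2" for V b s
  proof (rule G.prob_le_nn_integral)
    show "1 \<le> ennreal (exp (- b)) * (\<Prod>k<d. if k < a then indicator I (x k) else ennreal (exp (s * (x k)\<^sup>2)))"
      if "x \<in> A \<inter> V" for x
    proof -
      have "1 \<le> exp (- b) * exp (s * T x)" using V[of x] that by (simp flip: exp_add)
      then show ?thesis using prodT[of x s] that by (simp flip: ennreal_mult)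
    qed
    have "(\<lambda>x. \<Prod>k<d. if k < a then indicator I (x k) else ennreal (exp (s * (x k)\<^sup>2))) \<in> borel_measurable (gauss d)"
    proof (rule borel_measurable_prod_ennreal)
      fix k assume "k \<in> {..<d}"
      then have "(\<lambda>x. x k) \<in> borel_measurable (gauss d)" by (intro measurable_gauss_coordinate) simp
      then show "(\<lambda>x. if k < a then indicator I (x k) else ennreal (exp (s * (x k)\<^sup>2))) \<in> borel_measurable (gauss d)"
        using I by (cases "k < a") simp_all
    qed
    then have "(\<integral>\<^sup>+x. ennreal (exp (- b)) * (\<Prod>k<d. if k < a then indicator I (x k) else ennreal (exp (s * (x k)\<^sup>2))) \<partial>gauss d)
        = ennreal (exp (- b)) * ennreal (q ^ a * (1 / sqrt (1 - 2 * s)) ^ (d - a))"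
      using a by (simp add: nn_integral_cmult nn_integral_box_exp_tail[OF I s] q_def)
    then show "(\<integral>\<^sup>+x. ennreal (exp (- b)) * (\<Prod>k<d. if k < a then indicator I (x k) else ennreal (exp (s * (x k)\<^sup>2))) \<partial>gauss d)
        \<le> ennreal (exp (- b) * (q ^ a * (1 / sqrt (1 - 2 * s)) ^ (d - a)))"
      using q s by (simp flip: ennreal_mult)
  qed (use q s in simp)
  have e1: "2 \<le> exp (1 :: real)" using exp_ge_add_one_self[of "1 :: real"] by simp
  have small: "exp (- (1 / 8) * real d) * q ^ a \<le> q ^ a / 4"
    using mult_right_mono[OF d, of "q ^ a"] q by simp
  have "measure (gauss d) (A \<inter> U) \<le> q ^ a / 4"
  proof -
    \<comment> \<open>Parameter 1/4 at level 4 d gives exp (- d), against a moment of sqrt 2 \<le>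
      exp (1/2) per tail coordinate.\<close>
    have "measure (gauss d) (A \<inter> U) \<le> exp (- real d) * (q ^ a * (1 / sqrt (1 - 2 * (1 / 4))) ^ (d - a))"
      by (rule bound) (auto simp: U_def)
    also have "1 / sqrt (1 - 2 * (1 / 4)) = sqrt (2 :: real)" by (simp add: real_sqrt_divide)
    also have "exp (- real d) * (q ^ a * sqrt 2 ^ (d - a)) \<le> exp (- real d) * (q ^ a * sqrt 2 ^ d)"
      using q by (intro mult_left_mono power_increasing) auto
    also have "\<dots> \<le> exp (- real d) * (q ^ a * exp (1 / 2) ^ d)"
    proof -
      have "sqrt 2 \<le> exp (1 / 2)" using e1 by (intro real_le_lsqrt) (auto simp flip: exp_double)
      then show ?thesis using q by (intro mult_left_mono power_mono) auto
    qed
    also have "\<dots> = exp (- (1 / 2) * real d) * q ^ a"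
      by (simp add: exp_of_nat_mult[symmetric] algebra_simps flip: exp_add)
    also have "\<dots> \<le> exp (- (1 / 8) * real d) * q ^ a" using q by (intro mult_right_mono) auto
    finally show ?thesis using small by linarith
  qed
  moreover have "measure (gauss d) (A \<inter> L) \<le> q ^ a / 4"
  proof -
    \<comment> \<open>Parameter -3/2 makes the moment exactly 1/2 per tail coordinate. At least d/2
      of them give exp (- d/4), and the level d/12 costs exp (d/8).\<close>
    have "measure (gauss d) (A \<inter> L) \<le> exp (- (- (1 / 8) * real d)) * (q ^ a * (1 / sqrt (1 - 2 * (- 3 / 2))) ^ (d - a))"
      by (rule bound) (auto simp: L_def)
    also have "1 / sqrt (1 - 2 * (- 3 / 2)) = (1 / 2 :: real)" by simp
    also have "(1 / 2 :: real) ^ (d - a) \<le> exp (- (1 / 4) * real d)"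
    proof -
      have "(1 / 2 :: real) ^ (d - a) \<le> exp (- (1 / 2)) ^ (d - a)"
      proof (rule power_mono)
        have "2 \<ge> exp (1 / 2 :: real)"
        proof (rule power2_le_imp_le)
          have "exp (1 :: real) \<le> 4" using exp_le by simp
          then show "(exp (1 / 2))\<^sup>2 \<le> (2 :: real)\<^sup>2" by (simp flip: exp_double)
        qed simp
        then have "inverse 2 \<le> inverse (exp (1 / 2 :: real))" by (intro le_imp_inverse_le) auto
        then show "1 / 2 \<le> exp (- (1 / 2) :: real)" by (simp only: exp_minus inverse_eq_divide)
      qed simp
      also have "\<dots> = exp (- (1 / 2) * real (d - a))" by (simp add: mult.commute flip: exp_of_nat_mult)
      also have "\<dots> \<le> exp (- (1 / 4) * real d)" using a by (simp add: of_nat_diff)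
      finally show ?thesis .
    qed
    then have "exp (- (- (1 / 8) * real d)) * (q ^ a * (1 / 2) ^ (d - a))
        \<le> exp (- (- (1 / 8) * real d)) * (q ^ a * exp (- (1 / 4) * real d))"
      using q by (intro mult_left_mono) auto
    also have "\<dots> = exp (- (1 / 8) * real d) * q ^ a"
      by (simp add: algebra_simps flip: exp_add)
    finally show ?thesis using small by linarith
  qed
  ultimately have "q ^ a - q ^ a / 4 - q ^ a / 4 \<le> measure (gauss d) A - measure (gauss d) ((A \<inter> U) \<union> (A \<inter> L))"
    using measure_Un_le[of "A \<inter> U" "gauss d" "A \<inter> L"] A UL pA by auto
  also have "\<dots> = measure (gauss d) (A - ((A \<inter> U) \<union> (A \<inter> L)))"
    using A UL by (intro G.finite_measure_Diff[symmetric]) auto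
  also have "A - ((A \<inter> U) \<union> (A \<inter> L)) = ?E" unfolding E by auto
  finally show "measure std_gauss I ^ a / 2 \<le> measure (gauss d) ?E"
    by (simp add: q_def)
qed

text \<open>The inner sums are nonnegative here, so they need no further control.\<close>

lemma dense_edge:
  fixes x y :: "nat \<Rightarrow> real" and t \<Theta> :: real
  assumes ij: "1 \<le> i" "i < j" "j \<le> d" and \<Theta>: "0 < \<Theta>" "\<bar>t\<bar> * sqrt (real d) \<le> \<Theta>"
    and x: "\<And>k. k < i - 1 \<Longrightarrow> 0 \<le> x k" and y: "\<And>k. k < j - 1 \<Longrightarrow> 18 * \<Theta> \<le> y k"
    and tail: "real d / 12 \<le> (L2_set x {i - 1..<d})\<^sup>2"
    and norm: "(L2_set x {..<d})\<^sup>2 \<le> 5 * real d" "(L2_set y {..<d})\<^sup>2 \<le> 5 * real d"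
  shows "t \<le> cosine d (triang d (i - 1) x) (triang d (j - 1) y)"
proof -
  let ?a = "L2_set x {..<d}" and ?b = "L2_set y {..<d}" and ?\<rho> = "L2_set x {i - 1..<d}"
  have d: "0 < real d" using ij by simp
  have \<rho>: "0 < ?\<rho>\<^sup>2" using tail d by linarith
  have "0 < ?a\<^sup>2" using L2_set_split[of "i - 1" d x] ij \<rho> by (simp add: add_nonneg_pos sum_nonneg)
  then have a: "0 < ?a" using L2_set_nonneg[of x "{..<d}"] by (simp add: less_le)
  have "0 < y 0" using y[of 0] ij \<Theta> by simp
  then have "?b \<noteq> 0" using ij by (auto simp: L2_set_eq_0_iff intro!: bexI[of _ 0])
  then have b: "0 < ?b" using L2_set_nonneg[of y "{..<d}"] by (simp add: less_le)
  have "(?a * ?b)\<^sup>2 \<le> (5 * real d) * (5 * real d)"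
    unfolding power_mult_distrib by (rule mult_mono[OF norm]) auto
  also have "\<dots> = (5 * real d)\<^sup>2" by (simp add: power2_eq_square)
  finally have ab: "?a * ?b \<le> 5 * real d" by (rule power2_le_imp_le) simp
  have "t * (?a * ?b) \<le> \<bar>t\<bar> * (?a * ?b)"
    using a b by (intro mult_right_mono) auto
  also have "\<dots> \<le> \<bar>t\<bar> * (5 * real d)"
    using ab by (rule mult_left_mono) simp
  also have "\<dots> = 5 * (\<bar>t\<bar> * sqrt (real d)) * sqrt (real d)" by simp
  also have "\<dots> \<le> 5 * \<Theta> * sqrt (real d)"
    using \<Theta> by (intro mult_right_mono mult_left_mono) auto
  \<comment> \<open>Origin of 18: with tail norm at least sqrt (d / 12), the squared comparison
    reads 25 \<le> 18^2 / 12 = 27.\<close>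
  also have "\<dots> \<le> ?\<rho> * (18 * \<Theta>)"
  proof (rule power2_le_imp_le)
    have "(5 * \<Theta> * sqrt (real d))\<^sup>2 = 25 * (\<Theta>\<^sup>2 * real d)" by (simp add: power_mult_distrib)
    also have "\<dots> \<le> 27 * (\<Theta>\<^sup>2 * real d)" by (intro mult_right_mono) auto
    also have "\<dots> = real d / 12 * (18 * \<Theta>)\<^sup>2" by (simp add: power_mult_distrib)
    also have "\<dots> \<le> ?\<rho>\<^sup>2 * (18 * \<Theta>)\<^sup>2" using tail by (intro mult_right_mono) auto
    finally show "(5 * \<Theta> * sqrt (real d))\<^sup>2 \<le> (?\<rho> * (18 * \<Theta>))\<^sup>2" by (simp only: power_mult_distrib[of ?\<rho>])
  qed (use \<Theta> in simp)
  also have "\<dots> \<le> ?\<rho> * y (i - 1)"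
    using y[of "i - 1"] ij by (intro mult_left_mono) auto
  also have "\<dots> \<le> (\<Sum>k<i - 1. x k * y k) + ?\<rho> * y (i - 1)"
  proof -
    have "0 \<le> x k * y k" if "k < i - 1" for k
    proof (rule mult_nonneg_nonneg)
      show "0 \<le> x k" by (rule x[OF that])
      have "k < j - 1" using that ij by linarith
      then have "18 * \<Theta> \<le> y k" by (rule y)
      then show "0 \<le> y k" using \<Theta>(1) by linarith
    qed
    then have "0 \<le> (\<Sum>k<i - 1. x k * y k)" by (intro sum_nonneg) simp
    then show ?thesis by linarith
  qed
  finally have "t * (?a * ?b) \<le> (\<Sum>k<i - 1. x k * y k) + ?\<rho> * y (i - 1)" .
  moreover have "0 < ?a * ?b" using a b by simp
  ultimately show ?thesis
    unfolding cosine_triang[OF ij] by (simp only: pos_le_divide_eq)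
qed

text \<open>All entries below the diagonal are asked to lie in a fixed interval, which costs
  \<open>q\<close> per pair, and all tail norms to be moderate, which costs 1/2 per vertex. Every
  pair is then an edge, so the bound holds for any level up to the number of pairs.\<close>

lemma lower_tail_dense:
  fixes p :: real
  assumes p: "0 < p" "p \<le> 1 / 2"
  obtains K c d0 where "K \<ge> 1" "c > 0"
    "\<And>n d t a. 2 \<le> n \<Longrightarrow> d0 \<le> d \<Longrightarrow> K * (real n)\<^sup>2 \<le> real d \<Longrightarrow> is_threshold p d t \<Longrightarrow> a \<le> real (n choose 2) \<Longrightarrow>
      exp (- c * (real n)\<^sup>2) \<le> edge_tail n d t a"
proof -
  define \<Theta> where "\<Theta> = 2 / sqrt p"
  have \<Theta>: "0 < \<Theta>" using p by (simp add: \<Theta>_def)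
  obtain d1 where d1: "\<And>d t. d \<ge> d1 \<Longrightarrow> is_threshold p d t \<Longrightarrow> \<bar>t\<bar> * sqrt (real d) \<le> \<Theta>"
    by (rule threshold_sqrt_bound[OF p, folded \<Theta>_def]) (rule that)
  obtain d2 where d2: "\<And>d. d \<ge> d2 \<Longrightarrow> exp (- (1 / 8) * real d) \<le> 1 / 4"
    by (rule exp_neg_le_eventually[of "1 / 8" "1 / 4"]) (simp, simp, rule that)
  \<comment> \<open>Bounded above as well, so that these entries add at most d to a squared
    norm.\<close>
  define I where "I = {18 * \<Theta>..18 * \<Theta> + 1}"
  define q where "q = measure std_gauss I"
  have q: "0 < q" "q \<le> 1"
    unfolding q_def I_def using \<Theta> by (auto intro!: measure_std_gauss_Icc_pos)
  \<comment> \<open>The 2 yields 2 n \<le> d, leaving at least half of the coordinates to the tail;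
    the square bounds the total contribution of the interval entries by d.\<close>
  define K where "K = 2 + (18 * \<Theta> + 1)\<^sup>2"
  have K: "2 \<le> K" "(18 * \<Theta> + 1)\<^sup>2 \<le> K" by (simp_all add: K_def)
  define c where "c = 1 - ln q"
  have lnq: "ln q \<le> 0" using q by simp
  then have c: "0 < c" unfolding c_def by linarith
  have "exp (- c * (real n)\<^sup>2) \<le> edge_tail n d t a"
    if n: "2 \<le> n" and d: "max d1 d2 \<le> d" "K * (real n)\<^sup>2 \<le> real d" and thr: "is_threshold p d t"
      and a: "a \<le> real (n choose 2)" for n d t a
  proof -
    let ?G = "gauss_points n d"
    interpret G: prob_space ?G by (rule prob_space_gauss_points)
    have n1: "real n * 1 \<le> (real n)\<^sup>2" unfolding power2_eq_square using n by (intro mult_left_mono) auto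
    have "2 * (real n)\<^sup>2 \<le> K * (real n)\<^sup>2" using K by (intro mult_right_mono) auto
    then have "2 * real n \<le> real d" using n1 d(2) by linarith
    then have nd: "2 * n \<le> d" by linarith
    have nI: "real n * (18 * \<Theta> + 1)\<^sup>2 \<le> real d"
    proof -
      have "real n * (18 * \<Theta> + 1)\<^sup>2 \<le> (real n)\<^sup>2 * K" using n1 K by (intro mult_mono) auto
      then show ?thesis using d by (simp add: mult.commute)
    qed
    define B where "B i = {x \<in> space (gauss d). (\<forall>k<i - 1. x k \<in> I) \<and>
      real d / 12 \<le> (L2_set x {i - 1..<d})\<^sup>2 \<and> (L2_set x {i - 1..<d})\<^sup>2 \<le> 4 * real d}" for i
    have I: "I \<in> sets borel" by (simp add: I_def)
    have ed: "exp (- (1 / 8) * real d) \<le> 1 / 4" using d by (intro d2) simp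
    have B: "q ^ (i - 1) / 2 \<le> measure (gauss d) (B i)" "B i \<in> sets (gauss d)" if "i \<in> {1..n}" for i
    proof -
      have "2 * (i - 1) \<le> d" using that nd by auto
      from measure_box_tail[OF I this ed] show "q ^ (i - 1) / 2 \<le> measure (gauss d) (B i)" "B i \<in> sets (gauss d)"
        unfolding B_def q_def by blast+
    qed
    define F where "F = {X \<in> space ?G. \<forall>i\<in>{1..n}. X i \<in> B i}"
    have F: "measure ?G F = (\<Prod>i\<in>{1..n}. measure (gauss d) (B i))"
      unfolding F_def by (rule gauss_points.measure_PiM_box(1)) (rule prob_space_gauss finite_atLeastAtMost B(2), assumption?)+
    have N: "real (n choose 2) \<le> (real n)\<^sup>2" using choose_two_bounds(2)[OF n] zero_le_power2[of "real n"] by linarith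
    have "exp (- c * (real n)\<^sup>2) \<le> exp (real (n choose 2) * ln q + - 1 * real n)"
    proof -
      have "(real n)\<^sup>2 * ln q \<le> real (n choose 2) * ln q" using N lnq by (intro mult_right_mono_neg)
      moreover have "- c * (real n)\<^sup>2 = (real n)\<^sup>2 * ln q - (real n)\<^sup>2"
        by (simp add: c_def algebra_simps)
      ultimately have "- c * (real n)\<^sup>2 \<le> real (n choose 2) * ln q + - 1 * real n" using n1 by linarith
      then show ?thesis by (simp only: exp_le_cancel_iff)
    qed
    also have "\<dots> = q ^ (n choose 2) * exp (- 1) ^ n"
      using q by (simp only: exp_add exp_of_nat_mult exp_of_nat2_mult exp_ln)
    also have "\<dots> \<le> q ^ (n choose 2) * (1 / 2) ^ n"
    proof -
      have "2 \<le> exp (1 :: real)" using exp_ge_add_one_self[of "1 :: real"] by simp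
      then have "inverse (exp 1) \<le> inverse (2 :: real)" by (intro le_imp_inverse_le) auto
      then have "exp (- 1) \<le> (1 / 2 :: real)" by (simp only: exp_minus inverse_eq_divide)
      then show ?thesis using q by (intro mult_left_mono power_mono) auto
    qed
    also have "\<dots> = (\<Prod>i\<in>{1..n}. q ^ (i - 1) / 2)"
    proof -
      have "(\<Prod>i\<in>{1..n}. q ^ (i - 1)) = q ^ (\<Sum>i\<in>{1..n}. i - 1)" by (rule power_sum[symmetric])
      then show ?thesis by (simp add: prod_dividef sum_pred_choose power_divide del: One_nat_def)
    qed
    also have "\<dots> \<le> measure ?G F"
      unfolding F using B(1) q by (intro prod_mono) auto
    also have "\<dots> \<le> measure ?G {X \<in> space ?G. a \<le> edges d t n (\<lambda>i. triang d (i - 1) (X i))}"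
    proof (rule G.finite_measure_mono)
      have "(\<lambda>X. edges d t n (\<lambda>i. triang d (i - 1) (X i))) \<in> borel_measurable ?G"
        by (rule ecount_measurable) measurable
      then show "{X \<in> space ?G. a \<le> edges d t n (\<lambda>i. triang d (i - 1) (X i))} \<in> sets ?G"
        by (intro borel_measurable_le borel_measurable_const)
      show "F \<subseteq> {X \<in> space ?G. a \<le> edges d t n (\<lambda>i. triang d (i - 1) (X i))}"
      proof
        fix X assume X: "X \<in> F"
        have XB: "X i \<in> B i" if "i \<in> {1..n}" for i using X that unfolding F_def by blast
        have coord: "X i k \<in> I" if "i \<in> {1..n}" "k < i - 1" for i k
          using XB[OF that(1)] that(2) by (simp add: B_def)
        have tail: "real d / 12 \<le> (L2_set (X i) {i - 1..<d})\<^sup>2" "(L2_set (X i) {i - 1..<d})\<^sup>2 \<le> 4 * real d"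
          if "i \<in> {1..n}" for i
          using XB[OF that] by (simp_all add: B_def)
        have norm: "(L2_set (X i) {..<d})\<^sup>2 \<le> 5 * real d" if i: "i \<in> {1..n}" for i
        proof -
          have "(\<Sum>k<i - 1. (X i k)\<^sup>2) \<le> (\<Sum>k<i - 1. (18 * \<Theta> + 1)\<^sup>2)"
            using coord[OF i] \<Theta> by (intro sum_mono power_mono) (auto simp: I_def intro: order_trans[of 0 "18 * \<Theta>"])
          also have "\<dots> = real (i - 1) * (18 * \<Theta> + 1)\<^sup>2" by simp
          also have "\<dots> \<le> real n * (18 * \<Theta> + 1)\<^sup>2" using i by (intro mult_right_mono) auto
          also have "\<dots> \<le> real d" by (rule nI)
          finally have "(\<Sum>k<i - 1. (X i k)\<^sup>2) \<le> real d" .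
          moreover have "i - 1 \<le> d" using i nd by auto
          ultimately show ?thesis
            using L2_set_split[of "i - 1" d "X i"] tail(2)[OF i] by linarith
        qed
        have "edges d t n (\<lambda>i. triang d (i - 1) (X i)) = real (n choose 2)"
        proof (rule ecount_all)
          fix i j :: nat assume ij: "1 \<le> i" "i < j" "j \<le> n"
          then have i: "i \<in> {1..n}" and j: "j \<in> {1..n}" and jd: "j \<le> d" using nd by auto
          show "t \<le> cosine d (triang d (i - 1) (X i)) (triang d (j - 1) (X j))"
          proof (rule dense_edge[OF ij(1,2) jd \<Theta>])
            show "\<bar>t\<bar> * sqrt (real d) \<le> \<Theta>" using d by (intro d1 thr) simp
            show "0 \<le> X i k" if "k < i - 1" for k using coord[OF i that] \<Theta> by (simp add: I_def)
            show "18 * \<Theta> \<le> X j k" if "k < j - 1" for k using coord[OF j that] by (simp add: I_def)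
          qed (rule tail(1)[OF i] norm[OF i] norm[OF j])+
        qed
        then show "X \<in> {X \<in> space ?G. a \<le> edges d t n (\<lambda>i. triang d (i - 1) (X i))}"
          using X a unfolding F_def by simp
      qed
    qed
    also have "\<dots> = measure ?G {X \<in> space ?G. a \<le> edges d t n X}"
      using nd by (intro measure_edges_triang[symmetric]) simp
    finally show ?thesis .
  qed
  moreover have "1 \<le> K" using K by simp
  ultimately show ?thesis using c that by blast
qed

section \<open>Second moments under planted first coordinates\<close>

lemma integral_gauss_points_prod:
  fixes f :: "nat \<Rightarrow> nat \<Rightarrow> real \<Rightarrow> real"
  assumes f: "\<And>i k. integrable std_gauss (f i k)"
  shows "integrable (gauss_points n d) (\<lambda>X. \<Prod>i\<in>{1..n}. \<Prod>k<d. f i k (X i k))"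
    and "(\<integral>X. (\<Prod>i\<in>{1..n}. \<Prod>k<d. f i k (X i k)) \<partial>gauss_points n d)
      = (\<Prod>i\<in>{1..n}. \<Prod>k<d. \<integral>z. f i k z \<partial>std_gauss)"
proof -
  have int: "integrable (gauss d) (\<lambda>x. \<Prod>k<d. f i k (x k))" for i
    using f by (intro gauss.product_integrable_prod) auto
  show "integrable (gauss_points n d) (\<lambda>X. \<Prod>i\<in>{1..n}. \<Prod>k<d. f i k (X i k))"
    using int by (intro gauss_points.product_integrable_prod[where f = "\<lambda>i x. \<Prod>k<d. f i k (x k)"]) auto
  have "(\<integral>X. (\<Prod>i\<in>{1..n}. \<Prod>k<d. f i k (X i k)) \<partial>gauss_points n d)
      = (\<Prod>i\<in>{1..n}. \<integral>x. (\<Prod>k<d. f i k (x k)) \<partial>gauss d)"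
    using int by (intro gauss_points.product_integral_prod[where f = "\<lambda>i x. \<Prod>k<d. f i k (x k)"]) auto
  also have "\<dots> = (\<Prod>i\<in>{1..n}. \<Prod>k<d. \<integral>z. f i k z \<partial>std_gauss)"
    using f by (intro prod.cong refl gauss.product_integral_prod) auto
  finally show "(\<integral>X. (\<Prod>i\<in>{1..n}. \<Prod>k<d. f i k (X i k)) \<partial>gauss_points n d)
      = (\<Prod>i\<in>{1..n}. \<Prod>k<d. \<integral>z. f i k z \<partial>std_gauss)" .
qed

lemma integrable_std_gauss_power: "integrable std_gauss (\<lambda>z. z ^ k)"
  unfolding std_gauss_def by (rule integrable_std_normal_distribution_moment)

lemma integral_std_gauss_1: "(\<integral>z. z \<partial>std_gauss) = 0"
  using integral_std_normal_distribution_moment_odd[of 1] by (simp add: std_gauss_def)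

lemma integral_std_gauss_2: "(\<integral>z. z ^ 2 \<partial>std_gauss) = 1"
  using std_normal_distribution_even_moments(1)[of 1] by (simp add: std_gauss_def)

text \<open>Indicator of the event that every vector has its coordinate 0 in \<open>I\<close>. Its
  integral is the n-th power of the probability of \<open>I\<close>; weighting by it replaces
  conditioning and keeps integrands of product form.\<close>

abbreviation planted :: "nat \<Rightarrow> real set \<Rightarrow> (nat \<Rightarrow> nat \<Rightarrow> real) \<Rightarrow> real" where
  "planted n I X \<equiv> \<Prod>i\<in>{1..n}. indicator I (X i 0)"

text \<open>The monomial does not involve coordinate 0, which alone carries the indicator, so the
  weighted integral is the planted mass times unconditioned moments.\<close>

lemma planted_monomial:
  assumes I: "I \<in> sets borel" and "0 < d" and e0: "\<And>i. e i 0 = 0"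
  shows "integrable (gauss_points n d) (\<lambda>X. planted n I X * (\<Prod>i\<in>{1..n}. \<Prod>k<d. X i k ^ e i k))"
    (is ?int)
    and "(\<integral>X. planted n I X * (\<Prod>i\<in>{1..n}. \<Prod>k<d. X i k ^ e i k) \<partial>gauss_points n d)
      = measure std_gauss I ^ n * (\<Prod>i\<in>{1..n}. \<Prod>k<d. \<integral>z. z ^ e i k \<partial>std_gauss)"
    (is ?eq)
proof -
  define f :: "nat \<Rightarrow> nat \<Rightarrow> real \<Rightarrow> real" where "f i k z = (if k = 0 then indicator I z else z ^ e i k)" for i k z
  have f: "integrable std_gauss (f i k)" for i k
  proof (cases "k = 0")
    case True
    have "integrable std_gauss (indicator I :: real \<Rightarrow> real)"
      using I by (intro std_gauss.integrable_const_bound[of _ 1]) (auto simp: indicator_def)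
    moreover have "f i k = indicator I" using True by (simp add: f_def fun_eq_iff)
    ultimately show ?thesis by simp
  next
    case False
    then have "f i k = (\<lambda>z. z ^ e i k)" by (simp add: f_def fun_eq_iff)
    then show ?thesis by (simp add: integrable_std_gauss_power)
  qed
  have split: "(\<Prod>k<d. if k = 0 then u else g k) = u * (\<Prod>k<d. g k)" if "g 0 = 1" for u :: real and g :: "nat \<Rightarrow> real"
  proof -
    have "{..<d} = insert 0 {1..<d}" using \<open>0 < d\<close> by auto
    then show ?thesis using that by simp
  qed
  have eq: "(\<Prod>i\<in>{1..n}. \<Prod>k<d. f i k (X i k))
      = planted n I X * (\<Prod>i\<in>{1..n}. \<Prod>k<d. X i k ^ e i k)" for X :: "nat \<Rightarrow> nat \<Rightarrow> real"
  proof -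
    have "(\<Prod>k<d. f i k (X i k)) = indicator I (X i 0) * (\<Prod>k<d. X i k ^ e i k)" for i
    proof -
      have "(\<Prod>k<d. f i k (X i k)) = (\<Prod>k<d. if k = 0 then indicator I (X i 0) else X i k ^ e i k)"
        by (intro prod.cong) (auto simp: f_def)
      then show ?thesis by (simp add: split e0)
    qed
    then show ?thesis by (simp add: prod.distrib)
  qed
  show ?int using integral_gauss_points_prod(1)[where f = f and n = n and d = d, OF f] unfolding eq .
  have "(\<Prod>k<d. \<integral>z. f i k z \<partial>std_gauss) = measure std_gauss I * (\<Prod>k<d. \<integral>z. z ^ e i k \<partial>std_gauss)" for i
  proof -
    have "(\<integral>z. f i k z \<partial>std_gauss) = (if k = 0 then measure std_gauss I else \<integral>z. z ^ e i k \<partial>std_gauss)" for k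
      using I by (simp add: f_def)
    moreover have "(\<integral>z. z ^ e i 0 \<partial>std_gauss) = 1" using std_gauss.prob_space by (simp add: e0)
    ultimately show ?thesis by (simp add: split)
  qed
  then show ?eq
    using integral_gauss_points_prod(2)[where f = f and n = n and d = d, OF f] unfolding eq by (simp add: prod.distrib)
qed

lemma planted_square:
  assumes I: "I \<in> sets borel" and i: "i \<in> {1..n}" and k: "0 < k" "k < d"
  shows "integrable (gauss_points n d) (\<lambda>X. planted n I X * (X i k)\<^sup>2)"
    and "(\<integral>X. planted n I X * (X i k)\<^sup>2 \<partial>gauss_points n d) = measure std_gauss I ^ n"
proof -
  define e :: "nat \<Rightarrow> nat \<Rightarrow> nat" where "e v l = (if v = i \<and> l = k then 2 else 0)" for v l
  have e0: "e v 0 = 0" for v using k by (simp add: e_def)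
  have mono: "(\<Prod>v\<in>{1..n}. \<Prod>l<d. (g v l :: real)) = g i k"
    if "\<And>v l. \<not> (v = i \<and> l = k) \<Longrightarrow> g v l = 1" for g
  proof -
    have "(\<Prod>l<d. g v l) = (if v = i then g i k else 1)" for v
    proof (cases "v = i")
      case True
      have "(\<Prod>l<d. g v l) = (\<Prod>l\<in>{k}. g v l)"
        using that k by (intro prod.mono_neutral_right) auto
      then show ?thesis using True by simp
    qed (use that in simp)
    then show ?thesis using i by (simp add: prod.delta del: One_nat_def)
  qed
  have 1: "(\<Prod>v\<in>{1..n}. \<Prod>l<d. X v l ^ e v l) = (X i k)\<^sup>2" for X :: "nat \<Rightarrow> nat \<Rightarrow> real"
    by (subst mono) (auto simp: e_def)
  have 2: "(\<Prod>v\<in>{1..n}. \<Prod>l<d. \<integral>z. z ^ e v l \<partial>std_gauss) = 1"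
    using std_gauss.prob_space by (subst mono) (auto simp: e_def integral_std_gauss_2)
  have d: "0 < d" using k by simp
  show "integrable (gauss_points n d) (\<lambda>X. planted n I X * (X i k)\<^sup>2)"
    using planted_monomial(1)[where e = e and n = n, OF I d e0] unfolding 1 .
  show "(\<integral>X. planted n I X * (X i k)\<^sup>2 \<partial>gauss_points n d) = measure std_gauss I ^ n"
    using planted_monomial(2)[where e = e and n = n, OF I d e0] unfolding 1 2 by simp
qed

text \<open>If k and l differ, a factor \<open>X i k\<close> occurs to the first power and has mean
  zero; if they agree, two independent squares of mean one remain.\<close>

lemma planted_cross:
  assumes I: "I \<in> sets borel" and ij: "i \<in> {1..n}" "j \<in> {1..n}" "i \<noteq> j"
    and k: "0 < k" "k < d" "0 < l" "l < d"
  shows "integrable (gauss_points n d) (\<lambda>X. planted n I X * (X i k * X j k * (X i l * X j l)))"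
    and "(\<integral>X. planted n I X * (X i k * X j k * (X i l * X j l)) \<partial>gauss_points n d)
      = (if k = l then measure std_gauss I ^ n else 0)"
proof -
  define e :: "nat \<Rightarrow> nat \<Rightarrow> nat" where
    "e v m = (if v = i \<or> v = j then of_bool (m = k) + of_bool (m = l) else 0)" for v m
  have e0: "e v 0 = 0" for v using k by (simp add: e_def)
  have outer: "(\<Prod>v\<in>{1..n}. (h v :: real)) = h i * h j" if "\<And>v. v \<noteq> i \<Longrightarrow> v \<noteq> j \<Longrightarrow> h v = 1" for h
  proof -
    have "(\<Prod>v\<in>{1..n}. h v) = (\<Prod>v\<in>{i, j}. h v)"
      using that ij by (intro prod.mono_neutral_right) auto
    then show ?thesis using ij by simp
  qed
  have pick: "(\<Prod>m<d. (if m = k then g m else 1 :: real)) = g k" if "k < d" for g and k :: nat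
    using that by (simp add: prod.delta)
  have 1: "(\<Prod>v\<in>{1..n}. \<Prod>m<d. X v m ^ e v m) = X i k * X j k * (X i l * X j l)" for X :: "nat \<Rightarrow> nat \<Rightarrow> real"
  proof -
    have "(\<Prod>m<d. X v m ^ e v m) = X v k * X v l" if "v = i \<or> v = j" for v
    proof -
      have "(\<Prod>m<d. X v m ^ e v m) = (\<Prod>m<d. (if m = k then X v m else 1) * (if m = l then X v m else 1))"
        using that by (intro prod.cong) (auto simp: e_def power_add)
      then show ?thesis using k by (simp add: prod.distrib pick)
    qed
    moreover have "(\<Prod>m<d. X v m ^ e v m) = 1" if "v \<noteq> i" "v \<noteq> j" for v
      using that by (simp add: e_def)
    ultimately have "(\<Prod>v\<in>{1..n}. \<Prod>m<d. X v m ^ e v m) = (X i k * X i l) * (X j k * X j l)"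
      by (subst outer) simp_all
    then show ?thesis by simp
  qed
  have 2: "(\<Prod>v\<in>{1..n}. \<Prod>m<d. \<integral>z. z ^ e v m \<partial>std_gauss) = (if k = l then 1 else 0)"
  proof -
    have one: "(\<integral>z. z ^ 0 \<partial>std_gauss) = 1" using std_gauss.prob_space by simp
    have "(\<Prod>m<d. \<integral>z. z ^ e v m \<partial>std_gauss) = (if k = l then 1 else 0)" if "v = i \<or> v = j" for v
    proof (cases "k = l")
      case True
      have "(\<integral>z. z ^ e v m \<partial>std_gauss) = 1" for m
      proof (cases "m = k")
        case m: True
        have "e v m = 2" using that m True by (simp add: e_def)
        then show ?thesis by (simp only: integral_std_gauss_2)
      next
        case False
        have "e v m = 0" using True False by (simp add: e_def)
        then show ?thesis by (simp only: one)
      qed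
      then show ?thesis using True by simp
    next
      case False
      have "e v k = 1" using that False by (simp add: e_def)
      then have "(\<integral>z. z ^ e v k \<partial>std_gauss) = 0" by (simp add: integral_std_gauss_1)
      then have "(\<Prod>m<d. \<integral>z. z ^ e v m \<partial>std_gauss) = 0"
        using k by (intro prod_zero) auto
      then show ?thesis using False by simp
    qed
    moreover have "(\<Prod>m<d. \<integral>z. z ^ e v m \<partial>std_gauss) = 1" if "v \<noteq> i" "v \<noteq> j" for v
    proof -
      have "e v m = 0" for m using that by (simp add: e_def)
      then show ?thesis by (simp only: one prod.neutral_const)
    qed
    ultimately show ?thesis by (subst outer) simp_all
  qed
  have d: "0 < d" using k by simp
  show "integrable (gauss_points n d) (\<lambda>X. planted n I X * (X i k * X j k * (X i l * X j l)))"
    using planted_monomial(1)[where e = e and n = n, OF I d e0] unfolding 1 .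
  show "(\<integral>X. planted n I X * (X i k * X j k * (X i l * X j l)) \<partial>gauss_points n d)
      = (if k = l then measure std_gauss I ^ n else 0)"
    using planted_monomial(2)[where e = e and n = n, OF I d e0] unfolding 1 2 by simp
qed

lemma planted_norm:
  assumes I: "I \<in> sets borel" and i: "i \<in> {1..n}" and d: "0 < d"
  shows "integrable (gauss_points n d) (\<lambda>X. planted n I X * (\<Sum>k\<in>{1..<d}. (X i k)\<^sup>2))"
    and "(\<integral>X. planted n I X * (\<Sum>k\<in>{1..<d}. (X i k)\<^sup>2) \<partial>gauss_points n d)
      = real (d - 1) * measure std_gauss I ^ n"
proof -
  have int: "integrable (gauss_points n d) (\<lambda>X. planted n I X * (X i k)\<^sup>2)" if "k \<in> {1..<d}" for k
    using that by (intro planted_square(1) I i) auto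
  show "integrable (gauss_points n d) (\<lambda>X. planted n I X * (\<Sum>k\<in>{1..<d}. (X i k)\<^sup>2))"
    unfolding sum_distrib_left by (rule Bochner_Integration.integrable_sum) (rule int)
  have "(\<integral>X. planted n I X * (\<Sum>k\<in>{1..<d}. (X i k)\<^sup>2) \<partial>gauss_points n d)
      = (\<Sum>k\<in>{1..<d}. \<integral>X. planted n I X * (X i k)\<^sup>2 \<partial>gauss_points n d)"
    unfolding sum_distrib_left by (rule Bochner_Integration.integral_sum) (rule int)
  also have "\<dots> = (\<Sum>k\<in>{1..<d}. measure std_gauss I ^ n)"
  proof (rule sum.cong[OF refl])
    fix k assume "k \<in> {1..<d}"
    then show "(\<integral>X. planted n I X * (X i k)\<^sup>2 \<partial>gauss_points n d) = measure std_gauss I ^ n"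
      by (intro planted_square(2) I i) auto
  qed
  finally show "(\<integral>X. planted n I X * (\<Sum>k\<in>{1..<d}. (X i k)\<^sup>2) \<partial>gauss_points n d)
      = real (d - 1) * measure std_gauss I ^ n" by simp
qed

text \<open>After expanding the square only the d - 1 diagonal terms survive. Hence the unplanted
  part of an inner product is typically of order sqrt d, the order of the planted shift.\<close>

lemma planted_inner:
  assumes I: "I \<in> sets borel" and ij: "i \<in> {1..n}" "j \<in> {1..n}" "i \<noteq> j" and d: "0 < d"
  shows "integrable (gauss_points n d) (\<lambda>X. planted n I X * (\<Sum>k\<in>{1..<d}. X i k * X j k)\<^sup>2)"
    and "(\<integral>X. planted n I X * (\<Sum>k\<in>{1..<d}. X i k * X j k)\<^sup>2 \<partial>gauss_points n d)
      = real (d - 1) * measure std_gauss I ^ n"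
proof -
  have exp: "planted n I X * (\<Sum>k\<in>{1..<d}. X i k * X j k)\<^sup>2
      = (\<Sum>k\<in>{1..<d}. \<Sum>l\<in>{1..<d}. planted n I X * (X i k * X j k * (X i l * X j l)))"
    for X :: "nat \<Rightarrow> nat \<Rightarrow> real"
    by (subst power2_eq_square, subst sum_product) (simp only: sum_distrib_left)
  have int: "integrable (gauss_points n d) (\<lambda>X. planted n I X * (X i k * X j k * (X i l * X j l)))"
    if "k \<in> {1..<d}" "l \<in> {1..<d}" for k l
    using that by (intro planted_cross(1) I ij) auto
  show "integrable (gauss_points n d) (\<lambda>X. planted n I X * (\<Sum>k\<in>{1..<d}. X i k * X j k)\<^sup>2)"
    unfolding exp by (intro Bochner_Integration.integrable_sum int)
  have "(\<integral>X. planted n I X * (\<Sum>k\<in>{1..<d}. X i k * X j k)\<^sup>2 \<partial>gauss_points n d)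
      = (\<Sum>k\<in>{1..<d}. \<integral>X. (\<Sum>l\<in>{1..<d}. planted n I X * (X i k * X j k * (X i l * X j l))) \<partial>gauss_points n d)"
    unfolding exp by (intro Bochner_Integration.integral_sum Bochner_Integration.integrable_sum int)
  also have "\<dots> = (\<Sum>k\<in>{1..<d}. \<Sum>l\<in>{1..<d}. \<integral>X. planted n I X * (X i k * X j k * (X i l * X j l)) \<partial>gauss_points n d)"
    by (intro sum.cong refl Bochner_Integration.integral_sum int)
  also have "\<dots> = (\<Sum>k\<in>{1..<d}. \<Sum>l\<in>{1..<d}. if k = l then measure std_gauss I ^ n else 0)"
  proof (intro sum.cong refl)
    fix k l assume "k \<in> {1..<d}" "l \<in> {1..<d}"
    then show "(\<integral>X. planted n I X * (X i k * X j k * (X i l * X j l)) \<partial>gauss_points n d)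
        = (if k = l then measure std_gauss I ^ n else 0)"
      by (intro planted_cross(2) I ij) auto
  qed
  also have "\<dots> = (\<Sum>k\<in>{1..<d}. measure std_gauss I ^ n)"
    by (intro sum.cong refl) (simp add: sum.delta)
  finally show "(\<integral>X. planted n I X * (\<Sum>k\<in>{1..<d}. X i k * X j k)\<^sup>2 \<partial>gauss_points n d)
      = real (d - 1) * measure std_gauss I ^ n" by simp
qed

text \<open>The planted product contributes at least a^2 = b sqrt d. Against it stand R sqrt d from
  the other coordinates and at most \<Theta> (4 b + M sqrt d) from the threshold. The bound 8
  \<Theta> \<le> sqrt d reduces 4 b \<Theta> to half of the gain, and the other half covers R +
  \<Theta> M.\<close>

lemma planted_edge:
  fixes x y :: "nat \<Rightarrow> real" and a b M R t \<Theta> :: real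
  assumes d: "1 \<le> d" and a: "0 < a" "a\<^sup>2 = b * sqrt (real d)"
    and x: "a \<le> x 0" "x 0 \<le> 2 * a" "(\<Sum>k\<in>{1..<d}. (x k)\<^sup>2) \<le> M * real d"
    and y: "a \<le> y 0" "y 0 \<le> 2 * a" "(\<Sum>k\<in>{1..<d}. (y k)\<^sup>2) \<le> M * real d"
    and inner: "- (R * sqrt (real d)) \<le> (\<Sum>k\<in>{1..<d}. x k * y k)"
    and t: "\<bar>t\<bar> * sqrt (real d) \<le> \<Theta>" and M: "0 \<le> M" and b: "0 \<le> b"
    and \<Theta>: "8 * \<Theta> \<le> sqrt (real d)" "2 * (R + \<Theta> * M) \<le> b"
  shows "t \<le> cosine d x y"
proof -
  let ?s = "sqrt (real d)"
  have s: "?s * ?s = real d" by simp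
  have norm: "0 < L2_set z {..<d} \<and> (L2_set z {..<d})\<^sup>2 \<le> 4 * a\<^sup>2 + M * real d"
    if z: "a \<le> z 0" "z 0 \<le> 2 * a" "(\<Sum>k\<in>{1..<d}. (z k)\<^sup>2) \<le> M * real d" for z :: "nat \<Rightarrow> real"
  proof -
    have split: "(L2_set z {..<d})\<^sup>2 = (z 0)\<^sup>2 + (\<Sum>k\<in>{1..<d}. (z k)\<^sup>2)"
      using L2_set_split[of 1 d z] d by (simp add: L2_set_def sum_nonneg)
    have "(z 0)\<^sup>2 \<le> (2 * a)\<^sup>2" using z a by (intro power_mono) auto
    then have "(L2_set z {..<d})\<^sup>2 \<le> 4 * a\<^sup>2 + M * real d"
      unfolding split power_mult_distrib using z(3) by simp
    moreover have "L2_set z {..<d} \<noteq> 0"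
      using z(1) a(1) d by (auto simp: L2_set_eq_0_iff intro!: bexI[of _ 0])
    then have "0 < L2_set z {..<d}" using L2_set_nonneg[of z "{..<d}"] by (simp add: less_le)
    ultimately show ?thesis by blast
  qed
  let ?a = "L2_set x {..<d}" and ?b = "L2_set y {..<d}"
  note nx = norm[of x, OF x] and ny = norm[of y, OF y]
  have "(?a * ?b)\<^sup>2 \<le> (4 * a\<^sup>2 + M * real d) * (4 * a\<^sup>2 + M * real d)"
    unfolding power_mult_distrib[of ?a] using nx ny M by (intro mult_mono) auto
  also have "\<dots> = (4 * a\<^sup>2 + M * real d)\<^sup>2" by (simp only: power2_eq_square)
  finally have ab: "?a * ?b \<le> 4 * a\<^sup>2 + M * real d"
    by (rule power2_le_imp_le) (use M in simp)
  have pos: "0 < ?a * ?b" using nx ny by simp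
  have "t * (?a * ?b) \<le> \<bar>t\<bar> * (?a * ?b)" using pos by (intro mult_right_mono) auto
  also have "\<dots> \<le> \<bar>t\<bar> * (4 * a\<^sup>2 + M * real d)" using ab by (intro mult_left_mono) auto
  also have "\<dots> = (\<bar>t\<bar> * ?s) * (4 * b + M * ?s)"
    unfolding a(2) using s by (simp add: algebra_simps)
  also have "\<dots> \<le> \<Theta> * (4 * b + M * ?s)" using t M b by (intro mult_right_mono) auto
  also have "\<dots> = (8 * \<Theta>) * (b / 2) + \<Theta> * M * ?s" by (simp add: algebra_simps)
  also have "\<dots> \<le> ?s * (b / 2) + \<Theta> * M * ?s"
    using \<Theta>(1) b by (intro add_right_mono mult_right_mono) auto
  also have "\<dots> = (b / 2 + \<Theta> * M) * ?s" by (simp add: algebra_simps)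
  also have "\<dots> \<le> (b - R) * ?s" using \<Theta>(2) by (intro mult_right_mono) auto
  also have "\<dots> = a * a - R * ?s" using a(2) by (simp add: algebra_simps power2_eq_square)
  also have "\<dots> \<le> x 0 * y 0 - R * ?s"
    using x y a by (intro diff_right_mono mult_mono) auto
  also have "\<dots> \<le> sphere_inner d x y"
  proof -
    have "{..<d} = insert 0 {1..<d}" using d by auto
    then have "sphere_inner d x y = x 0 * y 0 + (\<Sum>k\<in>{1..<d}. x k * y k)"
      unfolding sphere_inner_def by simp
    then show ?thesis using inner by linarith
  qed
  finally show ?thesis unfolding cosine_def using pos by (simp only: pos_le_divide_eq)
qed

text \<open>Planting costs at most 2 b sqrt d in the exponent per vertex. Under the planted weight
  the expected proportion of non-edges is at most half of \<open>\<kappa> = 1 - \<beta>\<close>, so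
  Markov's inequality leaves at least half of the planted mass with density \<beta> or more.\<close>

lemma lower_tail_planted:
  fixes p \<beta> :: real
  assumes p: "0 < p" "p \<le> 1 / 2" and \<beta>: "\<beta> < 1"
  obtains c d0 where "c > 0"
    "\<And>n d t. 2 \<le> n \<Longrightarrow> d0 \<le> d \<Longrightarrow> is_threshold p d t \<Longrightarrow>
      exp (- c * (real n * sqrt (real d))) \<le> edge_tail n d t (\<beta> * real (n choose 2))"
proof -
  define \<Theta> where "\<Theta> = 2 / sqrt p"
  have \<Theta>: "0 < \<Theta>" using p by (simp add: \<Theta>_def)
  obtain d1 where d1: "\<And>d t. d \<ge> d1 \<Longrightarrow> is_threshold p d t \<Longrightarrow> \<bar>t\<bar> * sqrt (real d) \<le> \<Theta>"
    by (rule threshold_sqrt_bound[OF p, folded \<Theta>_def]) (rule that)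
  define \<kappa> where "\<kappa> = 1 - \<beta>"
  have \<kappa>: "0 < \<kappa>" using \<beta> by (simp add: \<kappa>_def)
  \<comment> \<open>The expected non-edge proportion is bounded by 2/M (two norms) plus 1/R^2 (one
    inner product); \<open>M\<close> and \<open>R\<close> give \<kappa>/4 to each.\<close>
  define M where "M = 8 / \<kappa>"
  define R where "R = 2 / sqrt \<kappa>"
  have MR: "0 < M" "0 < R" "2 / M + 1 / R\<^sup>2 = \<kappa> / 2"
    using \<kappa> by (auto simp: M_def R_def power_divide)
  \<comment> \<open>The summand 9 makes a \<ge> 3 \<ge> sqrt (2 pi), so that the prefactor in the
    lower bound for the interval probability is at least 1.\<close>
  define b where "b = 2 * (R + \<Theta> * M) + 9"
  have b: "9 \<le> b" "2 * (R + \<Theta> * M) \<le> b" using MR \<Theta> by (auto simp: b_def)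
  define c where "c = 2 * b + 1"
  have c: "0 < c" using b by (simp add: c_def)
  define d0 where "d0 = max (max 1 d1) (nat \<lceil>(8 * \<Theta>)\<^sup>2\<rceil>)"
  have "exp (- c * (real n * sqrt (real d))) \<le> edge_tail n d t (\<beta> * real (n choose 2))"
    if n: "2 \<le> n" and d: "d0 \<le> d" and thr: "is_threshold p d t" for n d t
  proof -
    let ?G = "gauss_points n d" and ?N = "real (n choose 2)"
    let ?E = "edges d t n"
    interpret G: prob_space ?G by (rule prob_space_gauss_points)
    have N: "1 \<le> ?N" using choose_two_bounds[OF n] by blast
    have dd: "1 \<le> d" "d1 \<le> d" using d by (simp_all add: d0_def)
    have t: "\<bar>t\<bar> * sqrt (real d) \<le> \<Theta>" by (rule d1[OF dd(2) thr])
    have "(8 * \<Theta>)\<^sup>2 \<le> real d" using d unfolding d0_def by linarith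
    then have s8: "8 * \<Theta> \<le> sqrt (real d)" by (rule real_le_rsqrt)
    have s1: "1 \<le> sqrt (real d)" using dd by simp
    define a where "a = sqrt (b * sqrt (real d))"
    have b0: "0 \<le> b * sqrt (real d)" using b by (intro mult_nonneg_nonneg) auto
    then have a2: "a\<^sup>2 = b * sqrt (real d)" unfolding a_def by simp
    have "9 * 1 \<le> b * sqrt (real d)" using b s1 by (intro mult_mono) auto
    then have "3\<^sup>2 \<le> a\<^sup>2" by (simp add: a2)
    then have a3: "3 \<le> a" by (rule power2_le_imp_le) (simp add: a_def b0)
    define I where "I = {a..2 * a}"
    have I: "I \<in> sets borel" by (simp add: I_def)
    define q where "q = measure std_gauss I"
    have qlow: "exp (- (2 * b * sqrt (real d))) \<le> q"
    proof -
      have "(2 * a - a) * std_normal_density (2 * a) \<le> q"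
        unfolding q_def I_def using a3 by (intro measure_std_gauss_Icc_ge) auto
      moreover have "(2 * a - a) * std_normal_density (2 * a) = a / sqrt (2 * pi) * exp (- (2 * b * sqrt (real d)))"
        by (simp add: std_normal_density_def power_mult_distrib a2)
      moreover have "1 * exp (- (2 * b * sqrt (real d))) \<le> a / sqrt (2 * pi) * exp (- (2 * b * sqrt (real d)))"
      proof (rule mult_right_mono)
        have "sqrt (2 * pi) \<le> 3" using pi_less_4 by (intro real_le_lsqrt) auto
        then show "1 \<le> a / sqrt (2 * pi)" using a3 by (simp add: pos_le_divide_eq)
      qed simp
      ultimately show ?thesis by linarith
    qed
    then have q: "0 < q" by (rule less_le_trans[rotated]) simp
    define ind where "ind X = planted n I X" for X :: "nat \<Rightarrow> nat \<Rightarrow> real"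
    define P0 where "P0 = {X \<in> space ?G. \<forall>i\<in>{1..n}. X i \<in> {x \<in> space (gauss d). x 0 \<in> I}}"
    have box: "{x \<in> space (gauss d). x 0 \<in> I} \<in> sets (gauss d)" using dd I by (intro gauss_coordinate_sets) auto
    have P0: "P0 \<in> sets ?G" "measure ?G P0 = q ^ n"
    proof -
      show "P0 \<in> sets ?G"
        unfolding P0_def by (rule gauss_points.measure_PiM_box(2)) (rule prob_space_gauss finite_atLeastAtMost box)+
      have "measure ?G P0 = (\<Prod>i\<in>{1..n}. measure (gauss d) {x \<in> space (gauss d). x 0 \<in> I})"
        unfolding P0_def by (rule gauss_points.measure_PiM_box(1)) (rule prob_space_gauss finite_atLeastAtMost box)+
      also have "measure (gauss d) {x \<in> space (gauss d). x 0 \<in> I} = q"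
        unfolding q_def using dd I by (intro measure_gauss_coordinate) auto
      finally show "measure ?G P0 = q ^ n" by simp
    qed
    define Y where "Y i X = (\<Sum>k\<in>{1..<d}. (X i k)\<^sup>2)" for i and X :: "nat \<Rightarrow> nat \<Rightarrow> real"
    define Z where "Z i j X = (\<Sum>k\<in>{1..<d}. X i k * X j k)\<^sup>2" for i j and X :: "nat \<Rightarrow> nat \<Rightarrow> real"
    \<comment> \<open>A majorant of the non-edge indicator on the planted event: a non-edge violates
      a norm bound or the inner product bound, and the violated one makes its term at least
      1.\<close>
    define H where "H i j X = 1 / (M * real d) * (ind X * Y i X) + 1 / (M * real d) * (ind X * Y j X)
      + 1 / (R\<^sup>2 * real d) * (ind X * Z i j X)" for i j X
    have H: "integrable ?G (H i j)" "(\<integral>X. H i j X \<partial>?G) \<le> q ^ n * (\<kappa> / 2)" if ij: "(i, j) \<in> vpairs n" for i j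
    proof -
      have i: "i \<in> {1..n}" "j \<in> {1..n}" "i \<noteq> j" using ij by (auto simp: vpairs_def)
      have d0': "0 < d" using dd by simp
      note intY = planted_norm[OF I i(1) d0', folded ind_def Y_def q_def]
        planted_norm[OF I i(2) d0', folded ind_def Y_def q_def]
      note intZ = planted_inner[OF I i d0', folded ind_def Z_def q_def]
      show "integrable ?G (H i j)"
        unfolding H_def using intY intZ by (intro Bochner_Integration.integrable_add integrable_mult_right) auto
      have "(\<integral>X. H i j X \<partial>?G) = 1 / (M * real d) * (real (d - 1) * q ^ n) + 1 / (M * real d) * (real (d - 1) * q ^ n)
          + 1 / (R\<^sup>2 * real d) * (real (d - 1) * q ^ n)"
        unfolding H_def using intY intZ by simp
      also have "\<dots> = (real (d - 1) / real d) * (q ^ n * (2 / M + 1 / R\<^sup>2))"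
      proof -
        have gen: "1 / (m * A) * (D * Q) + 1 / (m * A) * (D * Q) + 1 / (r * A) * (D * Q) = (D / A) * (Q * (2 / m + 1 / r))"
          if "A \<noteq> 0" "m \<noteq> 0" "r \<noteq> 0" for A m r D Q :: real
          using that by (simp add: field_simps)
        show ?thesis by (rule gen) (use MR dd in auto)
      qed
      also have "\<dots> \<le> 1 * (q ^ n * (2 / M + 1 / R\<^sup>2))"
        using dd q MR \<kappa> by (intro mult_right_mono) auto
      finally show "(\<integral>X. H i j X \<partial>?G) \<le> q ^ n * (\<kappa> / 2)" unfolding MR(3) by simp
    qed
    define U where "U X = (\<Sum>(i, j)\<in>vpairs n. H i j X)" for X
    have U: "integrable ?G U" "(\<integral>X. U X \<partial>?G) \<le> ?N * (q ^ n * (\<kappa> / 2))"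
    proof -
      show "integrable ?G U"
        unfolding U_def case_prod_unfold using H(1) by (intro Bochner_Integration.integrable_sum) auto
      have "(\<integral>X. U X \<partial>?G) = (\<Sum>(i, j)\<in>vpairs n. \<integral>X. H i j X \<partial>?G)"
        unfolding U_def case_prod_unfold using H(1) by (intro Bochner_Integration.integral_sum) auto
      also have "\<dots> \<le> (\<Sum>(i, j)\<in>vpairs n. q ^ n * (\<kappa> / 2))"
        using H(2) by (intro sum_mono) auto
      finally show "(\<integral>X. U X \<partial>?G) \<le> ?N * (q ^ n * (\<kappa> / 2))" by (simp add: card_vpairs)
    qed
    have Y0: "0 \<le> Y i X" for i X by (simp add: Y_def sum_nonneg)
    have ind0: "0 \<le> ind X" for X unfolding ind_def by (intro prod_nonneg) auto
    have H0: "0 \<le> H i j X" for i j X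
      unfolding H_def using Y0 ind0 MR by (intro add_nonneg_nonneg mult_nonneg_nonneg) (auto simp: Z_def)
    have U0: "0 \<le> U X" for X unfolding U_def using H0 by (intro sum_nonneg) auto
    have nonedge: "1 - of_bool (t \<le> cosine d (X i) (X j)) \<le> H i j X"
      if X: "X \<in> P0" and ij: "(i, j) \<in> vpairs n" for X i j
    proof (cases "t \<le> cosine d (X i) (X j)")
      case True
      then show ?thesis using H0[of i j X] by simp
    next
      case False
      have coord: "X v 0 \<in> I" if "v \<in> {1..n}" for v using X that unfolding P0_def by blast
      have ind1: "ind X = 1" unfolding ind_def using coord by (intro prod.neutral) simp
      have i: "i \<in> {1..n}" "j \<in> {1..n}" using ij by (auto simp: vpairs_def)
      have dpos: "0 < real d" using dd by simp
      have "M * real d < Y i X \<or> M * real d < Y j X \<or> R\<^sup>2 * real d < Z i j X"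
      proof (rule ccontr)
        assume "\<not> ?thesis"
        then have le: "Y i X \<le> M * real d" "Y j X \<le> M * real d" "Z i j X \<le> R\<^sup>2 * real d" by auto
        have "\<bar>\<Sum>k\<in>{1..<d}. X i k * X j k\<bar>\<^sup>2 \<le> (R * sqrt (real d))\<^sup>2"
          using le(3) by (simp only: Z_def power2_abs power_mult_distrib real_sqrt_pow2 of_nat_0_le_iff)
        then have "\<bar>\<Sum>k\<in>{1..<d}. X i k * X j k\<bar> \<le> R * sqrt (real d)"
          by (rule power2_le_imp_le) (use MR in simp)
        then have "- (R * sqrt (real d)) \<le> (\<Sum>k\<in>{1..<d}. X i k * X j k)" by linarith
        moreover have "a \<le> X i 0" "X i 0 \<le> 2 * a" "a \<le> X j 0" "X j 0 \<le> 2 * a"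
          using coord[OF i(1)] coord[OF i(2)] by (simp_all add: I_def)
        moreover have "0 < a" "0 \<le> M" "0 \<le> b" using a3 MR b by linarith+
        ultimately have "t \<le> cosine d (X i) (X j)"
          using le(1,2)[unfolded Y_def] t a2 s8 b(2) by (intro planted_edge[OF dd(1)])
        with False show False by simp
      qed
      then have "1 \<le> Y i X / (M * real d) \<or> 1 \<le> Y j X / (M * real d) \<or> 1 \<le> Z i j X / (R\<^sup>2 * real d)"
        using MR dpos by (auto simp: pos_le_divide_eq)
      moreover have "0 \<le> Y i X / (M * real d)" "0 \<le> Y j X / (M * real d)" "0 \<le> Z i j X / (R\<^sup>2 * real d)"
        using Y0 MR by (auto simp: Z_def)
      ultimately have "1 \<le> Y i X / (M * real d) + Y j X / (M * real d) + Z i j X / (R\<^sup>2 * real d)" by linarith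
      then show ?thesis using False by (simp add: H_def ind1)
    qed
    let ?T = "{X \<in> space ?G. \<beta> * ?N \<le> ?E X}"
    have T: "?T \<in> sets ?G" by (intro borel_measurable_le borel_measurable_const ecount_cosine_measurable)
    define V where "V = P0 - ?T"
    have V: "V \<in> sets ?G" unfolding V_def using P0 T by blast
    \<comment> \<open>On \<open>V\<close> more than \<kappa> N pairs are non-edges, so U \<ge>
      \<kappa> N there, while the integral of \<open>U\<close> is at most half of \<kappa> N times
      the planted mass.\<close>
    have "\<kappa> * ?N * measure ?G V = (\<integral>X. \<kappa> * ?N * indicator V X \<partial>?G)"
      using V by simp
    also have "\<dots> \<le> (\<integral>X. U X \<partial>?G)"
    proof (rule integral_mono[OF _ U(1)])
      show "integrable ?G (\<lambda>X. \<kappa> * ?N * indicator V X)"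
        using V by (intro integrable_mult_right) (simp add: integrable_indicator_iff G.emeasure_eq_measure del: One_nat_def)
      fix X assume Xs: "X \<in> space ?G"
      show "\<kappa> * ?N * indicator V X \<le> U X"
      proof (cases "X \<in> V")
        case True
        then have XP: "X \<in> P0" and "X \<notin> ?T" by (auto simp only: V_def Diff_iff)
        then have "?E X < \<beta> * ?N" using Xs by (simp only: mem_Collect_eq simp_thms not_le)
        then have "\<kappa> * ?N \<le> ?N - ?E X" by (simp add: \<kappa>_def left_diff_distrib)
        also have "\<dots> = (\<Sum>(i, j)\<in>vpairs n. 1 - of_bool (t \<le> cosine d (X i) (X j)))"
          by (simp add: ecount_def case_prod_unfold sum_subtractf card_vpairs)
        also have "\<dots> \<le> U X"
          unfolding U_def using nonedge[OF XP] by (intro sum_mono) auto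
        finally show ?thesis using True by simp
      qed (use U0 in simp)
    qed
    also have "\<dots> \<le> ?N * (q ^ n * (\<kappa> / 2))" by (rule U(2))
    also have "\<dots> = \<kappa> * ?N * (q ^ n / 2)" by simp
    finally have VV: "measure ?G V \<le> q ^ n / 2"
    proof -
      assume le: "\<kappa> * ?N * measure ?G V \<le> \<kappa> * ?N * (q ^ n / 2)"
      have "0 < \<kappa> * ?N" using \<kappa> N by (intro mult_pos_pos) linarith+
      with le show ?thesis by (simp only: mult_le_cancel_left_pos)
    qed
    have "measure ?G P0 \<le> measure ?G (V \<union> ?T)"
      by (intro G.finite_measure_mono sets.Un V T) (auto simp only: V_def)
    also have "\<dots> \<le> measure ?G V + measure ?G ?T" by (intro measure_Un_le V T)
    finally have low: "q ^ n / 2 \<le> measure ?G ?T" using VV unfolding P0(2) by linarith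
    \<comment> \<open>The extra 1 in \<open>c\<close> buys a factor exp (-1), below the 1/2 lost to
      Markov's inequality; this uses n sqrt d \<ge> 1.\<close>
    have "exp (- c * (real n * sqrt (real d))) \<le> exp (- 1 + real n * - (2 * b * sqrt (real d)))"
    proof -
      have "1 * 1 \<le> real n * sqrt (real d)" using n s1 by (intro mult_mono) auto
      then show ?thesis by (simp add: c_def algebra_simps)
    qed
    also have "\<dots> = exp (- 1) * exp (- (2 * b * sqrt (real d))) ^ n"
      by (simp only: exp_add exp_of_nat_mult)
    also have "\<dots> \<le> 1 / 2 * q ^ n"
    proof (rule mult_mono)
      have "2 \<le> exp (1 :: real)" using exp_ge_add_one_self[of "1 :: real"] by simp
      then have "inverse (exp 1) \<le> inverse (2 :: real)" by (intro le_imp_inverse_le) auto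
      then show "exp (- 1) \<le> (1 / 2 :: real)" by (simp only: exp_minus inverse_eq_divide)
      show "exp (- (2 * b * sqrt (real d))) ^ n \<le> q ^ n" using qlow by (intro power_mono) auto
    qed auto
    also have "\<dots> \<le> measure ?G ?T" using low by simp
    finally show ?thesis .
  qed
  with c that show ?thesis by blast
qed

text \<open>Three regimes: bounded d, where the minimum is at least n; K n^2 \<le> d, where it is
  n^2; and otherwise planting, whose exponent n sqrt d exceeds the minimum by at most a constant
  factor.\<close>

lemma lower_tail:
  fixes p \<beta> :: real
  assumes p: "0 < p" "p \<le> 1 / 2" and \<beta>: "\<beta> < 1"
  obtains c where "c > 0"
    "\<And>n d t. 2 \<le> n \<Longrightarrow> 2 \<le> d \<Longrightarrow> is_threshold p d t \<Longrightarrow>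
      exp (- c * min ((real n)\<^sup>2) (real n * sqrt (real d))) \<le> edge_tail n d t (\<beta> * real (n choose 2))"
proof -
  obtain K c1 d1 where K: "K \<ge> 1" and c1: "c1 > 0" and dense:
    "\<And>n d t a. 2 \<le> n \<Longrightarrow> d1 \<le> d \<Longrightarrow> K * (real n)\<^sup>2 \<le> real d \<Longrightarrow> is_threshold p d t \<Longrightarrow> a \<le> real (n choose 2) \<Longrightarrow>
      exp (- c1 * (real n)\<^sup>2) \<le> edge_tail n d t a"
    by (rule lower_tail_dense[OF p]) (rule that)
  obtain c2 d2 where c2: "c2 > 0" and planted:
    "\<And>n d t. 2 \<le> n \<Longrightarrow> d2 \<le> d \<Longrightarrow> is_threshold p d t \<Longrightarrow>
      exp (- c2 * (real n * sqrt (real d))) \<le> edge_tail n d t (\<beta> * real (n choose 2))"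
    by (rule lower_tail_planted[OF p \<beta>]) (rule that)
  obtain c3 where c3: "c3 > 0" and small:
    "\<And>n d t a. 2 \<le> n \<Longrightarrow> 2 \<le> d \<Longrightarrow> d \<le> max d1 d2 \<Longrightarrow> is_threshold p d t \<Longrightarrow> a \<le> real (n choose 2) \<Longrightarrow>
      exp (- c3 * real n) \<le> edge_tail n d t a"
    by (rule lower_tail_small_dim[OF p(1)]) (rule that)
  define c where "c = c1 + c2 * sqrt K + c3"
  have c: "c1 \<le> c" "c2 * sqrt K \<le> c" "c3 \<le> c" "0 < c"
    using c1 c2 c3 K by (auto simp: c_def add_pos_nonneg)
  have "exp (- c * min ((real n)\<^sup>2) (real n * sqrt (real d))) \<le> edge_tail n d t (\<beta> * real (n choose 2))" (is "exp (- c * ?min) \<le> ?P")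
    if n: "2 \<le> n" and d: "2 \<le> d" and thr: "is_threshold p d t" for n d t
  proof -
    have \<beta>N: "\<beta> * real (n choose 2) \<le> real (n choose 2)"
      using \<beta> mult_right_mono[of \<beta> 1 "real (n choose 2)"] by simp
    have m0: "0 \<le> ?min" by simp
    have "\<exists>e. exp (- e) \<le> ?P \<and> e \<le> c * ?min"
    proof (cases "d \<le> max d1 d2")
      case True
      have "real n * 1 \<le> ?min"
      proof (rule min.boundedI)
        show "real n * 1 \<le> (real n)\<^sup>2" unfolding power2_eq_square using n by (intro mult_left_mono) auto
        show "real n * 1 \<le> real n * sqrt (real d)" using d by (intro mult_left_mono) auto
      qed
      then have "c3 * real n \<le> c * ?min" using c c3 by (intro mult_mono) auto
      moreover have "exp (- (c3 * real n)) \<le> ?P" using small[OF n d True thr \<beta>N] by simp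
      ultimately show ?thesis by blast
    next
      case False
      then have dd: "d1 \<le> d" "d2 \<le> d" by auto
      show ?thesis
      proof (cases "K * (real n)\<^sup>2 \<le> real d")
        case True
        have "1 * (real n)\<^sup>2 \<le> K * (real n)\<^sup>2" using K by (intro mult_right_mono) auto
        then have "real n \<le> sqrt (real d)" using True by (intro real_le_rsqrt) linarith
        then have "(real n)\<^sup>2 \<le> real n * sqrt (real d)" unfolding power2_eq_square by (intro mult_left_mono) auto
        then have "?min = (real n)\<^sup>2" by simp
        then have "c1 * (real n)\<^sup>2 \<le> c * ?min" using c by (simp add: mult_right_mono)
        moreover have "exp (- (c1 * (real n)\<^sup>2)) \<le> ?P" using dense[OF n dd(1) True thr \<beta>N] by simp
        ultimately show ?thesis by blast
      next
        case False
        have "sqrt (real d) \<le> sqrt (K * (real n)\<^sup>2)" using False by simp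
        also have "\<dots> = sqrt K * real n" by (simp add: real_sqrt_mult)
        finally have "real n * sqrt (real d) \<le> real n * (sqrt K * real n)" by (intro mult_left_mono) auto
        then have 1: "real n * sqrt (real d) \<le> sqrt K * (real n)\<^sup>2" by (simp add: power2_eq_square algebra_simps)
        have 2: "1 * (real n * sqrt (real d)) \<le> sqrt K * (real n * sqrt (real d))"
          using K by (intro mult_right_mono) auto
        \<comment> \<open>Both terms of the minimum satisfy this: d < K n^2 handles n^2, and sqrt K
          \<ge> 1 handles n sqrt d.\<close>
        have "real n * sqrt (real d) \<le> sqrt K * ?min"
          using 1 2 by (cases "(real n)\<^sup>2 \<le> real n * sqrt (real d)") simp_all
        then have "c2 * (real n * sqrt (real d)) \<le> c2 * (sqrt K * ?min)" using c2 by (intro mult_left_mono) auto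
        also have "\<dots> = (c2 * sqrt K) * ?min" by simp
        also have "\<dots> \<le> c * ?min" using c m0 by (intro mult_right_mono) auto
        finally have "c2 * (real n * sqrt (real d)) \<le> c * ?min" .
        moreover have "exp (- (c2 * (real n * sqrt (real d)))) \<le> ?P" using planted[OF n dd(2) thr] by simp
        ultimately show ?thesis by blast
      qed
    qed
    then obtain e where e: "exp (- e) \<le> ?P" "e \<le> c * ?min" by blast
    have "exp (- c * ?min) \<le> exp (- e)" using e(2) by simp
    then show ?thesis using e(1) by linarith
  qed
  with c(4) that show ?thesis by blast
qed

theorem theorem2p3:
  fixes p \<epsilon> :: real
  assumes "0 < p" and "p \<le> 1/2" and "\<epsilon> > 0" and "(1 + \<epsilon>) * p < 1"
  shows "\<exists>c>0. \<exists>C>0. \<forall>n\<ge>2. \<forall>d\<ge>2. \<forall>t. is_threshold p d t \<longrightarrow>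
     exp (- c * min ((real n)\<^sup>2) (real n * sqrt (real d)))
       \<le> measure (sphere_points n d)
           {X \<in> space (sphere_points n d).
              real (card (rgg_edges n d t X)) \<ge> (1 + \<epsilon>) * real (n choose 2) * p} \<and>
     measure (sphere_points n d)
           {X \<in> space (sphere_points n d).
              real (card (rgg_edges n d t X)) \<ge> (1 + \<epsilon>) * real (n choose 2) * p}
       \<le> exp (- C * min ((real n)\<^sup>2) (real n * sqrt (real d)))"
proof -
  have eq: "measure (sphere_points n d) {X \<in> space (sphere_points n d).
        real (card (rgg_edges n d t X)) \<ge> (1 + \<epsilon>) * real (n choose 2) * p}
      = edge_tail n d t ((1 + \<epsilon>) * p * real (n choose 2))" for n d t
    unfolding measure_sphere_points_edges by (simp only: mult.assoc mult.commute[of _ p])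
  \<comment> \<open>The lower bound is taken with \<open>\<beta> = (1 + \<epsilon>) * p\<close>,
    below 1 by hypothesis.\<close>
  obtain c where c: "c > 0" and lower:
    "\<And>n d t. 2 \<le> n \<Longrightarrow> 2 \<le> d \<Longrightarrow> is_threshold p d t \<Longrightarrow>
      exp (- c * min ((real n)\<^sup>2) (real n * sqrt (real d))) \<le> edge_tail n d t ((1 + \<epsilon>) * p * real (n choose 2))"
    by (rule lower_tail[OF assms(1,2,4)]) (rule that)
  obtain C where C: "C > 0" and upper:
    "\<And>n d t. 2 \<le> n \<Longrightarrow> 2 \<le> d \<Longrightarrow> is_threshold p d t \<Longrightarrow>
      edge_tail n d t ((1 + \<epsilon>) * p * real (n choose 2))
      \<le> exp (- C * min ((real n)\<^sup>2) (real n * sqrt (real d)))"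
    by (rule upper_tail[OF assms]) (rule that)
  show ?thesis
    unfolding eq using c C lower upper by (intro exI[of _ c] exI[of _ C] conjI allI impI) simp_all
qed

end
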